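(* Let $2\le m\le n$, let $(P,\chi)$ be a set of affine evolution data, and let $\phi\in\mathcal C_P$. Then there exist $\epsilon>0$ and a unique real analytic family $\{\phi_t:t\in(-\epsilon,\epsilon)\}$ in $\mathcal C_P$ with $\phi_0=\phi$, satisfying $$\Bigl(\frac{d\phi_t}{dt}(x)\Bigr)^b=(\phi_t)_*(\chi(x))^{a_1\ldots a_{m-1}}(\mathrm{Re}\,\Omega)_{a_1\ldots a_{m-1}a_m}g^{a_mb}$$ for all $x\in\mathbb R^n$. Furthermore, $N=\{\phi_t(p):t\in(-\epsilon,\epsilon),\ p\in P\}$ is a special Lagrangian submanifold in $\mathbb C^m$ wherever it is nonsingular.
   Context: $\mathbb C^m$ has coordinates $(z_1,\dots,z_m)$, metric $g=\sum|dz_j|^2$, $2$-form $\omega=\frac i2\sum dz_j\wedge d\bar z_j$ and complex $m$-form $\Omega=dz_1\wedge\cdots\wedge dz_m$. An oriented real $m$-dimensional submanifold $L$ is special Lagrangian if $\mathrm{Re}\,\Omega|_{T_xL}=\mathrm{vol}_{T_xL}$ for all $x\in L$; a real $m$-dimensional submanifold admits an orientation making it special Lagrangian iff $\omega|_L\equiv0$ and $\mathrm{Im}\,\Omega|_L\equiv 0$. The index notation is for real tensors on $\mathbb C^m\cong\mathbb R^{2m}$, with summation over repeated indices. For an affine map $\phi_t$, $(\phi_t)_*$ is push-forward by its derivative (linear part). A set of affine evolution data is a pair $(P,\chi)$, where $P$ is an $(m-1)$-dimensional submanifold of $\mathbb R^n$ (possibly with singular points), and $\chi:\mathbb R^n\to\Lambda^{m-1}\mathbb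 R^n$ is an affine map such that $\chi(p)$ is a nonzero element of $\Lambda^{m-1}T_pP\subset\Lambda^{m-1}\mathbb R^n$ for each nonsingular point $p\in P$; moreover $P$ is not contained in any proper affine subspace of $\mathbb R^n$. $\mathcal C_P$ is the set of (real) affine maps $\phi\in\mathrm{Aff}(\mathbb R^n,\mathbb C^m)$ such that (i) $\phi^*(\omega)|_P\equiv 0$, and (ii) $d\phi|_{T_pP}:T_pP\to\mathbb C^m$ is injective for all $p$ in a dense open subset of $P$. *)

theory Defs
  imports "HOL-Analysis.Analysis"
begin

section \<open>Maps\<close>

definition affine_map :: "('a::real_vector \<Rightarrow> 'b::real_vector) \<Rightarrow> bool" where
  "affine_map f \<longleftrightarrow> (\<exists>L c. linear L \<and> f = (\<lambda>x. L x + c))"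

definition linear_part :: "('a::real_vector \<Rightarrow> 'b::real_vector) \<Rightarrow> 'a \<Rightarrow> 'b" where
  "linear_part f = (\<lambda>x. f x - f 0)"

definition real_analytic_on :: "(real \<Rightarrow> 'a::real_normed_vector) \<Rightarrow> real set \<Rightarrow> bool"
    (infix "real'_analytic'_on" 50) where
  "f real_analytic_on I \<longleftrightarrow>
     (\<forall>t\<^sub>0\<in>I. \<exists>r>0. \<exists>a :: nat \<Rightarrow> 'a.
        \<forall>t. \<bar>t - t\<^sub>0\<bar> < r \<longrightarrow> t \<in> I \<longrightarrow> (\<lambda>n. (t - t\<^sub>0) ^ n *\<^sub>R a n) sums f t)"

text \<open>The following two notions are meant for open \<open>U\<close> only.\<close>

fun Ck_on :: "nat \<Rightarrow> ('a::euclidean_space \<Rightarrow> 'b::euclidean_space) \<Rightarrow> 'a set \<Rightarrow> bool" where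
  "Ck_on 0 f U \<longleftrightarrow> continuous_on U f"
| "Ck_on (Suc k) f U \<longleftrightarrow>
     (\<forall>x\<in>U. f differentiable (at x)) \<and>
     (\<forall>v. Ck_on k (\<lambda>x. frechet_derivative f (at x) v) U)"

definition smooth_on :: "('a::euclidean_space \<Rightarrow> 'b::euclidean_space) \<Rightarrow> 'a set \<Rightarrow> bool"
    (infix "smooth'_on" 50) where
  "f smooth_on U \<longleftrightarrow> (\<forall>k. Ck_on k f U)"


section \<open>Submanifolds, possibly with singular points\<close>

text \<open>A point of \<open>P\<close> is nonsingular (for dimension \<open>k\<close>) if near it \<open>P\<close> is a smooth embedded
  \<open>k\<close>-dimensional submanifold: some diffeomorphism of open sets straightens \<open>P\<close> to a
  \<open>k\<close>-dimensional linear subspace.\<close>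

definition nonsingular_point :: "nat \<Rightarrow> 'a::euclidean_space set \<Rightarrow> 'a \<Rightarrow> bool" where
  "nonsingular_point k P p \<longleftrightarrow> p \<in> P \<and>
     (\<exists>U V F G S. open U \<and> p \<in> U \<and> open V \<and> homeomorphism U V F G \<and>
        F smooth_on U \<and> G smooth_on V \<and>
        subspace S \<and> dim S = k \<and> F ` (U \<inter> P) = V \<inter> (S :: 'a set))"

definition nonsingular_points :: "nat \<Rightarrow> 'a::euclidean_space set \<Rightarrow> 'a set" where
  "nonsingular_points k P = {p. nonsingular_point k P p}"

definition submanifold :: "nat \<Rightarrow> 'a::euclidean_space set \<Rightarrow> bool" where
  "submanifold k P \<longleftrightarrow> (\<forall>p\<in>P. nonsingular_point k P p)"

definition singular_submanifold :: "nat \<Rightarrow> 'a::euclidean_space set \<Rightarrow> bool" where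
  "singular_submanifold k P \<longleftrightarrow> P \<subseteq> closure (nonsingular_points k P)"

text \<open>Velocities of curves in \<open>P\<close>; used only at nonsingular points, where this is the usual
  tangent space.\<close>

definition tangent_space :: "'a::euclidean_space set \<Rightarrow> 'a \<Rightarrow> 'a set" where
  "tangent_space P p = {v. \<exists>\<gamma> :: real \<Rightarrow> 'a. \<gamma> 0 = p \<and>
     (\<exists>\<delta>>0. \<forall>t. \<bar>t\<bar> < \<delta> \<longrightarrow> \<gamma> t \<in> P) \<and> (\<gamma> has_vector_derivative v) (at 0)}"


section \<open>Multivectors as antisymmetric tensors\<close>

text \<open>A contravariant tensor of degree \<open>k\<close> on \<open>V\<close> is given by its components
  \<open>T\<close> at the multi-indices \<open>a\<^sub>1 \<dots> a\<^sub>k\<close>, an index being an element of the standard orthonormal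
  basis of \<open>V\<close>. The components at all other lists are set to 0, so that equality of tensors is
  equality of functions.\<close>

definition multi_indices :: "nat \<Rightarrow> 'a::euclidean_space list set" where
  "multi_indices k = {as. length as = k \<and> set as \<subseteq> Basis}"

text \<open>The tensor of \<open>v\<^sub>1 \<and> \<dots> \<and> v\<^sub>k\<close>, in the normalisation without a factor \<open>1/k!\<close>.\<close>

definition wedge :: "nat \<Rightarrow> 'a::euclidean_space list \<Rightarrow> 'a list \<Rightarrow> real" where
  "wedge k vs as =
     (if as \<in> multi_indices k
      then (\<Sum>\<sigma> | \<sigma> permutes {..<k}. of_int (sign \<sigma>) * (\<Prod>i<k. (vs ! \<sigma> i) \<bullet> (as ! i)))
      else 0)"

text \<open>\<open>\<Lambda>\<^sup>k W\<close> as a subspace of \<open>\<Lambda>\<^sup>k V\<close>, for a linear subspace \<open>W\<close> of \<open>V\<close>.\<close>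

definition Lambda :: "nat \<Rightarrow> 'a::euclidean_space set \<Rightarrow> ('a list \<Rightarrow> real) set" where
  "Lambda k W = {T. \<exists>(N::nat) c v. (\<forall>r<N. length (v r) = k \<and> set (v r) \<subseteq> W) \<and>
     T = (\<lambda>as. \<Sum>r<N. c r * wedge k (v r) as)}"

definition pushforward ::
    "nat \<Rightarrow> ('a::euclidean_space \<Rightarrow> 'b::euclidean_space) \<Rightarrow> ('a list \<Rightarrow> real) \<Rightarrow> 'b list \<Rightarrow> real" where
  "pushforward k L T bs =
     (if bs \<in> multi_indices k
      then (\<Sum>as\<in>multi_indices k. (\<Prod>i<k. L (as ! i) \<bullet> (bs ! i)) * T as)
      else 0)"


section \<open>The forms on complex Euclidean space\<close>

text \<open>The coordinates of \<open>\<complex>\<^sup>m\<close> are indexed by a linearly ordered type with \<open>m\<close> elements, which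
  is what makes \<open>dz\<^sub>1 \<and> \<dots> \<and> dz\<^sub>m\<close> well defined. The metric \<open>g\<close> is the inner product of
  \<open>complex ^ 'm\<close>.\<close>

definition omega :: "complex ^ 'm \<Rightarrow> complex ^ 'm \<Rightarrow> real" where
  "omega u v = Re (\<i> / 2 * (\<Sum>j\<in>UNIV. u $ j * cnj (v $ j) - v $ j * cnj (u $ j)))"

text \<open>The arguments are indexed by the coordinate type as well; \<open>by_position\<close> turns a list
  of \<open>m\<close> vectors into such a family in the order of the list.\<close>

definition Omega :: "('m::finite \<Rightarrow> complex ^ 'm) \<Rightarrow> complex" where
  "Omega v = det (\<chi> i j. v i $ j)"

definition by_position :: "'b list \<Rightarrow> 'm::{finite,linorder} \<Rightarrow> 'b" where
  "by_position vs i = vs ! card {j. j < i}"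

definition ReOmega_component :: "(complex ^ 'm::{finite,linorder}) list \<Rightarrow> real" where
  "ReOmega_component as = Re (Omega (by_position as))"

text \<open>The vector whose components are
  \<open>T\<^bsup>a\<^sub>1 \<dots> a\<^sub>m\<^sub>-\<^sub>1\<^esup> (Re \<Omega>)\<^bsub>a\<^sub>1 \<dots> a\<^sub>m\<^esub> g\<^bsup>a\<^sub>m b\<^esup>\<close>. The basis is orthonormal, so \<open>g\<^bsup>ab\<^esup> = a \<bullet> b\<close>.\<close>

definition contract_ReOmega ::
    "((complex ^ 'm::{finite,linorder}) list \<Rightarrow> real) \<Rightarrow> complex ^ 'm::{finite,linorder}" where
  "contract_ReOmega T =
     (\<Sum>b\<in>Basis. (\<Sum>as\<in>multi_indices (CARD('m) - 1). \<Sum>c\<in>Basis.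
        T as * ReOmega_component (as @ [c]) * (c \<bullet> b)) *\<^sub>R b)"


section \<open>Special Lagrangian submanifolds\<close>

text \<open>An orientation of \<open>L\<close> is recorded by an oriented orthonormal basis \<open>e x\<close> of each tangent
  space. The bases themselves need not vary continuously in \<open>x\<close>; the orientation they define must
  be given near every point by a continuous frame \<open>f\<close>. The determinant below is that of the
  change of basis from \<open>e y\<close> to \<open>f y\<close>.\<close>

definition oriented_by :: "(complex ^ 'm::finite) set \<Rightarrow>
    (complex ^ 'm \<Rightarrow> 'm \<Rightarrow> complex ^ 'm) \<Rightarrow> bool" where
  "oriented_by L e \<longleftrightarrow>
     (\<forall>x\<in>L. (\<forall>i j. e x i \<bullet> e x j = (if i = j then 1 else 0)) \<and>
            span (range (e x)) = tangent_space L x) \<and>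
     (\<forall>x\<in>L. \<exists>U f. open U \<and> x \<in> U \<and>
        (\<forall>i. continuous_on (L \<inter> U) (\<lambda>y. f y i)) \<and>
        (\<forall>y\<in>L \<inter> U. (\<forall>i. f y i \<in> tangent_space L y) \<and> det (\<chi> i j. f y i \<bullet> e y j) > 0))"

text \<open>The volume form of the oriented space with oriented orthonormal basis \<open>e\<close>.\<close>

definition vol_form :: "('m::finite \<Rightarrow> complex ^ 'm) \<Rightarrow> ('m \<Rightarrow> complex ^ 'm) \<Rightarrow> real" where
  "vol_form e v = det (\<chi> i j. v i \<bullet> e j)"

definition special_lagrangian :: "(complex ^ 'm::finite) set \<Rightarrow>
    (complex ^ 'm \<Rightarrow> 'm \<Rightarrow> complex ^ 'm) \<Rightarrow> bool" where
  "special_lagrangian L e \<longleftrightarrow> submanifold CARD('m) L \<and> oriented_by L e \<and>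
     (\<forall>x\<in>L. \<forall>v. (\<forall>i. v i \<in> tangent_space L x) \<longrightarrow> Re (Omega v) = vol_form (e x) v)"


section \<open>Affine evolution data\<close>

text \<open>Here \<open>m\<close> is the complex dimension of the target, so \<open>P\<close> has dimension \<open>m - 1\<close>. Affineness
  of \<open>chi\<close>, whose values are functions, is stated componentwise.\<close>

definition affine_evolution_data ::
    "nat \<Rightarrow> (real ^ 'n) set \<Rightarrow> (real ^ 'n \<Rightarrow> (real ^ 'n) list \<Rightarrow> real) \<Rightarrow> bool" where
  "affine_evolution_data m P chi \<longleftrightarrow>
     singular_submanifold (m - 1) P \<and>
     (\<forall>x. chi x \<in> Lambda (m - 1) UNIV) \<and>
     (\<forall>as. affine_map (\<lambda>x. chi x as)) \<and>
     (\<forall>p\<in>nonsingular_points (m - 1) P.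
        chi p \<in> Lambda (m - 1) (tangent_space P p) \<and> chi p \<noteq> (\<lambda>_. 0)) \<and>
     (\<forall>A. affine A \<and> P \<subseteq> A \<longrightarrow> A = UNIV)"

definition C_set :: "(real ^ 'n) set \<Rightarrow> (real ^ 'n \<Rightarrow> complex ^ 'm) set" where
  "C_set P = {\<phi>. affine_map \<phi> \<and>
     (\<forall>p\<in>nonsingular_points (CARD('m) - 1) P.
        \<forall>u\<in>tangent_space P p. \<forall>v\<in>tangent_space P p.
          omega (linear_part \<phi> u) (linear_part \<phi> v) = 0) \<and>
     (\<exists>D. openin (top_of_set P) D \<and> P \<subseteq> closure D \<and>
        (\<forall>p\<in>D. nonsingular_point (CARD('m) - 1) P p \<and>
               inj_on (linear_part \<phi>) (tangent_space P p)))}"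

definition evolution_family :: "(real ^ 'n) set \<Rightarrow> (real ^ 'n \<Rightarrow> (real ^ 'n) list \<Rightarrow> real) \<Rightarrow>
    (real ^ 'n \<Rightarrow> complex ^ 'm::{finite,linorder}) \<Rightarrow> real \<Rightarrow>
    (real \<Rightarrow> real ^ 'n \<Rightarrow> complex ^ 'm::{finite,linorder}) \<Rightarrow> bool" where
  "evolution_family P chi \<phi> \<epsilon> \<Phi> \<longleftrightarrow>
     (\<forall>t\<in>{-\<epsilon><..<\<epsilon>}. \<Phi> t \<in> C_set P) \<and>
     (\<forall>x. (\<lambda>t. \<Phi> t x) real_analytic_on {-\<epsilon><..<\<epsilon>}) \<and>
     \<Phi> 0 = \<phi> \<and>
     (\<forall>t\<in>{-\<epsilon><..<\<epsilon>}. \<forall>x. ((\<lambda>s. \<Phi> s x) has_vector_derivative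
        contract_ReOmega (pushforward (CARD('m) - 1) (linear_part (\<Phi> t)) (chi x))) (at t))"

end

theory Submission
  imports Defs
begin

text \<open>The velocity \<open>\<Phi>'\<^sub>t(x)\<close> prescribed by the evolution equation is affine in \<open>x\<close> and polynomial in the
  linear part of \<open>\<Phi>\<^sub>t\<close>. So the equation is an autonomous polynomial differential equation for the
  finitely many coordinates of an affine map. Power series solve it near any initial value, because
  the majorants of a formal solution stay bounded on a small disc
  (\<open>poly_ode_local_analytic_solution\<close>), and Gronwall's inequality gives uniqueness
  (\<open>poly_ode_unique\<close>). Every solution is then real analytic: near each time it is the local series
  solution that starts there (\<open>evolves_analytic\<close>).

  Let \<open>p\<close> be a nonsingular point, \<open>W\<close> the tangent space of \<open>P\<close> at \<open>p\<close>, \<open>L\<close> the linear part of the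
  map and \<open>X\<close> its velocity at \<open>p\<close>. As \<open>dim W = m - 1\<close>, the multivector \<open>chi p\<close> is a nonzero multiple
  of \<open>e\<^sub>1 \<and> \<dots> \<and> e\<^sub>m\<^sub>-\<^sub>1\<close> for a basis of \<open>W\<close>, and hence
  \<open>X \<bullet> y = K Re \<Omega>(L e\<^sub>1, \<dots>, L e\<^sub>m\<^sub>-\<^sub>1, y)\<close> with a real \<open>K \<noteq> 0\<close>. Everything pointwise follows from this
  formula (\<open>velocity_properties\<close>). Taking \<open>y\<close> in the complex span of \<open>L W\<close> gives \<open>X \<bullet> L w = 0\<close> and
  \<open>omega X (L w) = 0\<close>; taking \<open>y = i X\<close> gives \<open>Im \<Omega>(L e\<^sub>1, \<dots>, L e\<^sub>m\<^sub>-\<^sub>1, X) = 0\<close>. If \<open>X \<noteq> 0\<close> then \<open>L\<close>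
  is injective on \<open>W\<close>; the converse holds if \<open>L W\<close> is isotropic, since then real independence of
  vectors in \<open>L W\<close> implies complex independence.

  Both conditions that define \<open>C_set P\<close> persist. Isotropy does because \<open>omega X (L w) = 0\<close> holds along
  \<open>P\<close>: differentiating it along \<open>P\<close> and antisymmetrising removes the second derivatives of the
  chart and shows that the pull-back of \<open>omega\<close> to \<open>P\<close> has zero time derivative
  (\<open>omega_pullback_stationary\<close>). This is the statement that \<open>\<omega>\<close> is closed, in disguise. Immersivity on a
  dense set does because of uniqueness: if \<open>X\<close> vanished at one time on a relatively open piece of
  \<open>P\<close>, then the map would be stationary on the affine hull of the piece at that time, hence at all
  times, and the initial map would fail to be injective there (\<open>velocity_zero_persists\<close>,
  \<open>immersed_points_dense\<close>).

  Let \<open>N\<close> be the union of the images of \<open>P\<close>. At a nonsingular point \<open>\<Phi>\<^sub>t(p)\<close> of \<open>N\<close> with \<open>X \<noteq> 0\<close> the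
  tangent space contains \<open>X\<close> and \<open>L W\<close>, so by dimension it is their span, where \<open>\<omega>\<close> and \<open>Im \<Omega>\<close>
  vanish. Such points are dense in \<open>N\<close> and tangent spaces depend continuously on the point, so both
  forms vanish on all tangent spaces at nonsingular points (\<open>swept_special_lagrangian\<close>). On such a
  plane \<open>\<Omega>\<close> has the value \<open>1\<close> or \<open>-1\<close> at an orthonormal basis. Choosing the sign \<open>1\<close> orients the plane,
  and the sign of \<open>Re \<Omega>\<close> on a continuous tangent frame shows that the orientation is continuous
  (\<open>special_lagrangian_if_tangent_planes\<close>).\<close>


section \<open>Analytic solutions of polynomial differential equations\<close>

text \<open>The set \<open>M\<close> lists monomials: \<open>\<mu>\<close> stands for the product of the \<open>k\<close> coordinates \<open>idx \<mu> i\<close>. The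
  coefficients come from any commutative semiring so that the same polynomial can be evaluated at
  numbers and at formal power series.\<close>

definition poly_field ::
    "'i set \<Rightarrow> nat \<Rightarrow> ('j \<Rightarrow> 'i \<Rightarrow> 'a::comm_semiring_1) \<Rightarrow> ('i \<Rightarrow> nat \<Rightarrow> 'j) \<Rightarrow> ('j \<Rightarrow> 'a) \<Rightarrow> 'j \<Rightarrow> 'a" where
  "poly_field M k C idx y j = (\<Sum>\<mu>\<in>M. C j \<mu> * (\<Prod>i<k. y (idx \<mu> i)))"

definition fps_agree :: "nat \<Rightarrow> 'a::zero fps \<Rightarrow> 'a fps \<Rightarrow> bool" where
  "fps_agree n f g \<longleftrightarrow> (\<forall>i<n. fps_nth f i = fps_nth g i)"

lemma fps_agree_mult:
  fixes f g :: "real fps"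
  assumes "fps_agree n f f'" "fps_agree n g g'"
  shows "fps_agree n (f * g) (f' * g')"
  using assms unfolding fps_agree_def fps_mult_nth by (auto intro!: sum.cong)

lemma fps_agree_prod:
  fixes f g :: "'b \<Rightarrow> real fps"
  assumes "\<And>i. i \<in> A \<Longrightarrow> fps_agree n (f i) (g i)"
  shows "fps_agree n (prod f A) (prod g A)"
  using assms
proof (induction A rule: infinite_finite_induct)
  case (insert x F)
  then show ?case by (simp add: fps_agree_mult)
qed (auto simp: fps_agree_def)

lemma fps_agree_poly_field:
  fixes C :: "'j \<Rightarrow> 'i \<Rightarrow> real fps"
  assumes "\<And>j. fps_agree n (Y j) (Z j)"
  shows "fps_agree n (poly_field M k C idx Y j) (poly_field M k C idx Z j)"
proof -
  have "fps_agree n (C j \<mu> * (\<Prod>i<k. Y (idx \<mu> i))) (C j \<mu> * (\<Prod>i<k. Z (idx \<mu> i)))" for \<mu>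
    by (intro fps_agree_mult fps_agree_prod assms) (simp add: fps_agree_def)
  then show ?thesis
    unfolding poly_field_def fps_agree_def fps_sum_nth by (auto intro!: sum.cong)
qed

text \<open>Picard iteration: integration raises by one the degree up to which two series agree, so in each
  degree the iterates are eventually constant, and the limit is a fixed point.\<close>

lemma fps_poly_ode_exists:
  fixes C :: "'j \<Rightarrow> 'i \<Rightarrow> real fps" and c :: "'j \<Rightarrow> real"
  obtains Y where "\<And>j. Y j = fps_integral (poly_field M k C idx Y j) (c j)"
proof -
  define T where "T Y = (\<lambda>j. fps_integral (poly_field M k C idx Y j) (c j))" for Y
  have step: "fps_agree (Suc n) (T Y j) (T Z j)" if "\<And>j. fps_agree n (Y j) (Z j)" for n Y Z j
  proof -
    have "fps_agree n (poly_field M k C idx Y j) (poly_field M k C idx Z j)"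
      by (rule fps_agree_poly_field) (rule that)
    then show ?thesis
      unfolding T_def fps_agree_def fps_integral_def by (auto simp: less_Suc_eq_0_disj)
  qed
  define Z where "Z n = (T ^^ n) (\<lambda>_. 0)" for n
  have Z_agree: "fps_agree n (Z (n + d) j) (Z n j)" for n d j
  proof (induction n arbitrary: j)
    case 0 then show ?case by (simp add: fps_agree_def)
  next
    case (Suc n)
    show ?case using step[of n "Z (n + d)" "Z n" j] Suc by (simp add: Z_def)
  qed
  define Y where "Y j = Abs_fps (\<lambda>i. fps_nth (Z (Suc i) j) i)" for j
  have Y_agree: "fps_agree n (Y j) (Z n j)" for n j
    unfolding fps_agree_def
  proof (intro allI impI)
    fix i assume "i < n"
    then obtain d where "n = Suc i + d" using less_imp_Suc_add by auto
    then show "fps_nth (Y j) i = fps_nth (Z n j) i"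
      using Z_agree[of "Suc i" d j] by (simp add: fps_agree_def Y_def)
  qed
  have "Y j = T Y j" for j
  proof (rule fps_ext)
    fix n
    have "fps_agree (Suc n) (T Y j) (T (Z n) j)" by (rule step) (rule Y_agree)
    then show "fps_nth (Y j) n = fps_nth (T Y j) n"
      by (simp add: fps_agree_def Y_def Z_def)
  qed
  then show ?thesis using that unfolding T_def by blast
qed

text \<open>The truncation makes the estimates below available by induction on \<open>n\<close>, before anything is known
  about convergence.\<close>

definition majorant :: "real \<Rightarrow> nat \<Rightarrow> real fps \<Rightarrow> real" where
  "majorant R n f = (\<Sum>i<n. \<bar>fps_nth f i\<bar> * R ^ i)"

lemma majorant_nonneg: "0 \<le> R \<Longrightarrow> 0 \<le> majorant R n f"
  by (simp add: majorant_def sum_nonneg)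

lemma majorant_mult:
  assumes "0 \<le> R"
  shows "majorant R n (f * g) \<le> majorant R n f * majorant R n g"
proof -
  let ?a = "\<lambda>i. \<bar>fps_nth f i\<bar> * R ^ i" and ?b = "\<lambda>i. \<bar>fps_nth g i\<bar> * R ^ i"
  have "majorant R n (f * g) \<le> (\<Sum>i<n. \<Sum>j\<le>i. ?a j * ?b (i - j))"
    unfolding majorant_def
  proof (rule sum_mono)
    fix i
    have "\<bar>fps_nth (f * g) i\<bar> * R ^ i \<le> (\<Sum>j=0..i. \<bar>fps_nth f j * fps_nth g (i - j)\<bar>) * R ^ i"
      unfolding fps_mult_nth using assms by (intro mult_right_mono sum_abs) auto
    also have "\<dots> = (\<Sum>j=0..i. ?a j * ?b (i - j))"
      unfolding sum_distrib_right
      by (rule sum.cong) (auto simp: abs_mult algebra_simps simp flip: power_add)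
    finally show "\<bar>fps_nth (f * g) i\<bar> * R ^ i \<le> (\<Sum>j\<le>i. ?a j * ?b (i - j))"
      by (simp add: atLeast0AtMost)
  qed
  also have "\<dots> = (\<Sum>(j,l)\<in>{(j,l). j + l < n}. ?a j * ?b l)"
    by (rule sum.triangle_reindex[symmetric])
  also have "\<dots> \<le> (\<Sum>(j,l)\<in>{..<n}\<times>{..<n}. ?a j * ?b l)"
    by (rule sum_mono2) (use assms in auto)
  also have "\<dots> = majorant R n f * majorant R n g"
    unfolding majorant_def sum_product sum.cartesian_product ..
  finally show ?thesis .
qed

lemma majorant_add:
  assumes "0 \<le> R" shows "majorant R n (f + g) \<le> majorant R n f + majorant R n g"
  unfolding majorant_def sum.distrib[symmetric]
  using assms by (intro sum_mono) (auto simp flip: distrib_right intro!: mult_right_mono)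

lemma majorant_sum:
  assumes "0 \<le> R" shows "majorant R n (sum f A) \<le> (\<Sum>a\<in>A. majorant R n (f a))"
proof (induction A rule: infinite_finite_induct)
  case (insert x F)
  then show ?case using majorant_add[OF assms, of n "f x" "sum f F"] by simp
qed (auto simp: majorant_def)

lemma majorant_const: "majorant R n (fps_const c) \<le> \<bar>c\<bar>"
proof -
  have "majorant R n (fps_const c) = (\<Sum>i<n. if i = 0 then \<bar>c\<bar> else 0)"
    unfolding majorant_def by (rule sum.cong) auto
  then show ?thesis by (simp add: sum.delta)
qed

lemma majorant_prod:
  assumes "0 \<le> R" "\<And>i. i < k \<Longrightarrow> majorant R n (f i) \<le> B" "0 \<le> B"
  shows "majorant R n (\<Prod>i<k. f i) \<le> B ^ k"
  using assms(2)
proof (induction k)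
  case 0
  show ?case using majorant_const[of R n 1] by simp
next
  case (Suc k)
  have "majorant R n (\<Prod>i<Suc k. f i) \<le> majorant R n (\<Prod>i<k. f i) * majorant R n (f k)"
    using majorant_mult[OF assms(1)] by simp
  also have "\<dots> \<le> B ^ k * B"
    using Suc assms by (intro mult_mono) (auto intro: majorant_nonneg)
  finally show ?case by (simp add: mult.commute)
qed

text \<open>The bound gains a factor \<open>R\<close> and one degree, which makes an induction along the Picard equation
  possible.\<close>

lemma majorant_integral:
  assumes "0 \<le> R"
  shows "majorant R (Suc n) (fps_integral f c) \<le> \<bar>c\<bar> + R * majorant R n f"
proof -
  have "majorant R (Suc n) (fps_integral f c)
      = \<bar>c\<bar> + (\<Sum>i<n. inverse (real (Suc i)) * \<bar>fps_nth f i\<bar> * R ^ Suc i)"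
    unfolding majorant_def sum.lessThan_Suc_shift by (simp add: abs_mult del: of_nat_Suc power_Suc)
  also have "\<dots> \<le> \<bar>c\<bar> + (\<Sum>i<n. \<bar>fps_nth f i\<bar> * R ^ Suc i)"
    using assms by (intro add_left_mono sum_mono mult_right_mono)
      (auto intro!: mult_left_le_one_le simp: inverse_le_1_iff simp del: of_nat_Suc)
  finally show ?thesis by (simp add: majorant_def sum_distrib_left mult_ac)
qed

lemma eval_fps_intros:
  fixes f g :: "real fps"
  assumes "ereal (norm t) < fps_conv_radius f" "ereal (norm t) < fps_conv_radius g"
  shows "ereal (norm t) < fps_conv_radius (f * g)" "eval_fps (f * g) t = eval_fps f t * eval_fps g t"
    "ereal (norm t) < fps_conv_radius (f + g)" "eval_fps (f + g) t = eval_fps f t + eval_fps g t"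
proof -
  have m: "ereal (norm t) < min (fps_conv_radius f) (fps_conv_radius g)" using assms by simp
  show "ereal (norm t) < fps_conv_radius (f * g)" "ereal (norm t) < fps_conv_radius (f + g)"
    by (rule less_le_trans[OF m fps_conv_radius_mult] less_le_trans[OF m fps_conv_radius_add])+
qed (use assms in \<open>simp_all add: eval_fps_mult eval_fps_add\<close>)

lemma eval_fps_prod:
  fixes f :: "'b \<Rightarrow> real fps"
  assumes "\<And>i. i \<in> A \<Longrightarrow> ereal (norm t) < fps_conv_radius (f i)"
  shows "ereal (norm t) < fps_conv_radius (prod f A) \<and>
    eval_fps (prod f A) t = (\<Prod>i\<in>A. eval_fps (f i) t)"
  using assms
proof (induction A rule: infinite_finite_induct)
  case (insert x F)
  then have "ereal (norm t) < fps_conv_radius (f x)" "ereal (norm t) < fps_conv_radius (prod f F)"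
    "eval_fps (prod f F) t = (\<Prod>i\<in>F. eval_fps (f i) t)" by auto
  then show ?case
    using eval_fps_intros[of t "f x" "prod f F"] insert.hyps by simp
qed auto

lemma eval_fps_sum:
  fixes f :: "'b \<Rightarrow> real fps"
  assumes "\<And>i. i \<in> A \<Longrightarrow> ereal (norm t) < fps_conv_radius (f i)"
  shows "ereal (norm t) < fps_conv_radius (sum f A) \<and>
    eval_fps (sum f A) t = (\<Sum>i\<in>A. eval_fps (f i) t)"
  using assms
proof (induction A rule: infinite_finite_induct)
  case (insert x F)
  then have "ereal (norm t) < fps_conv_radius (f x)" "ereal (norm t) < fps_conv_radius (sum f F)"
    "eval_fps (sum f F) t = (\<Sum>i\<in>F. eval_fps (f i) t)" by auto
  then show ?case
    using eval_fps_intros[of t "f x" "sum f F"] insert.hyps by simp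
qed auto

lemma eval_fps_poly_field:
  fixes C :: "'j \<Rightarrow> 'i \<Rightarrow> real"
  assumes "\<And>\<mu> i. \<mu> \<in> M \<Longrightarrow> i < k \<Longrightarrow> ereal (norm t) < fps_conv_radius (Y (idx \<mu> i))"
  shows "eval_fps (poly_field M k (\<lambda>j \<mu>. fps_const (C j \<mu>)) idx Y j) t
       = poly_field M k C idx (\<lambda>j. eval_fps (Y j) t) j"
proof -
  let ?p = "\<lambda>\<mu>. \<Prod>i<k. Y (idx \<mu> i)"
  have p: "ereal (norm t) < fps_conv_radius (?p \<mu>) \<and> eval_fps (?p \<mu>) t = (\<Prod>i<k. eval_fps (Y (idx \<mu> i)) t)"
    if "\<mu> \<in> M" for \<mu>
    by (rule eval_fps_prod) (use that assms in auto)
  have q: "ereal (norm t) < fps_conv_radius (fps_const (C j \<mu>) * ?p \<mu>) \<and>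
     eval_fps (fps_const (C j \<mu>) * ?p \<mu>) t = C j \<mu> * (\<Prod>i<k. eval_fps (Y (idx \<mu> i)) t)"
    if "\<mu> \<in> M" for \<mu>
    using p[OF that] eval_fps_intros[of t "fps_const (C j \<mu>)" "?p \<mu>"] by simp
  show ?thesis
    unfolding poly_field_def using eval_fps_sum[of M t "\<lambda>\<mu>. fps_const (C j \<mu>) * ?p \<mu>"] q
    by (auto intro!: sum.cong)
qed

text \<open>The majorants of a formal solution satisfy \<open>M\<^sub>n\<^sub>+\<^sub>1 \<le> b + R K M\<^sub>n\<^sup>k\<close>, where \<open>b\<close> bounds the initial values
  and \<open>K\<close> the coefficients. The bound \<open>M\<^sub>n \<le> b + 1\<close> is reproduced as soon as \<open>R K (b + 1)\<^sup>k \<le> 1\<close>, and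
  then the series converge for \<open>\<bar>t\<bar> < R\<close>.\<close>

lemma poly_ode_local_analytic_solution:
  fixes C :: "'j \<Rightarrow> 'i \<Rightarrow> real" and c :: "'j \<Rightarrow> real"
  assumes J: "finite J" and idx: "\<And>\<mu> i. \<mu> \<in> M \<Longrightarrow> i < k \<Longrightarrow> idx \<mu> i \<in> J"
  obtains R a where "R > 0" "\<And>j. a j 0 = c j"
    "\<And>j t. j \<in> J \<Longrightarrow> \<bar>t\<bar> < R \<Longrightarrow> summable (\<lambda>n. a j n * t ^ n)"
    "\<And>j t. j \<in> J \<Longrightarrow> \<bar>t\<bar> < R \<Longrightarrow> ((\<lambda>t. \<Sum>n. a j n * t ^ n) has_real_derivative
        poly_field M k C idx (\<lambda>j. \<Sum>n. a j n * t ^ n) j) (at t)"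
proof -
  obtain Y where Y: "\<And>j. Y j = fps_integral (poly_field M k (\<lambda>j \<mu>. fps_const (C j \<mu>)) idx Y j) (c j)"
    using fps_poly_ode_exists[of M k "\<lambda>j \<mu>. fps_const (C j \<mu>)" idx c] by blast
  define b where "b = (\<Sum>j\<in>J. \<bar>c j\<bar>)"
  define K where "K = (\<Sum>j\<in>J. \<Sum>\<mu>\<in>M. \<bar>C j \<mu>\<bar>)"
  define B where "B = b + 1"
  define R where "R = 1 / (K * B ^ k + 1)"
  have b: "\<bar>c j\<bar> \<le> b" if "j \<in> J" for j
    unfolding b_def using that J by (intro member_le_sum) auto
  have K: "(\<Sum>\<mu>\<in>M. \<bar>C j \<mu>\<bar>) \<le> K" if "j \<in> J" for j
    unfolding K_def using that J by (intro member_le_sum) (auto intro: sum_nonneg)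
  have pos: "0 \<le> b" "0 \<le> K" "0 < B" by (auto simp: b_def K_def B_def intro!: sum_nonneg add_nonneg_pos)
  have KB: "0 < K * B ^ k + 1" using pos by (simp add: add_nonneg_pos)
  then have R: "0 < R" by (simp add: R_def)
  have RK: "R * (K * B ^ k) \<le> 1" using KB by (simp add: R_def)
  have bound: "majorant R n (Y j) \<le> B" if "j \<in> J" for n j
    using that
  proof (induction n arbitrary: j)
    case 0 then show ?case using pos by (simp add: majorant_def)
  next
    case (Suc n)
    let ?p = "poly_field M k (\<lambda>j \<mu>. fps_const (C j \<mu>)) idx Y j"
    have "majorant R n ?p \<le> (\<Sum>\<mu>\<in>M. \<bar>C j \<mu>\<bar> * B ^ k)"
      unfolding poly_field_def
    proof (rule order.trans[OF majorant_sum sum_mono])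
      fix \<mu> assume "\<mu> \<in> M"
      have "majorant R n (fps_const (C j \<mu>) * (\<Prod>i<k. Y (idx \<mu> i)))
          \<le> majorant R n (fps_const (C j \<mu>)) * majorant R n (\<Prod>i<k. Y (idx \<mu> i))"
        using R by (intro majorant_mult) auto
      also have "\<dots> \<le> \<bar>C j \<mu>\<bar> * B ^ k"
        using R Suc.IH idx[OF \<open>\<mu> \<in> M\<close>] pos
        by (intro mult_mono majorant_const majorant_prod) (auto intro!: majorant_nonneg)
      finally show "majorant R n (fps_const (C j \<mu>) * (\<Prod>i<k. Y (idx \<mu> i))) \<le> \<bar>C j \<mu>\<bar> * B ^ k" .
    qed (use R in auto)
    also have "\<dots> \<le> K * B ^ k"
      unfolding sum_distrib_right[symmetric] using K[OF Suc.prems] pos by (intro mult_right_mono) auto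
    finally have "R * majorant R n ?p \<le> R * (K * B ^ k)" using R by (intro mult_left_mono) auto
    moreover have "majorant R (Suc n) (Y j) \<le> \<bar>c j\<bar> + R * majorant R n ?p"
      by (subst Y) (rule majorant_integral, use R in simp)
    ultimately show ?case using b[OF Suc.prems] RK unfolding B_def by linarith
  qed
  have "summable (\<lambda>n. \<bar>fps_nth (Y j) n\<bar> * R ^ n)" if "j \<in> J" for j
  proof (rule bounded_imp_summable)
    show "(\<Sum>i\<le>n. \<bar>fps_nth (Y j) i\<bar> * R ^ i) \<le> B" for n
      using bound[OF that, of "Suc n"] by (simp add: majorant_def lessThan_Suc_atMost)
  qed (use R in auto)
  then have "summable (\<lambda>n. fps_nth (Y j) n * R ^ n)" if "j \<in> J" for j
    using that R by (intro summable_norm_cancel[of "\<lambda>n. fps_nth (Y j) n * R ^ n"]) (simp add: abs_mult)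
  then have radR: "ereal (norm R) \<le> fps_conv_radius (Y j)" if "j \<in> J" for j
    unfolding fps_conv_radius_def using that by (intro conv_radius_geI)
  have rad: "ereal (norm t) < fps_conv_radius (Y j)" if "j \<in> J" "\<bar>t\<bar> < R" for j t
    using less_le_trans[OF _ radR[OF that(1)], of "ereal (norm t)"] that(2) R by simp
  have deriv: "(eval_fps (Y j) has_real_derivative poly_field M k C idx (\<lambda>j. eval_fps (Y j) t) j) (at t)"
    if "j \<in> J" "\<bar>t\<bar> < R" for j t
  proof -
    have "(eval_fps (Y j) has_real_derivative eval_fps (fps_deriv (Y j)) t) (at t)"
      using rad[OF that] by (intro has_field_derivative_eval_fps) auto
    also have "fps_deriv (Y j) = poly_field M k (\<lambda>j \<mu>. fps_const (C j \<mu>)) idx Y j"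
      by (subst Y) (rule fps_deriv_fps_integral)
    also have "eval_fps \<dots> t = poly_field M k C idx (\<lambda>j. eval_fps (Y j) t) j"
      by (rule eval_fps_poly_field) (use rad idx that in auto)
    finally show ?thesis .
  qed
  show ?thesis
  proof (rule that[of R "\<lambda>j n. fps_nth (Y j) n"])
    show "fps_nth (Y j) 0 = c j" for j by (subst Y) simp
    show "summable (\<lambda>n. fps_nth (Y j) n * t ^ n)" if "j \<in> J" "\<bar>t\<bar> < R" for j t
      using rad[OF that] by (intro summable_fps) auto
  qed (use R deriv in \<open>auto simp: eval_fps_def[abs_def]\<close>)
qed

text \<open>The function \<open>g s * exp (- K * s)\<close> is nonincreasing.\<close>

lemma gronwall_zero_forward:
  fixes g :: "real \<Rightarrow> real"
  assumes "a \<le> b" "g a = 0" "0 \<le> g b"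
    and "\<And>s. a \<le> s \<Longrightarrow> s \<le> b \<Longrightarrow> (g has_real_derivative g' s) (at s)"
    and "\<And>s. a \<le> s \<Longrightarrow> s \<le> b \<Longrightarrow> g' s \<le> K * g s"
  shows "g b = 0"
proof -
  have "g b * exp (- K * b) \<le> g a * exp (- K * a)"
  proof (rule DERIV_nonpos_imp_nonincreasing[OF assms(1)], intro exI conjI)
    fix s assume s: "a \<le> s" "s \<le> b"
    show "((\<lambda>s. g s * exp (- K * s)) has_real_derivative (g' s - K * g s) * exp (- K * s)) (at s)"
      using assms(4)[OF s] by (auto intro!: derivative_eq_intros simp: algebra_simps)
    show "(g' s - K * g s) * exp (- K * s) \<le> 0"
      using assms(5)[OF s] by (simp add: mult_nonpos_nonneg)
  qed
  then have "g b \<le> 0" using assms(2) by (simp add: mult_le_0_iff)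
  then show ?thesis using assms(3) by simp
qed

lemma gronwall_zero:
  fixes g :: "real \<Rightarrow> real"
  assumes "g a = 0" "0 \<le> g b"
    and "\<And>s. s \<in> closed_segment a b \<Longrightarrow> (g has_real_derivative g' s) (at s)"
    and "\<And>s. s \<in> closed_segment a b \<Longrightarrow> \<bar>g' s\<bar> \<le> K * g s"
  shows "g b = 0"
proof (cases "a \<le> b")
  case True
  show ?thesis
    by (rule gronwall_zero_forward[OF True, of g g' K])
      (use assms True in \<open>auto simp: closed_segment_eq_real_ivl abs_le_iff\<close>)
next
  case False
  have "g (- (- b)) = 0"
  proof (rule gronwall_zero_forward[of "- a" "- b" "\<lambda>s. g (- s)" "\<lambda>s. - g' (- s)" K])
    fix s assume "- a \<le> s" "s \<le> - b"
    then have s: "- s \<in> closed_segment a b" by (auto simp: closed_segment_eq_real_ivl)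
    show "((\<lambda>s. g (- s)) has_real_derivative - g' (- s)) (at s)"
      using DERIV_chain2[of g "g' (- s)" uminus s "-1" UNIV, OF assms(3)[OF s]]
      by (simp add: DERIV_minus[OF DERIV_ident])
    show "- g' (- s) \<le> K * g (- s)" using assms(4)[OF s] by (simp add: abs_le_iff)
  qed (use assms False in auto)
  then show ?thesis by simp
qed

text \<open>The factors are exchanged one at a time.\<close>

lemma prod_diff_le:
  fixes a b :: "nat \<Rightarrow> real"
  assumes "1 \<le> B" "\<And>i. i < k \<Longrightarrow> \<bar>a i\<bar> \<le> B" "\<And>i. i < k \<Longrightarrow> \<bar>b i\<bar> \<le> B"
  shows "\<bar>(\<Prod>i<k. a i) - (\<Prod>i<k. b i)\<bar> \<le> B ^ k * (\<Sum>i<k. \<bar>a i - b i\<bar>)"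
  using assms(2,3)
proof (induction k)
  case (Suc k)
  let ?A = "\<Prod>i<k. a i" and ?B = "\<Prod>i<k. b i" and ?S = "\<Sum>i<k. \<bar>a i - b i\<bar>"
  have B0: "0 \<le> B" using assms(1) by simp
  have IH: "\<bar>?A - ?B\<bar> \<le> B ^ k * ?S" using Suc by simp
  have "(\<Prod>i<k. \<bar>a i\<bar>) \<le> (\<Prod>i<k. B)"
    using Suc.prems(1) by (intro prod_mono) (auto simp: less_Suc_eq)
  then have A: "\<bar>?A\<bar> \<le> B ^ k" by (simp add: abs_prod)
  have "(\<Prod>i<Suc k. a i) - (\<Prod>i<Suc k. b i) = (a k - b k) * ?A + b k * (?A - ?B)"
    by (simp add: algebra_simps)
  then have "\<bar>(\<Prod>i<Suc k. a i) - (\<Prod>i<Suc k. b i)\<bar> \<le> \<bar>a k - b k\<bar> * \<bar>?A\<bar> + \<bar>b k\<bar> * \<bar>?A - ?B\<bar>"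
    by (metis abs_mult abs_triangle_ineq)
  also have "\<dots> \<le> \<bar>a k - b k\<bar> * B ^ k + B * (B ^ k * ?S)"
    using A IH Suc.prems(2)[of k] B0 by (intro add_mono mult_mono) auto
  also have "\<dots> \<le> \<bar>a k - b k\<bar> * B ^ Suc k + B * (B ^ k * ?S)"
    using assms(1) B0 by (intro add_right_mono mult_left_mono power_increasing) auto
  finally show ?case by (simp add: algebra_simps)
qed simp

lemma poly_field_lipschitz:
  fixes C :: "'j \<Rightarrow> 'i \<Rightarrow> real"
  assumes J: "finite J" and idx: "\<And>\<mu> i. \<mu> \<in> M \<Longrightarrow> i < k \<Longrightarrow> idx \<mu> i \<in> J" and B: "1 \<le> B"
  obtains K where "0 \<le> K" "\<And>y z j. j \<in> J \<Longrightarrow> (\<And>i. i \<in> J \<Longrightarrow> \<bar>y i\<bar> \<le> B \<and> \<bar>z i\<bar> \<le> B) \<Longrightarrow>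
    \<bar>poly_field M k C idx y j - poly_field M k C idx z j\<bar> \<le> K * (\<Sum>i\<in>J. \<bar>y i - z i\<bar>)"
proof
  define K where "K = (\<Sum>j\<in>J. \<Sum>\<mu>\<in>M. \<bar>C j \<mu>\<bar> * (B ^ k * real k))"
  show "0 \<le> K" unfolding K_def using B by (intro sum_nonneg) auto
  fix y z j assume j: "j \<in> J" and yz: "\<And>i. i \<in> J \<Longrightarrow> \<bar>y i\<bar> \<le> B \<and> \<bar>z i\<bar> \<le> B"
  let ?S = "\<Sum>i\<in>J. \<bar>y i - z i\<bar>"
  have S0: "0 \<le> ?S" by (simp add: sum_nonneg)
  have "\<bar>poly_field M k C idx y j - poly_field M k C idx z j\<bar>
      \<le> (\<Sum>\<mu>\<in>M. \<bar>C j \<mu> * ((\<Prod>i<k. y (idx \<mu> i)) - (\<Prod>i<k. z (idx \<mu> i)))\<bar>)"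
    unfolding poly_field_def sum_subtractf[symmetric] right_diff_distrib[symmetric] by (rule sum_abs)
  also have "\<dots> \<le> (\<Sum>\<mu>\<in>M. \<bar>C j \<mu>\<bar> * (B ^ k * real k) * ?S)"
  proof (rule sum_mono)
    fix \<mu> assume \<mu>: "\<mu> \<in> M"
    have "\<bar>(\<Prod>i<k. y (idx \<mu> i)) - (\<Prod>i<k. z (idx \<mu> i))\<bar>
        \<le> B ^ k * (\<Sum>i<k. \<bar>y (idx \<mu> i) - z (idx \<mu> i)\<bar>)"
      using yz idx[OF \<mu>] by (intro prod_diff_le B) auto
    also have "\<dots> \<le> B ^ k * (\<Sum>i<k. ?S)"
      using B J idx[OF \<mu>] by (intro mult_left_mono sum_mono member_le_sum) auto
    finally have "\<bar>(\<Prod>i<k. y (idx \<mu> i)) - (\<Prod>i<k. z (idx \<mu> i))\<bar> \<le> B ^ k * real k * ?S" by simp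
    from mult_left_mono[OF this, of "\<bar>C j \<mu>\<bar>"]
    show "\<bar>C j \<mu> * ((\<Prod>i<k. y (idx \<mu> i)) - (\<Prod>i<k. z (idx \<mu> i)))\<bar> \<le> \<bar>C j \<mu>\<bar> * (B ^ k * real k) * ?S"
      by (simp add: abs_mult mult_ac)
  qed
  also have "\<dots> = (\<Sum>\<mu>\<in>M. \<bar>C j \<mu>\<bar> * (B ^ k * real k)) * ?S" by (simp add: sum_distrib_right)
  also have "\<dots> \<le> K * ?S"
    unfolding K_def using B J j S0 by (intro mult_right_mono member_le_sum sum_nonneg) auto
  finally show "\<bar>poly_field M k C idx y j - poly_field M k C idx z j\<bar> \<le> K * ?S" .
qed

text \<open>On the compact segment both solutions stay in a box where the field is Lipschitz, so Gronwall's
  inequality applies to the square of their distance.\<close>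

lemma poly_ode_unique:
  fixes C :: "'j \<Rightarrow> 'i \<Rightarrow> real" and y z :: "real \<Rightarrow> 'j \<Rightarrow> real"
  assumes J: "finite J" and idx: "\<And>\<mu> i. \<mu> \<in> M \<Longrightarrow> i < k \<Longrightarrow> idx \<mu> i \<in> J"
    and y: "\<And>s j. s \<in> closed_segment a b \<Longrightarrow> j \<in> J \<Longrightarrow>
      ((\<lambda>s. y s j) has_real_derivative poly_field M k C idx (y s) j) (at s)"
    and z: "\<And>s j. s \<in> closed_segment a b \<Longrightarrow> j \<in> J \<Longrightarrow>
      ((\<lambda>s. z s j) has_real_derivative poly_field M k C idx (z s) j) (at s)"
    and init: "\<And>j. j \<in> J \<Longrightarrow> y a j = z a j" and j: "j \<in> J"
  shows "y b j = z b j"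
proof -
  let ?I = "closed_segment a b"
  have bdd: "\<exists>B. \<forall>s\<in>?I. \<forall>j\<in>J. \<bar>w s j\<bar> \<le> B"
    if w: "\<And>s j. s \<in> ?I \<Longrightarrow> j \<in> J \<Longrightarrow> ((\<lambda>s. w s j) has_real_derivative d s j) (at s)" for w d
  proof -
    have "continuous_on ?I (\<lambda>s. \<Sum>j\<in>J. \<bar>w s j\<bar>)"
      using w by (intro continuous_intros) (meson DERIV_isCont continuous_at_imp_continuous_on)
    then have "bounded ((\<lambda>s. \<Sum>j\<in>J. \<bar>w s j\<bar>) ` ?I)"
      by (intro compact_imp_bounded compact_continuous_image) auto
    then obtain B where B: "\<And>s. s \<in> ?I \<Longrightarrow> norm (\<Sum>j\<in>J. \<bar>w s j\<bar>) \<le> B" by (auto simp: bounded_iff)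
    have "\<bar>w s j\<bar> \<le> B" if "s \<in> ?I" "j \<in> J" for s j
    proof -
      have "\<bar>w s j\<bar> \<le> (\<Sum>j\<in>J. \<bar>w s j\<bar>)" using that J by (intro member_le_sum) auto
      then show ?thesis using B[OF that(1)] by simp
    qed
    then show ?thesis by blast
  qed
  obtain By where By: "\<And>s j. s \<in> ?I \<Longrightarrow> j \<in> J \<Longrightarrow> \<bar>y s j\<bar> \<le> By" using bdd[of y, OF y] by blast
  obtain Bz where Bz: "\<And>s j. s \<in> ?I \<Longrightarrow> j \<in> J \<Longrightarrow> \<bar>z s j\<bar> \<le> Bz" using bdd[of z, OF z] by blast
  define B where "B = max 1 (max By Bz)"
  have B: "\<bar>y s j\<bar> \<le> B \<and> \<bar>z s j\<bar> \<le> B" if "s \<in> ?I" "j \<in> J" for s j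
    using By[OF that] Bz[OF that] by (auto simp: B_def)
  obtain K where K: "0 \<le> K" "\<And>y z j. j \<in> J \<Longrightarrow> (\<And>i. i \<in> J \<Longrightarrow> \<bar>y i\<bar> \<le> B \<and> \<bar>z i\<bar> \<le> B) \<Longrightarrow>
    \<bar>poly_field M k C idx y j - poly_field M k C idx z j\<bar> \<le> K * (\<Sum>i\<in>J. \<bar>y i - z i\<bar>)"
    using poly_field_lipschitz[OF J, of M k idx B C] idx by (auto simp: B_def)
  let ?d = "\<lambda>s j. y s j - z s j"
  let ?f = "\<lambda>s j. poly_field M k C idx (y s) j - poly_field M k C idx (z s) j"
  define g where "g s = (\<Sum>j\<in>J. (?d s j)\<^sup>2)" for s
  have "g b = 0"
  proof (rule gronwall_zero[of g a b "\<lambda>s. \<Sum>j\<in>J. 2 * ?d s j * ?f s j" "2 * K * real (card J)"])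
    show "g a = 0" by (simp add: g_def init)
    show "0 \<le> g b" by (simp add: g_def sum_nonneg)
    fix s assume s: "s \<in> ?I"
    show "(g has_real_derivative (\<Sum>j\<in>J. 2 * ?d s j * ?f s j)) (at s)"
      unfolding g_def using y[OF s] z[OF s]
      by (auto intro!: derivative_eq_intros sum.cong simp: algebra_simps)
    have "\<bar>\<Sum>j\<in>J. 2 * ?d s j * ?f s j\<bar> \<le> (\<Sum>j\<in>J. 2 * \<bar>?d s j\<bar> * (K * (\<Sum>i\<in>J. \<bar>?d s i\<bar>)))"
    proof (rule order.trans[OF sum_abs sum_mono])
      fix j assume "j \<in> J"
      then have "\<bar>?f s j\<bar> \<le> K * (\<Sum>i\<in>J. \<bar>?d s i\<bar>)" using K(2) B[OF s] by blast
      from mult_left_mono[OF this, of "2 * \<bar>?d s j\<bar>"]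
      show "\<bar>2 * ?d s j * ?f s j\<bar> \<le> 2 * \<bar>?d s j\<bar> * (K * (\<Sum>i\<in>J. \<bar>?d s i\<bar>))"
        by (simp add: abs_mult del: right_diff_distrib_numeral)
    qed
    also have "\<dots> = 2 * K * (\<Sum>i\<in>J. \<bar>?d s i\<bar>)\<^sup>2"
      by (simp add: power2_eq_square sum_distrib_left sum_distrib_right mult_ac)
    also have "(\<Sum>i\<in>J. \<bar>?d s i\<bar>)\<^sup>2 \<le> (\<Sum>i\<in>J. \<bar>?d s i\<bar>\<^sup>2) * (\<Sum>i\<in>J. 1\<^sup>2)"
      using Cauchy_Schwarz_ineq_sum[of "\<lambda>i. \<bar>?d s i\<bar>" "\<lambda>_. 1" J] by simp
    finally have "\<bar>\<Sum>j\<in>J. 2 * ?d s j * ?f s j\<bar> \<le> 2 * K * ((\<Sum>i\<in>J. \<bar>?d s i\<bar>\<^sup>2) * (\<Sum>i\<in>J. 1\<^sup>2))"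
      using K(1) by (simp add: mult_left_mono)
    then show "\<bar>\<Sum>j\<in>J. 2 * ?d s j * ?f s j\<bar> \<le> 2 * K * real (card J) * g s"
      by (simp add: g_def mult_ac)
  qed
  then show ?thesis using j J by (simp add: g_def sum_nonneg_eq_0_iff)
qed


section \<open>Multilinear and alternating functions of lists\<close>

text \<open>Recursion on the first slot turns expansions in a basis into inductions on the length of the list.\<close>

fun multilinear :: "nat \<Rightarrow> ('a::real_vector list \<Rightarrow> real) \<Rightarrow> bool" where
  "multilinear 0 f \<longleftrightarrow> True"
| "multilinear (Suc k) f \<longleftrightarrow>
     (\<forall>vs. length vs = k \<longrightarrow> linear (\<lambda>x. f (x # vs))) \<and> (\<forall>x. multilinear k (\<lambda>vs. f (x # vs)))"

definition alternating :: "nat \<Rightarrow> ('a list \<Rightarrow> real) \<Rightarrow> bool" where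
  "alternating k f \<longleftrightarrow> (\<forall>vs \<sigma>. length vs = k \<longrightarrow> \<sigma> permutes {..<k} \<longrightarrow>
     f (permute_list \<sigma> vs) = of_int (sign \<sigma>) * f vs)"

lemma multilinearI:
  assumes "\<And>vs i. length vs = k \<Longrightarrow> i < k \<Longrightarrow> linear (\<lambda>x. f (vs[i := x]))"
  shows "multilinear k f"
  using assms
proof (induction k arbitrary: f)
  case (Suc k)
  have "linear (\<lambda>x. f (x # vs))" if "length vs = k" for vs
    using Suc.prems[of "0 # vs" 0] that by simp
  moreover have "multilinear k (\<lambda>vs. f (x # vs))" for x
  proof (rule Suc.IH)
    fix vs :: "'a list" and i assume "length vs = k" "i < k"
    then show "linear (\<lambda>y. f (x # vs[i := y]))" using Suc.prems[of "x # vs" "Suc i"] by simp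
  qed
  ultimately show ?case by simp
qed simp

lemma multilinear_cmult: "multilinear k f \<Longrightarrow> multilinear k (\<lambda>vs. c * f vs)"
proof (induction k arbitrary: f)
  case (Suc k)
  have "linear (\<lambda>x. c * g x)" if "linear g" for g :: "'a \<Rightarrow> real"
    using linear_compose_scale_right[OF that, of c] by simp
  then show ?case using Suc by simp
qed simp

lemma multilinear_sum: "(\<And>a. a \<in> A \<Longrightarrow> multilinear k (f a)) \<Longrightarrow> multilinear k (\<lambda>vs. \<Sum>a\<in>A. f a vs)"
  by (induction k arbitrary: f) (auto intro: linear_compose_sum)

lemma multilinear_prod_inner:
  fixes c :: "nat \<Rightarrow> 'a::real_inner"
  shows "multilinear k (\<lambda>vs. \<Prod>i<k. (vs ! i) \<bullet> c i)"
proof (induction k arbitrary: c)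
  case (Suc k)
  have eq: "(\<Prod>i<Suc k. ((x # vs) ! i) \<bullet> c i) = (x \<bullet> c 0) * (\<Prod>i<k. (vs ! i) \<bullet> c (Suc i))" for x vs
    by (subst prod.lessThan_Suc_shift) simp
  show ?case unfolding multilinear.simps eq
    using multilinear_cmult[OF Suc.IH[of "\<lambda>i. c (Suc i)"]]
    by (auto intro!: linearI simp: inner_add_left distrib_right)
qed simp

lemma lists_Suc: "{as. length as = Suc k \<and> set as \<subseteq> B} = (\<lambda>(b, as). b # as) ` (B \<times> {as. length as = k \<and> set as \<subseteq> B})"
  by (auto simp: length_Suc_conv image_iff)

text \<open>Only the given vectors have to be resolved by \<open>B\<close>. So \<open>B\<close> can be the standard basis of the whole
  space, but also an orthonormal basis of a tangent space that contains the vectors.\<close>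

lemma multilinear_expansion:
  fixes f :: "'a::real_inner list \<Rightarrow> real"
  assumes "multilinear k f" "length vs = k" "finite B" "\<And>v. v \<in> set vs \<Longrightarrow> v = (\<Sum>b\<in>B. (v \<bullet> b) *\<^sub>R b)"
  shows "f vs = (\<Sum>as | length as = k \<and> set as \<subseteq> B. (\<Prod>i<k. (vs ! i) \<bullet> (as ! i)) * f as)"
  using assms(1,2,4)
proof (induction k arbitrary: f vs)
  case 0
  have "{as. as = [] \<and> set as \<subseteq> B} = {[]}" by auto
  then show ?case using 0 by simp
next
  case (Suc k)
  then obtain x xs where vs: "vs = x # xs" "length xs = k" by (auto simp: length_Suc_conv)
  let ?L = "{as. length as = k \<and> set as \<subseteq> B}"
  have lin: "linear (\<lambda>x. f (x # xs))" using Suc.prems vs by simp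
  have x: "x = (\<Sum>b\<in>B. (x \<bullet> b) *\<^sub>R b)" using Suc.prems vs by simp
  have "f vs = f ((\<Sum>b\<in>B. (x \<bullet> b) *\<^sub>R b) # xs)" using x vs by simp
  also have "\<dots> = (\<Sum>b\<in>B. (x \<bullet> b) * f (b # xs))"
    using linear_sum[OF lin, of "\<lambda>b. (x \<bullet> b) *\<^sub>R b" B] linear_scale[OF lin] by simp
  also have "\<dots> = (\<Sum>b\<in>B. \<Sum>as\<in>?L. (x \<bullet> b) * ((\<Prod>i<k. (xs ! i) \<bullet> (as ! i)) * f (b # as)))"
    using Suc.IH[of "\<lambda>vs. f (b # vs)" xs for b] Suc.prems vs by (simp add: sum_distrib_left)
  also have "\<dots> = (\<Sum>(b, as)\<in>B \<times> ?L. (\<Prod>i<Suc k. (vs ! i) \<bullet> ((b # as) ! i)) * f (b # as))"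
    unfolding sum.cartesian_product
    by (intro sum.cong) (auto simp: vs prod.lessThan_Suc_shift mult.assoc simp del: prod.lessThan_Suc)
  also have "\<dots> = (\<Sum>as | length as = Suc k \<and> set as \<subseteq> B. (\<Prod>i<Suc k. (vs ! i) \<bullet> (as ! i)) * f as)"
    unfolding lists_Suc by (subst sum.reindex) (auto simp: inj_on_def case_prod_unfold)
  finally show ?case .
qed

text \<open>Transpositions generate the symmetric group.\<close>

lemma alternatingI:
  assumes "\<And>vs i j. length vs = k \<Longrightarrow> i < k \<Longrightarrow> j < k \<Longrightarrow> i \<noteq> j \<Longrightarrow>
    f (permute_list (Transposition.transpose i j) vs) = - f vs"
  shows "alternating k f"
  unfolding alternating_def
proof (intro allI impI)
  fix vs :: "'a list" and \<sigma> assume vs: "length vs = k" and \<sigma>: "\<sigma> permutes {..<k}"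
  have fin: "finite {..<k}" by simp
  show "f (permute_list \<sigma> vs) = of_int (sign \<sigma>) * f vs"
    using \<sigma> fin vs
  proof (induction arbitrary: vs rule: permutes_induct)
    case (swap i j p)
    then have "f (permute_list (Transposition.transpose i j \<circ> p) vs) = f (permute_list p (permute_list (Transposition.transpose i j) vs))"
      by (simp add: permute_list_compose)
    also have "\<dots> = of_int (sign p) * - f vs"
      using swap assms[of vs i j] by simp
    also have "of_int (sign p) * - f vs = of_int (sign (Transposition.transpose i j \<circ> p)) * f vs"
      using swap by (subst sign_compose) (auto simp: sign_swap_id permutation_swap_id intro: permutes_imp_permutation[OF finite_lessThan])
    finally show ?case .
  qed simp
qed

lemma alternating_not_distinct:
  assumes "alternating k f" "length vs = k" "\<not> distinct vs"
  shows "f vs = 0"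
proof -
  obtain i j where ij: "i < k" "j < k" "i \<noteq> j" "vs ! i = vs ! j"
    using assms by (auto simp: distinct_conv_nth)
  have perm: "Transposition.transpose i j permutes {..<k}" using ij by (simp add: permutes_swap_id)
  have "permute_list (Transposition.transpose i j) vs = vs"
    by (rule nth_equalityI) (use ij perm assms in \<open>auto simp: permute_list_nth Transposition.transpose_def\<close>)
  then have "f vs = - f vs"
    using assms perm ij by (metis alternating_def mult_minus1 of_int_1 of_int_minus sign_swap_id)
  then show ?thesis by simp
qed

lemma alternating_basis_lists:
  assumes es: "distinct es" "length es = k" and as: "length as = k" "set as \<subseteq> set es"
  obtains s :: real where "\<And>f. alternating k f \<Longrightarrow> f as = s * f es"
proof (cases "distinct as")
  case True
  have "set as = set es"
    using as es True by (intro card_subset_eq) (auto simp: distinct_card)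
  then have "mset as = mset es" using True es by (simp add: set_eq_iff_mset_eq_distinct)
  then obtain p where "p permutes {..<length es}" "permute_list p es = as"
    using mset_eq_permutation by blast
  then show ?thesis using that[of "of_int (sign p)"] es by (auto simp: alternating_def)
next
  case False
  then show ?thesis using that[of 0] alternating_not_distinct as by force
qed

text \<open>Alternating forms of top degree on a space form a line: \<open>d\<close> is the determinant of the coordinates of
  \<open>vs\<close> with respect to \<open>es\<close>. It is essential that the same \<open>d\<close> serves all \<open>f\<close>, since this compares a
  wedge product with the form \<open>Re \<Omega>\<close>.\<close>

lemma alternating_top_degree:
  fixes es :: "'a::real_inner list"
  assumes es: "distinct es" "length es = k"
    and vs: "length vs = k" "\<And>v. v \<in> set vs \<Longrightarrow> v = (\<Sum>b\<in>set es. (v \<bullet> b) *\<^sub>R b)"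
  obtains d where "\<And>f. multilinear k f \<Longrightarrow> alternating k f \<Longrightarrow> f vs = d * f es"
proof -
  let ?L = "{as. length as = k \<and> set as \<subseteq> set es}"
  have "\<exists>s. \<forall>f. alternating k f \<longrightarrow> f as = s * f es" if "as \<in> ?L" for as
    using alternating_basis_lists[of es k as] es that by (metis (mono_tags, lifting) mem_Collect_eq)
  then obtain s where s: "\<And>as f. as \<in> ?L \<Longrightarrow> alternating k f \<Longrightarrow> f as = s as * f es" by metis
  show ?thesis
  proof (rule that)
    fix f :: "'a list \<Rightarrow> real" assume f: "multilinear k f" "alternating k f"
    have "f vs = (\<Sum>as\<in>?L. (\<Prod>i<k. (vs ! i) \<bullet> (as ! i)) * f as)"
      using vs by (intro multilinear_expansion f) auto
    also have "\<dots> = (\<Sum>as\<in>?L. (\<Prod>i<k. (vs ! i) \<bullet> (as ! i)) * (s as * f es))"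
      by (intro sum.cong) (auto simp: s[OF _ f(2)])
    also have "\<dots> = (\<Sum>as\<in>?L. (\<Prod>i<k. (vs ! i) \<bullet> (as ! i)) * s as) * f es"
      by (simp add: sum_distrib_right mult.assoc)
    finally show "f vs = (\<Sum>as\<in>?L. (\<Prod>i<k. (vs ! i) \<bullet> (as ! i)) * s as) * f es" .
  qed
qed

text \<open>For each permutation \<open>\<sigma>\<close> in the wedge product the sum over \<open>as\<close> reassembles \<open>f\<close> at the permuted
  vectors, whose sign cancels that of \<open>\<sigma>\<close>. So \<open>k!\<close> equal terms remain.\<close>

lemma sum_wedge_times_alternating:
  fixes f :: "'a::euclidean_space list \<Rightarrow> real"
  assumes f: "multilinear k f" "alternating k f" and vs: "length vs = k"
  shows "(\<Sum>as\<in>multi_indices k. wedge k vs as * f as) = fact k * f vs"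
proof -
  let ?S = "{\<sigma>. \<sigma> permutes {..<k}}"
  have "(\<Sum>as\<in>multi_indices k. wedge k vs as * f as)
      = (\<Sum>as\<in>multi_indices k. \<Sum>\<sigma>\<in>?S. of_int (sign \<sigma>) * ((\<Prod>i<k. (vs ! \<sigma> i) \<bullet> (as ! i)) * f as))"
    by (intro sum.cong refl) (auto simp: wedge_def sum_distrib_right mult.assoc)
  also have "\<dots> = (\<Sum>\<sigma>\<in>?S. of_int (sign \<sigma>) * (\<Sum>as\<in>multi_indices k. (\<Prod>i<k. (vs ! \<sigma> i) \<bullet> (as ! i)) * f as))"
    by (subst sum.swap) (simp add: sum_distrib_left)
  also have "\<dots> = (\<Sum>\<sigma>\<in>?S. f vs)"
  proof (intro sum.cong refl)
    fix \<sigma> assume "\<sigma> \<in> ?S"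
    then have \<sigma>: "\<sigma> permutes {..<k}" by simp
    have "f (permute_list \<sigma> vs)
        = (\<Sum>as\<in>multi_indices k. (\<Prod>i<k. (permute_list \<sigma> vs ! i) \<bullet> (as ! i)) * f as)"
      unfolding multi_indices_def using vs
      by (intro multilinear_expansion f) (auto simp: euclidean_representation)
    also have "\<dots> = (\<Sum>as\<in>multi_indices k. (\<Prod>i<k. (vs ! \<sigma> i) \<bullet> (as ! i)) * f as)"
      using \<sigma> vs by (simp add: permute_list_nth)
    finally have "(\<Sum>as\<in>multi_indices k. (\<Prod>i<k. (vs ! \<sigma> i) \<bullet> (as ! i)) * f as) = of_int (sign \<sigma>) * f vs"
      using f(2) \<sigma> vs by (simp add: alternating_def)
    then show "of_int (sign \<sigma>) * (\<Sum>as\<in>multi_indices k. (\<Prod>i<k. (vs ! \<sigma> i) \<bullet> (as ! i)) * f as) = f vs"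
      by (simp flip: mult.assoc of_int_mult)
  qed
  also have "\<dots> = fact k * f vs" by (simp add: card_permutations)
  finally show ?thesis .
qed

lemma multilinear_wedge: "multilinear k (\<lambda>vs. wedge k vs as)"
proof (cases "as \<in> multi_indices k")
  case True
  have "(\<Prod>i<k. (vs ! \<sigma> i) \<bullet> (as ! i)) = (\<Prod>i<k. (vs ! i) \<bullet> (as ! inv \<sigma> i))" if "\<sigma> permutes {..<k}" for \<sigma> vs
    using prod.permute[OF that, of "\<lambda>i. (vs ! i) \<bullet> (as ! inv \<sigma> i)"] that
    by (simp add: permutes_inverses(2) comp_def)
  then show ?thesis
    using True by (auto simp: wedge_def intro!: multilinear_sum multilinear_cmult multilinear_prod_inner)
next
  case False
  have "multilinear k (\<lambda>_. 0)" by (rule multilinearI) (simp add: linear_zero)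
  with False show ?thesis by (simp add: wedge_def)
qed

lemma alternating_wedge: "alternating k (\<lambda>vs. wedge k vs as)"
  unfolding alternating_def
proof (intro allI impI)
  fix vs :: "'a list" and \<tau> assume vs: "length vs = k" and \<tau>: "\<tau> permutes {..<k}"
  let ?S = "{\<sigma>. \<sigma> permutes {..<k}}"
  let ?p = "\<lambda>\<sigma>. \<Prod>i<k. (vs ! \<sigma> i) \<bullet> (as ! i)"
  have "(\<Sum>\<sigma>\<in>?S. of_int (sign \<sigma>) * (\<Prod>i<k. (permute_list \<tau> vs ! \<sigma> i) \<bullet> (as ! i)))
      = (\<Sum>\<sigma>\<in>?S. of_int (sign \<tau>) * (of_int (sign (\<tau> \<circ> \<sigma>)) * ?p (\<tau> \<circ> \<sigma>)))"
  proof (intro sum.cong refl)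
    fix \<sigma> assume "\<sigma> \<in> ?S"
    then have \<sigma>: "\<sigma> permutes {..<k}" by simp
    have "sign (\<tau> \<circ> \<sigma>) = sign \<tau> * sign \<sigma>"
      using \<tau> \<sigma> by (intro sign_compose) (auto intro: permutes_imp_permutation[OF finite_lessThan])
    moreover have "(\<Prod>i<k. (permute_list \<tau> vs ! \<sigma> i) \<bullet> (as ! i)) = ?p (\<tau> \<circ> \<sigma>)"
      using \<tau> vs permutes_in_image[OF \<sigma>] by (intro prod.cong) (auto simp: permute_list_nth)
    ultimately show "of_int (sign \<sigma>) * (\<Prod>i<k. (permute_list \<tau> vs ! \<sigma> i) \<bullet> (as ! i))
        = of_int (sign \<tau>) * (of_int (sign (\<tau> \<circ> \<sigma>)) * ?p (\<tau> \<circ> \<sigma>))"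
      by (simp flip: mult.assoc of_int_mult)
  qed
  also have "\<dots> = of_int (sign \<tau>) * (\<Sum>\<sigma>\<in>?S. of_int (sign \<sigma>) * ?p \<sigma>)"
    unfolding sum_distrib_left[symmetric]
    by (subst setum_permutations_compose_left[OF \<tau>, of "\<lambda>\<sigma>. of_int (sign \<sigma>) * ?p \<sigma>"]) (rule refl)
  finally show "wedge k (permute_list \<tau> vs) as = of_int (sign \<tau>) * wedge k vs as"
    by (simp add: wedge_def)
qed

lemma orthonormal_expansion:
  fixes v :: "'a::real_inner"
  assumes B: "pairwise orthogonal B" "\<And>b. b \<in> B \<Longrightarrow> norm b = 1" "finite B" and v: "v \<in> span B"
  shows "(\<Sum>b\<in>B. (v \<bullet> b) *\<^sub>R b) = v"
proof -
  have lin: "linear (\<lambda>v. \<Sum>b\<in>B. (v \<bullet> b) *\<^sub>R b)"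
    by (rule linearI) (simp_all add: inner_add_left scaleR_add_left sum.distrib scaleR_sum_right)
  have "(\<Sum>b\<in>B. (a \<bullet> b) *\<^sub>R b) = a" if a: "a \<in> B" for a
  proof -
    have "(\<Sum>b\<in>B. (a \<bullet> b) *\<^sub>R b) = (\<Sum>b\<in>B. if b = a then a else 0)"
    proof (intro sum.cong refl)
      fix b assume b: "b \<in> B"
      have "a \<bullet> a = 1" using B(2)[OF a] by (simp add: norm_eq_1)
      moreover have "b \<noteq> a \<Longrightarrow> a \<bullet> b = 0" using B(1) a b by (auto simp: pairwise_def orthogonal_def)
      ultimately show "(a \<bullet> b) *\<^sub>R b = (if b = a then a else 0)" by auto
    qed
    then show ?thesis using B(3) a by simp
  qed
  from linear_eq_on_span[OF lin linear_ident this v] show ?thesis by simp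
qed

text \<open>The components of a wedge product are alternating multilinear functions of its factors, so every
  wedge product of vectors of \<open>W\<close> is a multiple of that of a basis.\<close>

lemma Lambda_top_degree:
  fixes W :: "'a::euclidean_space set"
  assumes W: "subspace W" "dim W = k" and T: "T \<in> Lambda k W"
  obtains es K where "length es = k" "distinct es" "set es \<subseteq> W" "span (set es) = W" "independent (set es)"
    "T = (\<lambda>as. K * wedge k es as)"
proof -
  obtain B where B: "B \<subseteq> W" "pairwise orthogonal B" "\<And>x. x \<in> B \<Longrightarrow> norm x = 1"
    "independent B" "card B = k" "span B = W"
    using orthonormal_basis_subspace[OF W(1)] W(2) by metis
  have "finite B" using B independent_bound by blast
  then obtain es where es: "set es = B" "distinct es" using finite_distinct_list by blast
  then have len: "length es = k" using B distinct_card by force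
  have rep: "v = (\<Sum>b\<in>set es. (v \<bullet> b) *\<^sub>R b)" if "v \<in> W" for v
    using orthonormal_expansion[OF B(2,3) \<open>finite B\<close>, of v] that B(6) es(1) by simp
  obtain N :: nat and c v where v: "\<And>r. r < N \<Longrightarrow> length (v r) = k \<and> set (v r) \<subseteq> W"
    and T': "T = (\<lambda>as. \<Sum>r<N. c r * wedge k (v r) as)"
    using T unfolding Lambda_def by blast
  have "\<exists>d. \<forall>f. multilinear k f \<longrightarrow> alternating k f \<longrightarrow> f (v r) = d * f es" if "r < N" for r
    using alternating_top_degree[of es k "v r"] es len v[OF that] rep by (metis subsetD)
  then obtain d where d: "\<And>r f. r < N \<Longrightarrow> multilinear k f \<Longrightarrow> alternating k f \<Longrightarrow> f (v r) = d r * f es"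
    by metis
  have "T = (\<lambda>as. (\<Sum>r<N. c r * d r) * wedge k es as)"
  proof
    fix as
    show "T as = (\<Sum>r<N. c r * d r) * wedge k es as"
      unfolding T' sum_distrib_right
      using d[OF _ multilinear_wedge[of k as] alternating_wedge[of k as]] by (intro sum.cong) auto
  qed
  then show ?thesis using that[of es] es len B by auto
qed

lemma sum_lessThan_add_split: "(\<Sum>r<a + b. g r) = (\<Sum>r<a. g r) + (\<Sum>r<b. g (a + r))"
  for g :: "nat \<Rightarrow> real"
  by (induction b) (auto simp: add.assoc)

lemma Lambda_linear_combination:
  assumes "finite I" "\<And>i. i \<in> I \<Longrightarrow> T i \<in> Lambda k W"
  shows "(\<lambda>as. \<Sum>i\<in>I. u i * T i as) \<in> Lambda k W"
  using assms
proof (induction I)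
  case empty
  show ?case unfolding Lambda_def by (auto intro!: exI[of _ "0::nat"])
next
  case (insert x I)
  obtain N :: nat and c v where 1: "\<And>r. r < N \<Longrightarrow> length (v r) = k \<and> set (v r) \<subseteq> W"
    "(\<lambda>as. \<Sum>i\<in>I. u i * T i as) = (\<lambda>as. \<Sum>r<N. c r * wedge k (v r) as)"
    using insert unfolding Lambda_def by blast
  obtain N' :: nat and c' v' where 2: "\<And>r. r < N' \<Longrightarrow> length (v' r) = k \<and> set (v' r) \<subseteq> W"
    "T x = (\<lambda>as. \<Sum>r<N'. c' r * wedge k (v' r) as)"
    using insert.prems unfolding Lambda_def by blast
  let ?c = "\<lambda>r. if r < N then c r else u x * c' (r - N)" and ?v = "\<lambda>r. if r < N then v r else v' (r - N)"
  have "(\<Sum>r<N + N'. ?c r * wedge k (?v r) as) = (\<Sum>i\<in>insert x I. u i * T i as)" for as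
  proof -
    have "(\<Sum>r<N + N'. ?c r * wedge k (?v r) as)
        = (\<Sum>r<N. ?c r * wedge k (?v r) as) + (\<Sum>r<N'. ?c (N + r) * wedge k (?v (N + r)) as)"
      by (subst sum_lessThan_add_split) simp
    also have "\<dots> = (\<Sum>i\<in>I. u i * T i as) + u x * T x as"
      using fun_cong[OF 1(2), of as] 2(2) by (simp add: sum_distrib_left mult.assoc)
    finally show ?thesis using insert.hyps by (simp add: add.commute)
  qed
  moreover have "length (?v r) = k \<and> set (?v r) \<subseteq> W" if "r < N + N'" for r
    using 1(1)[of r] 2(1)[of "r - N"] that by auto
  ultimately show ?case unfolding Lambda_def
    by (intro CollectI exI[of _ "N + N'"] exI[of _ ?c] exI[of _ ?v]) (auto simp: fun_eq_iff)
qed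

lemma multilinear_compose_linear:
  assumes "linear L" "multilinear k f"
  shows "multilinear k (\<lambda>vs. f (map L vs))"
  using assms(2)
proof (induction k arbitrary: f)
  case (Suc k)
  have "linear (\<lambda>x. f (L x # vs))" if "length vs = k" for vs
    using linear_compose[OF assms(1), of "\<lambda>x. f (x # vs)"] Suc.prems that by (simp add: comp_def)
  moreover have "multilinear k (\<lambda>vs. f (L x # map L vs))" for x
    using Suc.IH[of "\<lambda>vs. f (L x # vs)"] Suc.prems by simp
  ultimately show ?case by simp
qed simp

lemma alternating_compose:
  assumes "alternating k f" shows "alternating k (\<lambda>vs. f (map L vs))"
  using assms by (auto simp: alternating_def permute_list_map[symmetric])

section \<open>The holomorphic volume form and its contraction\<close>

text \<open>The function \<open>by_position\<close> puts entry \<open>n\<close> of a list at the coordinate that has \<open>n\<close> smaller ones. This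
  enumeration of the coordinates translates permutations of lists into permutations of rows.\<close>

lemma position_bij: "bij_betw (\<lambda>i::'m::{finite,linorder}. card {j. j < i}) UNIV {..<CARD('m)}"
proof -
  let ?p = "\<lambda>i::'m. card {j. j < i}"
  have less: "?p i < ?p j" if "i < j" for i j :: 'm
    using that by (intro psubset_card_mono) auto
  have inj: "inj ?p" by (intro injI) (metis less less_irrefl linorder_less_linear)
  have "?p i < CARD('m)" for i by (intro psubset_card_mono) auto
  then have "range ?p \<subseteq> {..<CARD('m)}" by auto
  then have "range ?p = {..<CARD('m)}"
    using inj by (intro card_subset_eq) (auto simp: card_image)
  with inj show ?thesis by (simp add: bij_betw_def)
qed

lemma position_less: "card {j. j < (i::'m::{finite,linorder})} < CARD('m)"
  using bij_betwE[OF position_bij] by auto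

lemma obtain_position:
  assumes "n < CARD('m::{finite,linorder})"
  obtains i :: "'m::{finite,linorder}" where "card {j. j < i} = n" "\<And>i'. card {j. j < i'} = n \<longleftrightarrow> i' = i"
proof -
  have "n \<in> (\<lambda>i::'m. card {j. j < i}) ` UNIV"
    using position_bij[where 'm = 'm] assms by (simp add: bij_betw_def)
  then obtain i :: 'm where "card {j. j < i} = n" by auto
  moreover have "inj (\<lambda>i::'m. card {j. j < i})"
    using position_bij[where 'm = 'm] by (simp add: bij_betw_def)
  ultimately show ?thesis using that by (metis injD)
qed

lemma by_position_update:
  fixes i :: "'m::{finite,linorder}"
  assumes "length vs = CARD('m)" "card {j. j < i} = n" "\<And>i'::'m. card {j. j < i'} = n \<longleftrightarrow> i' = i"
  shows "by_position (vs[n := x]) = (by_position vs)(i := x)"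
proof
  fix i' :: 'm
  show "by_position (vs[n := x]) i' = ((by_position vs)(i := x)) i'"
    using assms(1,2) assms(3)[of i'] position_less[of i'] by (cases "i' = i") (auto simp: by_position_def)
qed

lemma Omega_update_add: "Omega (w(i := x + y)) = Omega (w(i := x)) + Omega (w(i := y))"
proof -
  have eq: "(\<chi> r s. (w(i := z)) r $ s) = (\<chi> r. if r = i then z else w r)" for z
    by (auto simp: vec_eq_iff)
  show ?thesis unfolding Omega_def eq by (rule det_row_add)
qed

lemma Omega_update_scale: "Omega (w(i := c *s x)) = c * Omega (w(i := x))"
proof -
  have eq: "(\<chi> r s. (w(i := z)) r $ s) = (\<chi> r. if r = i then z else w r)" for z
    by (auto simp: vec_eq_iff)
  show ?thesis unfolding Omega_def eq by (rule det_row_mul)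
qed

lemma scaleR_eq_vector_mult: "r *\<^sub>R x = complex_of_real r *s (x :: complex ^ 'm)"
  by (simp add: vec_eq_iff scaleR_conv_of_real[symmetric])

lemma linear_Omega_update: "linear (\<lambda>x. Omega (w(i := x)))"
  by (rule linearI) (simp_all add: Omega_update_add scaleR_eq_vector_mult Omega_update_scale scaleR_conv_of_real)

lemma Omega_transpose:
  assumes "i \<noteq> j" shows "Omega (w \<circ> Transposition.transpose i j) = - Omega w"
proof -
  have "Transposition.transpose i j permutes UNIV" by (simp add: permutes_swap_id)
  from det_permute_rows[OF this, of "\<chi> i j. w i $ j"] show ?thesis
    using assms by (simp add: Omega_def sign_swap_id comp_def)
qed

lemma multilinear_ReOmega:
  "multilinear (CARD('m) - 1) (\<lambda>vs. ReOmega_component (vs @ [y :: complex ^ 'm::{finite,linorder}]))"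
proof (rule multilinearI)
  fix vs :: "(complex ^ 'm::{finite,linorder}) list" and n assume vs: "length vs = CARD('m) - 1" and n: "n < CARD('m) - 1"
  have "n < CARD('m)" using n by simp
  from obtain_position[OF this] obtain i :: 'm where
    i: "card {j. j < i} = n" "\<And>i'. card {j. j < i'} = n \<longleftrightarrow> i' = i" by metis
  have "by_position (vs[n := x] @ [y]) = (by_position (vs @ [y]))(i := x)" for x
    using by_position_update[of "vs @ [y]" i n x] vs n i by (simp add: list_update_append)
  then have "ReOmega_component (vs[n := x] @ [y]) = Re (Omega ((by_position (vs @ [y]))(i := x)))" for x
    by (simp add: ReOmega_component_def)
  moreover have "linear (\<lambda>x. Re (Omega ((by_position (vs @ [y]))(i := x))))"
    using linear_compose[OF linear_Omega_update bounded_linear.linear[OF bounded_linear_Re]] by (simp add: comp_def)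
  ultimately show "linear (\<lambda>x. ReOmega_component (vs[n := x] @ [y]))" by simp
qed

lemma alternating_ReOmega:
  "alternating (CARD('m) - 1) (\<lambda>vs. ReOmega_component (vs @ [y :: complex ^ 'm::{finite,linorder}]))"
proof (rule alternatingI)
  fix vs :: "(complex ^ 'm::{finite,linorder}) list" and a b
  assume vs: "length vs = CARD('m) - 1" and ab: "a < CARD('m) - 1" "b < CARD('m) - 1" "a \<noteq> b"
  have "a < CARD('m)" "b < CARD('m)" using ab by simp_all
  from this[THEN obtain_position] obtain i j :: 'm where
    i: "card {j. j < i} = a" "\<And>i'. card {j. j < i'} = a \<longleftrightarrow> i' = i" and
    j: "card {l. l < j} = b" "\<And>i'. card {l. l < i'} = b \<longleftrightarrow> i' = j" by metis
  have "i \<noteq> j" using i(1) j(1) ab(3) by blast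
  have perm: "Transposition.transpose a b permutes {..<length vs}" using ab vs by (simp add: permutes_swap_id)
  have "by_position (permute_list (Transposition.transpose a b) vs @ [y]) = by_position (vs @ [y]) \<circ> Transposition.transpose i j"
  proof
    fix l :: 'm
    let ?n = "card {j. j < l}" and ?\<tau> = "Transposition.transpose a b"
    have "?\<tau> ?n = card {l'. l' < Transposition.transpose i j l}"
      using i(1) j(1) i(2)[of l] j(2)[of l] by (metis transpose_apply_first transpose_apply_second transpose_apply_other)
    moreover have "(permute_list ?\<tau> vs @ [y]) ! ?n = (vs @ [y]) ! ?\<tau> ?n"
    proof (cases "?n < CARD('m) - 1")
      case True
      moreover have "?\<tau> ?n < CARD('m) - 1" using permutes_in_image[OF perm, of ?n] True vs by simp
      ultimately show ?thesis using perm vs by (simp add: nth_append permute_list_nth)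
    next
      case False
      then have "?\<tau> ?n = ?n" using ab by (intro transpose_apply_other) auto
      moreover have "?n = CARD('m) - 1" using False position_less[of l] by linarith
      ultimately show ?thesis using vs by (simp add: nth_append)
    qed
    ultimately show "by_position (permute_list ?\<tau> vs @ [y]) l = (by_position (vs @ [y]) \<circ> Transposition.transpose i j) l"
      by (simp add: by_position_def)
  qed
  then show "ReOmega_component (permute_list (Transposition.transpose a b) vs @ [y]) = - ReOmega_component (vs @ [y])"
    unfolding ReOmega_component_def by (simp add: Omega_transpose[OF \<open>i \<noteq> j\<close>])
qed

lemma linear_ReOmega_last:
  fixes vs :: "(complex ^ 'm::{finite,linorder}) list"
  assumes "length vs = CARD('m) - 1"
  shows "linear (\<lambda>y. ReOmega_component (vs @ [y]))"
proof -
  have "CARD('m) - 1 < CARD('m)" by simp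
  from obtain_position[OF this] obtain l :: 'm where
    l: "card {j. j < l} = CARD('m) - 1" "\<And>i'. card {j. j < i'} = CARD('m) - 1 \<longleftrightarrow> i' = l"
    by metis
  have upd: "by_position (vs @ [y]) = (by_position (vs @ [0]))(l := y)" for y
    using by_position_update[of "vs @ [0]" l "CARD('m) - 1" y] assms l
    by (simp add: list_update_append)
  have "(\<lambda>y. ReOmega_component (vs @ [y])) = Re \<circ> (\<lambda>y. Omega ((by_position (vs @ [0]))(l := y)))"
    unfolding ReOmega_component_def comp_def by (rule ext) (subst upd, rule refl)
  then show ?thesis
    using linear_compose[OF linear_Omega_update bounded_linear.linear[OF bounded_linear_Re]] by simp
qed

lemma contract_ReOmega_inner:
  fixes T :: "(complex ^ 'm::{finite,linorder}) list \<Rightarrow> real"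
  shows "contract_ReOmega T \<bullet> y
    = (\<Sum>as\<in>multi_indices (CARD('m) - 1). T as * ReOmega_component (as @ [y]))"
proof -
  let ?M = "multi_indices (CARD('m) - 1) :: (complex ^ 'm::{finite,linorder}) list set"
  have lin: "(\<Sum>b\<in>Basis. (\<Sum>c\<in>Basis. T as * ReOmega_component (as @ [c]) * (c \<bullet> b)) * (b \<bullet> y))
      = T as * ReOmega_component (as @ [y])" if "as \<in> ?M" for as
  proof -
    have len: "length as = CARD('m) - 1" using that by (simp add: multi_indices_def)
    have "(\<Sum>b\<in>Basis. (\<Sum>c\<in>Basis. T as * ReOmega_component (as @ [c]) * (c \<bullet> b)) * (b \<bullet> y))
        = (\<Sum>b\<in>Basis. T as * ReOmega_component (as @ [b]) * (b \<bullet> y))"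
      by (intro sum.cong) (auto simp: inner_Basis if_distrib[of "\<lambda>x. _ * x"] sum.delta cong: if_cong)
    also have "\<dots> = T as * (\<Sum>b\<in>Basis. (y \<bullet> b) * ReOmega_component (as @ [b]))"
      by (simp add: sum_distrib_left inner_commute mult_ac)
    also have "(\<Sum>b\<in>Basis. (y \<bullet> b) * ReOmega_component (as @ [b])) = ReOmega_component (as @ [\<Sum>b\<in>Basis. (y \<bullet> b) *\<^sub>R b])"
      using linear_sum[OF linear_ReOmega_last[OF len], of "\<lambda>b. (y \<bullet> b) *\<^sub>R b" Basis] linear_scale[OF linear_ReOmega_last[OF len]] by simp
    finally show ?thesis by (simp add: euclidean_representation)
  qed
  have "contract_ReOmega T \<bullet> y = (\<Sum>b\<in>Basis. \<Sum>as\<in>?M. (\<Sum>c\<in>Basis. T as * ReOmega_component (as @ [c]) * (c \<bullet> b)) * (b \<bullet> y))"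
    unfolding contract_ReOmega_def inner_sum_left by (simp add: sum_distrib_right)
  also have "\<dots> = (\<Sum>as\<in>?M. T as * ReOmega_component (as @ [y]))"
    by (subst sum.swap) (intro sum.cong refl lin)
  finally show ?thesis .
qed

text \<open>Expanding \<open>Re \<Omega>\<close> at the images of basis vectors moves \<open>L\<close> from the multivector to the form.\<close>

lemma contract_pushforward_inner:
  fixes L :: "'a::euclidean_space \<Rightarrow> complex ^ 'm::{finite,linorder}"
  shows "contract_ReOmega (pushforward (CARD('m) - 1) L T) \<bullet> y
    = (\<Sum>as\<in>multi_indices (CARD('m) - 1). T as * ReOmega_component (map L as @ [y]))"
proof -
  let ?k = "CARD('m) - 1"
  have "contract_ReOmega (pushforward ?k L T) \<bullet> y
      = (\<Sum>bs\<in>multi_indices ?k. \<Sum>as\<in>multi_indices ?k. T as * ((\<Prod>i<?k. L (as ! i) \<bullet> (bs ! i)) * ReOmega_component (bs @ [y])))"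
    unfolding contract_ReOmega_inner
    by (intro sum.cong refl) (auto simp: pushforward_def sum_distrib_left sum_distrib_right mult_ac)
  also have "\<dots> = (\<Sum>as\<in>multi_indices ?k. T as * (\<Sum>bs\<in>multi_indices ?k. (\<Prod>i<?k. L (as ! i) \<bullet> (bs ! i)) * ReOmega_component (bs @ [y])))"
    by (subst sum.swap) (simp add: sum_distrib_left)
  also have "\<dots> = (\<Sum>as\<in>multi_indices ?k. T as * ReOmega_component (map L as @ [y]))"
  proof (intro sum.cong refl)
    fix as :: "'a list" assume as: "as \<in> multi_indices ?k"
    then have len: "length as = ?k" by (simp add: multi_indices_def)
    have "ReOmega_component (map L as @ [y])
        = (\<Sum>bs | length bs = ?k \<and> set bs \<subseteq> Basis. (\<Prod>i<?k. (map L as ! i) \<bullet> (bs ! i)) * ReOmega_component (bs @ [y]))"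
      using len by (intro multilinear_expansion[OF multilinear_ReOmega]) (auto simp: euclidean_representation)
    also have "\<dots> = (\<Sum>bs\<in>multi_indices ?k. (\<Prod>i<?k. L (as ! i) \<bullet> (bs ! i)) * ReOmega_component (bs @ [y]))"
      using len by (simp add: multi_indices_def)
    finally show "T as * (\<Sum>bs\<in>multi_indices ?k. (\<Prod>i<?k. L (as ! i) \<bullet> (bs ! i)) * ReOmega_component (bs @ [y]))
        = T as * ReOmega_component (map L as @ [y])" by simp
  qed
  finally show ?thesis .
qed

lemma contract_pushforward_wedge:
  fixes L :: "'a::euclidean_space \<Rightarrow> complex ^ 'm::{finite,linorder}"
  assumes L: "linear L" and vs: "length vs = CARD('m) - 1"
  shows "contract_ReOmega (pushforward (CARD('m) - 1) L (\<lambda>as. c * wedge (CARD('m) - 1) vs as)) \<bullet> y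
    = c * fact (CARD('m) - 1) * ReOmega_component (map L vs @ [y])"
proof -
  have "(\<Sum>as\<in>multi_indices (CARD('m) - 1). wedge (CARD('m) - 1) vs as * ReOmega_component (map L as @ [y]))
      = fact (CARD('m) - 1) * ReOmega_component (map L vs @ [y])"
    by (rule sum_wedge_times_alternating[OF multilinear_compose_linear[OF L multilinear_ReOmega]
      alternating_compose[OF alternating_ReOmega] vs])
  then show ?thesis
    unfolding contract_pushforward_inner mult.assoc sum_distrib_left[symmetric] by simp
qed


section \<open>Charts, tangent spaces and second derivatives\<close>

lemma smooth_on_has_derivative:
  assumes "f smooth_on U" "x \<in> U" shows "(f has_derivative frechet_derivative f (at x)) (at x)"
  using assms unfolding smooth_on_def frechet_derivative_works[symmetric] by (metis Ck_on.simps(2))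

lemma smooth_on_frechet_derivative:
  assumes "f smooth_on U" shows "(\<lambda>x. frechet_derivative f (at x) v) smooth_on U"
  using assms unfolding smooth_on_def by (metis Ck_on.simps(2))

lemma smooth_on_continuous:
  assumes "f smooth_on U" shows "continuous_on U f"
  using assms unfolding smooth_on_def by (metis Ck_on.simps(1))

lemma smooth_on_linear_derivative:
  assumes "f smooth_on U" "x \<in> U" shows "linear (frechet_derivative f (at x))"
  using smooth_on_has_derivative[OF assms] has_derivative_bounded_linear bounded_linear.linear by blast

lemma has_vector_derivative_smooth_compose:
  assumes f: "f smooth_on V" and c: "(c has_vector_derivative v) (at t)" "c t \<in> V"
  shows "((\<lambda>t. f (c t)) has_vector_derivative frechet_derivative f (at (c t)) v) (at t)"
proof -
  have "((\<lambda>t. f (c t)) has_derivative (\<lambda>h. frechet_derivative f (at (c t)) (h *\<^sub>R v))) (at t)"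
    by (rule has_derivative_compose[OF c(1)[unfolded has_vector_derivative_def] smooth_on_has_derivative[OF f c(2)]])
  then show ?thesis
    by (simp add: has_vector_derivative_def linear_scale[OF smooth_on_linear_derivative[OF f c(2)]])
qed

lemma has_real_derivative_along_line:
  fixes f :: "'a::euclidean_space \<Rightarrow> 'b::euclidean_space"
  assumes "f smooth_on V" "x + s *\<^sub>R u \<in> V"
  shows "((\<lambda>s. f (x + s *\<^sub>R u) \<bullet> b) has_real_derivative frechet_derivative f (at (x + s *\<^sub>R u)) u \<bullet> b) (at s)"
proof -
  have "((\<lambda>s. x + s *\<^sub>R u) has_vector_derivative u) (at s)"
    by (auto intro!: derivative_eq_intros)
  then show ?thesis
    unfolding has_real_derivative_iff_has_vector_derivative
    by (intro bounded_linear.has_vector_derivative[OF bounded_linear_inner_left]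
      has_vector_derivative_smooth_compose[OF assms(1)] assms(2))
qed

text \<open>The mean value theorem is applied in the direction \<open>u\<close> to the difference of \<open>f\<close> in the direction
  \<open>v\<close>, and then in the direction \<open>v\<close>.\<close>

lemma second_difference_mean_value:
  fixes f :: "'a::euclidean_space \<Rightarrow> 'b::euclidean_space"
  assumes f: "f smooth_on V" and h: "0 < h"
    and V: "\<And>s t. 0 \<le> s \<Longrightarrow> s \<le> h \<Longrightarrow> 0 \<le> t \<Longrightarrow> t \<le> h \<Longrightarrow> x + s *\<^sub>R u + t *\<^sub>R v \<in> V"
  obtains s t where "0 < s" "s < h" "0 < t" "t < h"
    "(f (x + h *\<^sub>R u + h *\<^sub>R v) - f (x + h *\<^sub>R u) - f (x + h *\<^sub>R v) + f x) \<bullet> b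
     = h * (h * (frechet_derivative (\<lambda>y. frechet_derivative f (at y) u) (at (x + s *\<^sub>R u + t *\<^sub>R v)) v \<bullet> b))"
proof -
  let ?D = "\<lambda>y. frechet_derivative f (at y) u"
  have "((\<lambda>s. f (x + h *\<^sub>R v + s *\<^sub>R u) \<bullet> b - f (x + s *\<^sub>R u) \<bullet> b) has_real_derivative
      ?D (x + h *\<^sub>R v + s *\<^sub>R u) \<bullet> b - ?D (x + s *\<^sub>R u) \<bullet> b) (at s)" if "0 \<le> s" "s \<le> h" for s
    using V[of s h] V[of s 0] that h
    by (intro DERIV_diff has_real_derivative_along_line[OF f]) (auto simp: algebra_simps)
  from MVT2[OF h this]
  obtain s where s: "0 < s" "s < h"
    and 1: "(f (x + h *\<^sub>R v + h *\<^sub>R u) \<bullet> b - f (x + h *\<^sub>R u) \<bullet> b) - (f (x + h *\<^sub>R v + 0 *\<^sub>R u) \<bullet> b - f (x + 0 *\<^sub>R u) \<bullet> b)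
      = (h - 0) * (?D (x + h *\<^sub>R v + s *\<^sub>R u) \<bullet> b - ?D (x + s *\<^sub>R u) \<bullet> b)"
    by blast
  have "((\<lambda>t. ?D (x + s *\<^sub>R u + t *\<^sub>R v) \<bullet> b) has_real_derivative
      frechet_derivative ?D (at (x + s *\<^sub>R u + t *\<^sub>R v)) v \<bullet> b) (at t)" if "0 \<le> t" "t \<le> h" for t
    using V[of s t] that s by (intro has_real_derivative_along_line[OF smooth_on_frechet_derivative[OF f]]) auto
  from MVT2[OF h this]
  obtain t where t: "0 < t" "t < h"
    and 2: "?D (x + s *\<^sub>R u + h *\<^sub>R v) \<bullet> b - ?D (x + s *\<^sub>R u + 0 *\<^sub>R v) \<bullet> b
      = (h - 0) * (frechet_derivative ?D (at (x + s *\<^sub>R u + t *\<^sub>R v)) v \<bullet> b)"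
    by blast
  show ?thesis
    using that[OF s t] 1 2 by (simp add: inner_diff_left inner_add_left algebra_simps)
qed

text \<open>The second difference quotient is symmetric in \<open>u\<close> and \<open>v\<close>, and it converges to the mixed
  derivative in either order.\<close>

lemma second_derivative_symmetric:
  fixes f :: "'a::euclidean_space \<Rightarrow> 'b::euclidean_space"
  assumes f: "f smooth_on V" and V: "open V" "x \<in> V"
  shows "frechet_derivative (\<lambda>y. frechet_derivative f (at y) u) (at x) v
       = frechet_derivative (\<lambda>y. frechet_derivative f (at y) v) (at x) u"
proof (rule euclidean_eqI)
  fix b :: 'b assume "b \<in> Basis"
  let ?q = "\<lambda>u v h. ((f (x + h *\<^sub>R u + h *\<^sub>R v) - f (x + h *\<^sub>R u) - f (x + h *\<^sub>R v) + f x) \<bullet> b) / (h * h)"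
  let ?E = "\<lambda>u v y. frechet_derivative (\<lambda>y. frechet_derivative f (at y) u) (at y) v \<bullet> b"
  have lim: "(?q u v \<longlongrightarrow> ?E u v x) (at_right 0)" for u v
  proof (rule tendstoI)
    fix e :: real assume "0 < e"
    have "(\<lambda>y. frechet_derivative (\<lambda>y. frechet_derivative f (at y) u) (at y) v) smooth_on V"
      by (rule smooth_on_frechet_derivative[OF smooth_on_frechet_derivative[OF f]])
    then have "continuous_on V (?E u v)" by (intro continuous_intros smooth_on_continuous)
    then have "open (V \<inter> ?E u v -` ball (?E u v x) e)"
      using V(1) by (intro continuous_open_preimage) auto
    then have "open ((\<lambda>z. x + fst z *\<^sub>R u + snd z *\<^sub>R v) -` (V \<inter> ?E u v -` ball (?E u v x) e))"
      by (intro open_vimage) (auto intro!: continuous_intros)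
    moreover have "(0, 0) \<in> (\<lambda>z. x + fst z *\<^sub>R u + snd z *\<^sub>R v) -` (V \<inter> ?E u v -` ball (?E u v x) e)"
      using V(2) \<open>0 < e\<close> by simp
    ultimately obtain d where d: "0 < d"
      "ball (0, 0) d \<subseteq> (\<lambda>z. x + fst z *\<^sub>R u + snd z *\<^sub>R v) -` (V \<inter> ?E u v -` ball (?E u v x) e)"
      using openE by blast
    have near: "x + s *\<^sub>R u + t *\<^sub>R v \<in> V" "dist (?E u v (x + s *\<^sub>R u + t *\<^sub>R v)) (?E u v x) < e"
      if "0 \<le> s" "s \<le> h" "0 \<le> t" "t \<le> h" "h < d / 2" for s t h
    proof -
      have "norm (s, t) < d" using norm_Pair_le[of s t] that by simp
      then have "(s, t) \<in> ball (0, 0) d" by (simp flip: zero_prod_def)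
      then show "x + s *\<^sub>R u + t *\<^sub>R v \<in> V" "dist (?E u v (x + s *\<^sub>R u + t *\<^sub>R v)) (?E u v x) < e"
        using subsetD[OF d(2)] by (force simp: dist_commute)+
    qed
    have "dist (?q u v h) (?E u v x) < e" if h: "0 < h" "h < d / 2" for h
    proof -
      obtain s t where st: "0 < s" "s < h" "0 < t" "t < h"
        "(f (x + h *\<^sub>R u + h *\<^sub>R v) - f (x + h *\<^sub>R u) - f (x + h *\<^sub>R v) + f x) \<bullet> b
         = h * (h * ?E u v (x + s *\<^sub>R u + t *\<^sub>R v))"
        using second_difference_mean_value[OF f h(1) near(1)[OF _ _ _ _ h(2)], of b] by blast
      then have "?q u v h = ?E u v (x + s *\<^sub>R u + t *\<^sub>R v)" using h by simp
      then show ?thesis using near(2)[of s h t] st h by simp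
    qed
    then show "\<forall>\<^sub>F h in at_right 0. dist (?q u v h) (?E u v x) < e"
      unfolding eventually_at_right[OF zero_less_one] using d(1) by (intro exI[of _ "d / 2"]) auto
  qed
  have "?q u v = ?q v u" by (auto simp: fun_eq_iff algebra_simps)
  with lim[of u v] lim[of v u] have "?E u v x = ?E v u x"
    by (metis (no_types, lifting) tendsto_unique trivial_limit_at_right_real)
  then show "frechet_derivative (\<lambda>y. frechet_derivative f (at y) u) (at x) v \<bullet> b
      = frechet_derivative (\<lambda>y. frechet_derivative f (at y) v) (at x) u \<bullet> b" .
qed

text \<open>This is the straightening diffeomorphism in the definition of a nonsingular point, without the
  point: one chart serves all points of \<open>U \<inter> P\<close>, so these are all nonsingular.\<close>

definition chart :: "nat \<Rightarrow> 'a::euclidean_space set \<Rightarrow> 'a set \<Rightarrow> 'a set \<Rightarrow> ('a \<Rightarrow> 'a) \<Rightarrow> ('a \<Rightarrow> 'a) \<Rightarrow> 'a set \<Rightarrow> bool" where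
  "chart k P U V F G S \<longleftrightarrow> open U \<and> open V \<and> homeomorphism U V F G \<and>
     F smooth_on U \<and> G smooth_on V \<and> subspace S \<and> dim S = k \<and> F ` (U \<inter> P) = V \<inter> S"

lemma nonsingular_point_iff_chart:
  fixes P :: "'a::euclidean_space set"
  shows "nonsingular_point k P p \<longleftrightarrow> p \<in> P \<and> (\<exists>U V F G S. p \<in> U \<and> chart k P U V F G S)"
  unfolding nonsingular_point_def chart_def
  by (rule conj_cong[OF refl], (rule ex_cong1)+) (simp only: conj_ac)

lemma nonsingular_pointsE:
  assumes "p \<in> nonsingular_points k P"
  obtains U V F G S where "chart k P U V F G S" "p \<in> U \<inter> P"
  using assms unfolding nonsingular_points_def nonsingular_point_iff_chart by blast

lemma chart_nonsingular:
  assumes "chart k P U V F G S" "q \<in> U \<inter> P" shows "q \<in> nonsingular_points k P"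
  using assms unfolding nonsingular_points_def nonsingular_point_iff_chart by blast

lemma nonsingular_points_subset: "nonsingular_points k P \<subseteq> P"
  by (auto simp: nonsingular_points_def nonsingular_point_def)

lemma nonsingular_points_relatively_open:
  assumes "p \<in> nonsingular_points k P"
  obtains U where "open U" "p \<in> U" "U \<inter> P \<subseteq> nonsingular_points k P"
  using assms chart_nonsingular by (metis (no_types) Int_iff chart_def nonsingular_pointsE subsetI)

lemma chart_inverse:
  assumes "chart k P U V F G S"
  shows "x \<in> U \<Longrightarrow> F x \<in> V" "x \<in> U \<Longrightarrow> G (F x) = x" "s \<in> V \<Longrightarrow> G s \<in> U" "s \<in> V \<Longrightarrow> F (G s) = s"
    "q \<in> U \<inter> P \<Longrightarrow> F q \<in> V \<inter> S" "s \<in> V \<inter> S \<Longrightarrow> G s \<in> U \<inter> P"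
proof -
  show *: "x \<in> U \<Longrightarrow> F x \<in> V" "x \<in> U \<Longrightarrow> G (F x) = x" "s \<in> V \<Longrightarrow> G s \<in> U" "s \<in> V \<Longrightarrow> F (G s) = s" for x s
    using assms unfolding chart_def by (auto simp: homeomorphism_def)
  show "q \<in> U \<inter> P \<Longrightarrow> F q \<in> V \<inter> S" using assms by (auto simp: chart_def)
  assume "s \<in> V \<inter> S"
  then obtain x where "x \<in> U \<inter> P" "s = F x" using assms by (auto simp: chart_def)
  then show "G s \<in> U \<inter> P" using *(2) by auto
qed

lemma chart_derivative_inverse:
  assumes "chart k P U V F G S" "s \<in> V"
  shows "frechet_derivative F (at (G s)) (frechet_derivative G (at s) u) = u"
proof -
  note c = chart_inverse[OF assms(1)]
  have G: "(G has_derivative frechet_derivative G (at s)) (at s)"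
    using assms by (intro smooth_on_has_derivative[of _ V]) (auto simp: chart_def)
  have F: "(F has_derivative frechet_derivative F (at (G s))) (at (G s))"
    using assms c(3)[OF assms(2)] by (intro smooth_on_has_derivative[of _ U]) (auto simp: chart_def)
  have "((\<lambda>x. F (G x)) has_derivative (\<lambda>u. frechet_derivative F (at (G s)) (frechet_derivative G (at s) u))) (at s)"
    by (rule has_derivative_compose[OF G F])
  moreover have "((\<lambda>x. F (G x)) has_derivative (\<lambda>u. u)) (at s)"
  proof (rule has_derivative_transform_within_open[OF has_derivative_ident])
    show "open V" "s \<in> V" using assms by (auto simp: chart_def)
  qed (use c in auto)
  ultimately show ?thesis by (metis has_derivative_unique)
qed

text \<open>The component of the curve orthogonal to \<open>S\<close> is constant.\<close>

lemma subspace_curve_derivative: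
  fixes c :: "real \<Rightarrow> 'a::euclidean_space"
  assumes S: "subspace S" and \<delta>: "0 < \<delta>" "\<And>t. \<bar>t\<bar> < \<delta> \<Longrightarrow> c t - c 0 \<in> S"
    and c: "(c has_vector_derivative v) (at 0)"
  shows "v \<in> S"
proof -
  obtain y z where y: "y \<in> span S" and z: "\<And>w. w \<in> span S \<Longrightarrow> orthogonal z w" and v: "v = y + z"
    using orthogonal_subspace_decomp_exists[of S v] by metis
  have "((\<lambda>t. (c t - c 0) \<bullet> z) has_vector_derivative v \<bullet> z) (at 0)"
    using c by (auto intro!: derivative_eq_intros bounded_linear.has_vector_derivative[OF bounded_linear_inner_left])
  moreover have "((\<lambda>t. (c t - c 0) \<bullet> z) has_vector_derivative 0) (at 0)"
  proof (rule has_vector_derivative_transform_within_open[OF has_vector_derivative_const])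
    show "0 = (c t - c 0) \<bullet> z" if "t \<in> ball 0 \<delta>" for t
      using z[OF span_base[OF \<delta>(2)[of t]]] that by (simp add: orthogonal_def inner_commute)
  qed (use \<delta> in auto)
  ultimately have "v \<bullet> z = 0" using vector_derivative_unique_at by blast
  moreover have "y \<bullet> z = 0" using z[OF y] by (simp add: orthogonal_def inner_commute)
  ultimately have "z \<bullet> z = 0" using v by (simp add: inner_add_left)
  then show ?thesis using v y span_eq_iff[THEN iffD2, OF S] by simp
qed

lemma tangent_space_mono: "A \<subseteq> B \<Longrightarrow> tangent_space A p \<subseteq> tangent_space B p"
  unfolding tangent_space_def by blast

text \<open>A curve through \<open>p\<close> that is differentiable there is continuous there, so it stays in \<open>U\<close> for a
  short time.\<close>

lemma tangent_space_Int_open: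
  fixes p :: "'a::euclidean_space"
  assumes "open U" "p \<in> U"
  shows "tangent_space (U \<inter> A) p = tangent_space A p"
proof
  show "tangent_space A p \<subseteq> tangent_space (U \<inter> A) p"
  proof
    fix v assume "v \<in> tangent_space A p"
    then obtain \<gamma> \<delta> where \<gamma>: "\<gamma> 0 = p" "0 < \<delta>" "\<And>t. \<bar>t\<bar> < \<delta> \<Longrightarrow> \<gamma> t \<in> A"
      and d: "(\<gamma> has_vector_derivative v) (at (0::real))" unfolding tangent_space_def by blast
    obtain e where e: "0 < e" "ball p e \<subseteq> U" using assms openE by blast
    have "isCont \<gamma> 0" using d has_vector_derivative_continuous by blast
    then obtain \<delta>' where \<delta>': "0 < \<delta>'" "\<And>t. dist t 0 < \<delta>' \<Longrightarrow> dist (\<gamma> t) p < e"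
      unfolding continuous_at_eps_delta \<gamma>(1) using e(1) by blast
    have "\<gamma> t \<in> U \<inter> A" if "\<bar>t\<bar> < min \<delta> \<delta>'" for t
      using \<gamma>(3)[of t] \<delta>'(2)[of t] e(2) that by (auto simp: dist_commute subset_eq)
    then show "v \<in> tangent_space (U \<inter> A) p"
      unfolding tangent_space_def using \<gamma> \<delta>' d
      by (intro CollectI exI[of _ \<gamma>] conjI exI[of _ "min \<delta> \<delta>'"]) auto
  qed
qed (simp add: tangent_space_mono)

lemma tangent_space_subset_subspace:
  fixes p :: "'a::euclidean_space"
  assumes S: "subspace S" and A: "\<And>x. x \<in> A \<Longrightarrow> x - p \<in> S"
  shows "tangent_space A p \<subseteq> S"
proof
  fix v assume "v \<in> tangent_space A p"
  then obtain \<gamma> \<delta> where \<gamma>: "\<gamma> 0 = p" "0 < \<delta>" "\<And>t. \<bar>t\<bar> < \<delta> \<Longrightarrow> \<gamma> t \<in> A"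
    and d: "(\<gamma> has_vector_derivative v) (at (0::real))" unfolding tangent_space_def by blast
  show "v \<in> S" by (rule subspace_curve_derivative[OF S \<gamma>(2) _ d]) (use \<gamma> A in auto)
qed

lemma chart_short_line:
  assumes ch: "chart k P U V F G S" and s: "s \<in> V \<inter> S" and u: "u \<in> S"
  shows "\<exists>\<delta>>0. \<forall>t. \<bar>t\<bar> < \<delta> \<longrightarrow> s + t *\<^sub>R u \<in> V \<inter> S"
proof -
  have S: "subspace S" and oV: "open V" using ch by (auto simp: chart_def)
  have "open ((\<lambda>t. s + t *\<^sub>R u) -` V)" using oV by (intro open_vimage continuous_intros)
  moreover have "0 \<in> (\<lambda>t. s + t *\<^sub>R u) -` V" using s by simp
  ultimately obtain \<delta> where "0 < \<delta>" "ball 0 \<delta> \<subseteq> (\<lambda>t. s + t *\<^sub>R u) -` V" using openE by blast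
  then show ?thesis using s u S by (intro exI[of _ \<delta>]) (auto simp: subset_eq intro!: subspace_add subspace_scale)
qed

text \<open>The chart turns curves in \<open>P\<close> into curves in the linear subspace \<open>S\<close>, whose velocities lie in \<open>S\<close>;
  conversely a straight line in \<open>S\<close> gives a curve in \<open>P\<close>.\<close>

lemma chart_tangent_space:
  assumes ch: "chart k P U V F G S" and q: "q \<in> U \<inter> P"
  shows "tangent_space P q = frechet_derivative G (at (F q)) ` S"
proof -
  note c = chart_inverse[OF ch]
  have oU: "open U" and S: "subspace S" and Fs: "F smooth_on U" and Gs: "G smooth_on V"
    using ch by (auto simp: chart_def)
  have Fq: "F q \<in> V \<inter> S" using c(5)[OF q] .
  show ?thesis
  proof (intro equalityI subsetI)
    fix v assume "v \<in> tangent_space P q"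
    then have "v \<in> tangent_space (U \<inter> P) q" using tangent_space_Int_open[OF oU, of q P] q by simp
    then obtain \<gamma> \<epsilon> where \<gamma>: "\<gamma> 0 = q" and \<epsilon>: "0 < \<epsilon>" "\<And>t. \<bar>t\<bar> < \<epsilon> \<Longrightarrow> \<gamma> t \<in> U \<inter> P"
      and d: "(\<gamma> has_vector_derivative v) (at (0::real))" unfolding tangent_space_def by blast
    have dF: "((\<lambda>t. F (\<gamma> t)) has_vector_derivative frechet_derivative F (at q) v) (at 0)"
      using has_vector_derivative_smooth_compose[OF Fs d] \<gamma> q by simp
    have inS: "frechet_derivative F (at q) v \<in> S"
    proof (rule subspace_curve_derivative[OF S \<epsilon>(1) _ dF])
      show "F (\<gamma> t) - F (\<gamma> 0) \<in> S" if "\<bar>t\<bar> < \<epsilon>" for t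
        using c(5)[OF \<epsilon>(2)[OF that]] Fq \<gamma> S by (auto intro: subspace_diff)
    qed
    have "((\<lambda>t. G (F (\<gamma> t))) has_vector_derivative frechet_derivative G (at (F q)) (frechet_derivative F (at q) v)) (at 0)"
      using has_vector_derivative_smooth_compose[OF Gs dF] \<gamma> Fq by simp
    then have "(\<gamma> has_vector_derivative frechet_derivative G (at (F q)) (frechet_derivative F (at q) v)) (at 0)"
      by (rule has_vector_derivative_transform_within_open[where S = "ball 0 \<epsilon>"]) (use \<epsilon> c(2) in auto)
    then have "v = frechet_derivative G (at (F q)) (frechet_derivative F (at q) v)"
      using d vector_derivative_unique_at by blast
    then show "v \<in> frechet_derivative G (at (F q)) ` S" using inS by blast
  next
    fix v assume "v \<in> frechet_derivative G (at (F q)) ` S"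
    then obtain u where u: "u \<in> S" "v = frechet_derivative G (at (F q)) u" by blast
    obtain \<delta> where \<delta>: "0 < \<delta>" "\<And>t. \<bar>t\<bar> < \<delta> \<Longrightarrow> F q + t *\<^sub>R u \<in> V \<inter> S"
      using chart_short_line[OF ch Fq u(1)] by blast
    have "G (F q + t *\<^sub>R u) \<in> P" if "\<bar>t\<bar> < \<delta>" for t
      using c(6)[OF \<delta>(2)[OF that]] by simp
    moreover have "((\<lambda>t. G (F q + t *\<^sub>R u)) has_vector_derivative v) (at 0)"
    proof -
      have "((\<lambda>t. F q + t *\<^sub>R u) has_vector_derivative u) (at 0)"
        by (auto intro!: derivative_eq_intros)
      from has_vector_derivative_smooth_compose[OF Gs this] show ?thesis
        using Fq u(2) by simp
    qed
    ultimately show "v \<in> tangent_space P q"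
      unfolding tangent_space_def using c(2) q \<delta>(1)
      by (intro CollectI exI[of _ "\<lambda>t. G (F q + t *\<^sub>R u)"]) auto
  qed
qed

lemma chart_tangent_space_subspace:
  assumes ch: "chart k P U V F G S" and q: "q \<in> U \<inter> P"
  shows "subspace (tangent_space P q)" "dim (tangent_space P q) = k"
    "linear (frechet_derivative G (at (F q)))" "inj (frechet_derivative G (at (F q)))"
proof -
  note c = chart_inverse[OF ch]
  have FqV: "F q \<in> V" using c(5)[OF q] by blast
  have S: "subspace S" "dim S = k" and Gs: "G smooth_on V" using ch by (auto simp: chart_def)
  show lin: "linear (frechet_derivative G (at (F q)))" using smooth_on_linear_derivative[OF Gs FqV] .
  show inj: "inj (frechet_derivative G (at (F q)))"
    by (rule inj_on_inverseI[of _ "frechet_derivative F (at (G (F q)))"]) (rule chart_derivative_inverse[OF ch FqV])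
  show "subspace (tangent_space P q)"
    unfolding chart_tangent_space[OF assms] by (rule linear_subspace_image[OF lin S(1)])
  show "dim (tangent_space P q) = k"
    unfolding chart_tangent_space[OF assms] using S dim_image_eq[OF lin] inj
    by (metis inj_on_subset subset_UNIV)
qed

lemma nonsingular_tangent_space:
  assumes "p \<in> nonsingular_points k P"
  shows "subspace (tangent_space P p)" "dim (tangent_space P p) = k"
  using nonsingular_pointsE[OF assms] chart_tangent_space_subspace(1,2) by metis+


section \<open>The evolution equation for affine maps\<close>

lemma affine_mapE:
  assumes "affine_map f"
  shows "linear (linear_part f)" "f x = f 0 + linear_part f x"
proof -
  obtain L c where L: "linear L" "f = (\<lambda>x. L x + c)" using assms unfolding affine_map_def by blast
  have "linear_part f = L" using L linear_0[OF L(1)] by (auto simp: linear_part_def fun_eq_iff)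
  then show "linear (linear_part f)" using L by simp
qed (simp add: linear_part_def)

lemma affine_map_continuous:
  fixes f :: "'a::euclidean_space \<Rightarrow> 'b::euclidean_space"
  assumes "affine_map f" shows "continuous_on A f"
proof -
  obtain L c where "linear L" "f = (\<lambda>x. L x + c)" using assms unfolding affine_map_def by blast
  then show ?thesis
    by (simp add: continuous_on_add linear_continuous_on linear_conv_bounded_linear)
qed

lemma affine_mapI: "linear L \<Longrightarrow> f = (\<lambda>x. c + L x) \<Longrightarrow> affine_map f"
  unfolding affine_map_def by (auto simp: add.commute)

lemma affine_map_combination:
  assumes "affine_map f"
  shows "f (q + (v + w)) = f (q + v) + f (q + w) - f q" "f (q + r *\<^sub>R v) = r *\<^sub>R f (q + v) + (1 - r) *\<^sub>R f q"
proof -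
  let ?L = "linear_part f"
  note lin = affine_mapE(1)[OF assms]
  have "?L (q + (v + w)) = ?L (q + v) + ?L (q + w) - ?L q" by (simp add: linear_add[OF lin])
  then show "f (q + (v + w)) = f (q + v) + f (q + w) - f q" by (simp add: linear_part_def)
  have "?L (q + r *\<^sub>R v) = r *\<^sub>R ?L (q + v) + (1 - r) *\<^sub>R ?L q"
    by (simp add: linear_add[OF lin] linear_scale[OF lin] scaleR_add_right scaleR_left_diff_distrib)
  then show "f (q + r *\<^sub>R v) = r *\<^sub>R f (q + v) + (1 - r) *\<^sub>R f q"
    by (simp add: linear_part_def scaleR_diff_right scaleR_left_diff_distrib)
qed

lemma affine_map_coordinates:
  fixes f :: "'a::euclidean_space \<Rightarrow> 'b::real_vector"
  assumes "affine_map f"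
  shows "f x = f 0 + (\<Sum>b\<in>Basis. (x \<bullet> b) *\<^sub>R (f b - f 0))"
proof -
  have "linear_part f x = linear_part f (\<Sum>b\<in>Basis. (x \<bullet> b) *\<^sub>R b)" by (simp add: euclidean_representation)
  also have "\<dots> = (\<Sum>b\<in>Basis. (x \<bullet> b) *\<^sub>R linear_part f b)"
    by (simp add: linear_sum[OF affine_mapE(1)[OF assms]] linear_scale[OF affine_mapE(1)[OF assms]])
  finally show ?thesis by (simp add: linear_part_def diff_eq_eq add.commute)
qed

text \<open>This is the right-hand side of the evolution equation.\<close>

definition velocity :: "('a::euclidean_space \<Rightarrow> 'a list \<Rightarrow> real) \<Rightarrow>
    ('a \<Rightarrow> complex ^ 'm::{finite,linorder}) \<Rightarrow> 'a \<Rightarrow> complex ^ 'm::{finite,linorder}" where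
  "velocity chi \<phi> x = contract_ReOmega (pushforward (CARD('m) - 1) (linear_part \<phi>) (chi x))"

lemma velocity_inner:
  fixes \<phi> :: "'a::euclidean_space \<Rightarrow> complex ^ 'm::{finite,linorder}"
  shows "velocity chi \<phi> x \<bullet> y = (\<Sum>as\<in>multi_indices (CARD('m) - 1).
    chi x as * ReOmega_component (map (linear_part \<phi>) as @ [y]))"
  unfolding velocity_def by (rule contract_pushforward_inner)

lemma affine_velocity:
  fixes \<phi> :: "'a::euclidean_space \<Rightarrow> complex ^ 'm::{finite,linorder}"
  assumes chi: "\<And>as. affine_map (\<lambda>x. chi x as)"
  shows "affine_map (velocity chi \<phi>)"
proof (rule affine_mapI)
  let ?L = "linear_part (velocity chi \<phi>)"
  have eq: "?L x \<bullet> y = (\<Sum>as\<in>multi_indices (CARD('m) - 1).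
      linear_part (\<lambda>x. chi x as) x * ReOmega_component (map (linear_part \<phi>) as @ [y]))" for x y
    by (simp add: linear_part_def velocity_inner inner_diff_left left_diff_distrib sum_subtractf)
  show "linear ?L"
  proof (rule linearI)
    show "?L (x + x') = ?L x + ?L x'" for x x'
      by (rule euclidean_eqI)
        (simp add: inner_add_left eq linear_add[OF affine_mapE(1)[OF chi]] distrib_right sum.distrib)
    show "?L (r *\<^sub>R x) = r *\<^sub>R ?L x" for r x
      by (rule euclidean_eqI)
        (simp add: eq linear_scale[OF affine_mapE(1)[OF chi]] sum_distrib_left mult.assoc)
  qed
  show "velocity chi \<phi> = (\<lambda>x. velocity chi \<phi> 0 + ?L x)"
    by (simp add: linear_part_def fun_eq_iff)
qed

definition evolves :: "real set \<Rightarrow> ('a::euclidean_space \<Rightarrow> 'a list \<Rightarrow> real) \<Rightarrow>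
    (real \<Rightarrow> 'a \<Rightarrow> complex ^ 'm::{finite,linorder}) \<Rightarrow> bool" where
  "evolves I chi \<Phi> \<longleftrightarrow> (\<forall>t\<in>I. affine_map (\<Phi> t) \<and>
     (\<forall>x. ((\<lambda>s. \<Phi> s x) has_vector_derivative velocity chi (\<Phi> t) x) (at t)))"

lemma evolves_subset: "evolves I chi \<Phi> \<Longrightarrow> I' \<subseteq> I \<Longrightarrow> evolves I' chi \<Phi>"
  by (auto simp: evolves_def)

lemma evolves_shift:
  assumes "evolves I chi \<Phi>" "\<And>s. s \<in> I' \<Longrightarrow> t\<^sub>0 + s \<in> I"
  shows "evolves I' chi (\<lambda>s. \<Phi> (t\<^sub>0 + s))"
  unfolding evolves_def
proof (intro ballI conjI allI)
  fix s x assume "s \<in> I'"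
  then have s: "t\<^sub>0 + s \<in> I" by (rule assms)
  show "affine_map (\<Phi> (t\<^sub>0 + s))" using assms(1) s by (auto simp: evolves_def)
  have "((\<lambda>s. t\<^sub>0 + s) has_vector_derivative 1) (at s)" by (auto intro!: derivative_eq_intros)
  moreover have "((\<lambda>s. \<Phi> s x) has_vector_derivative velocity chi (\<Phi> (t\<^sub>0 + s)) x) (at (t\<^sub>0 + s))"
    using assms(1) s by (auto simp: evolves_def)
  ultimately have "(((\<lambda>s. \<Phi> s x) \<circ> (\<lambda>s. t\<^sub>0 + s)) has_vector_derivative 1 *\<^sub>R velocity chi (\<Phi> (t\<^sub>0 + s)) x) (at s)"
    by (rule vector_diff_chain_at)
  then show "((\<lambda>s. \<Phi> (t\<^sub>0 + s) x) has_vector_derivative velocity chi (\<Phi> (t\<^sub>0 + s)) x) (at s)"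
    by (simp add: comp_def)
qed

text \<open>The coordinates of an affine map are the components of its value at \<open>0\<close>, stored under the vector
  \<open>0\<close>, and those of its linear part at each basis vector. There is no clash, as \<open>0\<close> is not a basis
  vector.\<close>

definition state_indices :: "('a::euclidean_space \<times> 'b::euclidean_space) set" where
  "state_indices = insert 0 Basis \<times> Basis"

definition state_of :: "('a::euclidean_space \<Rightarrow> 'b::euclidean_space) \<Rightarrow> 'a \<times> 'b \<Rightarrow> real" where
  "state_of \<phi> = (\<lambda>(x, a). (if x = 0 then \<phi> 0 else \<phi> x - \<phi> 0) \<bullet> a)"

definition map_of_state :: "('a::euclidean_space \<times> 'b::euclidean_space \<Rightarrow> real) \<Rightarrow> 'a \<Rightarrow> 'b" where
  "map_of_state y x = (\<Sum>a\<in>Basis. (y (0, a) + (\<Sum>b\<in>Basis. (x \<bullet> b) * y (b, a))) *\<^sub>R a)"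

definition evolution_coeff :: "('a::euclidean_space \<Rightarrow> 'a list \<Rightarrow> real) \<Rightarrow> 'a \<times> (complex ^ 'm::{finite,linorder})
    \<Rightarrow> 'a list \<times> (complex ^ 'm::{finite,linorder}) list \<Rightarrow> real" where
  "evolution_coeff chi = (\<lambda>(x, a) (bs, as).
     (if x = 0 then chi 0 bs else chi x bs - chi 0 bs) * ReOmega_component (as @ [a]))"

definition index_pair :: "'a list \<times> 'b list \<Rightarrow> nat \<Rightarrow> 'a \<times> 'b" where
  "index_pair \<mu> i = (fst \<mu> ! i, snd \<mu> ! i)"

abbreviation evolution_field :: "('a::euclidean_space \<Rightarrow> 'a list \<Rightarrow> real) \<Rightarrow>
    ('a \<times> (complex ^ 'm::{finite,linorder}) \<Rightarrow> real) \<Rightarrow> 'a \<times> (complex ^ 'm::{finite,linorder}) \<Rightarrow> real" where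
  "evolution_field chi \<equiv> poly_field (multi_indices (CARD('m) - 1) \<times> multi_indices (CARD('m) - 1)) (CARD('m) - 1)
     (evolution_coeff chi) index_pair"

lemma finite_state_indices: "finite state_indices"
  by (simp add: state_indices_def)

lemma index_pair_in_state_indices:
  assumes "\<mu> \<in> multi_indices k \<times> multi_indices k" "i < k"
  shows "index_pair \<mu> i \<in> state_indices"
proof -
  have "fst \<mu> ! i \<in> Basis" "snd \<mu> ! i \<in> Basis"
    using assms by (auto simp: multi_indices_def subset_eq)
  then show ?thesis by (simp add: index_pair_def state_indices_def)
qed

lemma map_of_state_of:
  assumes "affine_map \<phi>" shows "map_of_state (state_of \<phi>) = \<phi>"
proof
  fix x
  have "map_of_state (state_of \<phi>) x = (\<Sum>a\<in>Basis. (\<phi> x \<bullet> a) *\<^sub>R a)"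
    unfolding map_of_state_def
  proof (intro sum.cong refl)
    fix a :: 'b assume "a \<in> Basis"
    have "\<phi> x \<bullet> a = \<phi> 0 \<bullet> a + (\<Sum>b\<in>Basis. (x \<bullet> b) * ((\<phi> b - \<phi> 0) \<bullet> a))"
      by (subst affine_map_coordinates[OF assms]) (simp add: inner_add_left inner_sum_left)
    then show "(state_of \<phi> (0, a) + (\<Sum>b\<in>Basis. (x \<bullet> b) * state_of \<phi> (b, a))) *\<^sub>R a = (\<phi> x \<bullet> a) *\<^sub>R a"
      by (simp add: state_of_def) (intro disjI1 sum.cong refl, auto)
  qed
  then show "map_of_state (state_of \<phi>) x = \<phi> x" by (simp add: euclidean_representation)
qed

lemma affine_map_of_state: "affine_map (map_of_state y)"
proof (rule affine_mapI)
  show "map_of_state y = (\<lambda>x. map_of_state y 0 + (\<Sum>a\<in>Basis. (\<Sum>b\<in>Basis. (x \<bullet> b) * y (b, a)) *\<^sub>R a))"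
    by (auto simp: map_of_state_def fun_eq_iff scaleR_add_left sum.distrib)
  show "linear (\<lambda>x. \<Sum>a\<in>Basis. (\<Sum>b\<in>Basis. (x \<bullet> b) * y (b, a)) *\<^sub>R a)"
    by (rule linearI) (simp_all add: inner_add_left distrib_right sum.distrib scaleR_add_left
        sum_distrib_left scaleR_sum_right mult.assoc)
qed

lemma state_of_map_of_state:
  assumes "j \<in> state_indices" shows "state_of (map_of_state y) j = y j"
proof -
  obtain x a where j: "j = (x, a)" "x \<in> insert 0 Basis" "a \<in> Basis"
    using assms by (auto simp: state_indices_def)
  have inner: "map_of_state y x \<bullet> a = y (0, a) + (\<Sum>b\<in>Basis. (x \<bullet> b) * y (b, a))" for x
    unfolding map_of_state_def using j(3)
    by (simp add: inner_sum_left inner_Basis if_distrib[of "\<lambda>z. _ * z"] sum.delta cong: if_cong)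
  have "(\<Sum>b\<in>Basis. (x \<bullet> b) * y (b, a)) = y (x, a)" if "x \<in> Basis"
    using that by (simp add: inner_Basis if_distrib[of "\<lambda>z. z * _"] sum.delta cong: if_cong)
  then show ?thesis using j by (auto simp: state_of_def inner inner_diff_left)
qed

text \<open>A component of a push-forward is a sum of products of \<open>m - 1\<close> matrix entries of the linear part,
  hence in coordinates the velocity is a polynomial field.\<close>

lemma evolution_field_state_of:
  fixes \<phi> :: "'a::euclidean_space \<Rightarrow> complex ^ 'm::{finite,linorder}"
  assumes "j \<in> state_indices"
  shows "evolution_field chi (state_of \<phi>) j = state_of (velocity chi \<phi>) j"
proof -
  let ?k = "CARD('m) - 1"
  obtain x a where j: "j = (x, a)" "x \<in> insert 0 Basis" "a \<in> Basis"
    using assms by (auto simp: state_indices_def)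
  define T where "T = (\<lambda>bs. if x = 0 then chi 0 bs else chi x bs - chi 0 bs)"
  have vel: "velocity chi \<phi> x \<bullet> a = (\<Sum>as\<in>multi_indices ?k. \<Sum>bs\<in>multi_indices ?k.
      (\<Prod>i<?k. linear_part \<phi> (bs ! i) \<bullet> (as ! i)) * chi x bs * ReOmega_component (as @ [a]))" for x
    unfolding velocity_def contract_ReOmega_inner
    by (intro sum.cong refl) (simp add: pushforward_def sum_distrib_right)
  have "state_of (velocity chi \<phi>) j = (\<Sum>as\<in>multi_indices ?k. \<Sum>bs\<in>multi_indices ?k.
      (\<Prod>i<?k. linear_part \<phi> (bs ! i) \<bullet> (as ! i)) * T bs * ReOmega_component (as @ [a]))"
    by (simp add: j(1) state_of_def T_def inner_diff_left vel sum_subtractf left_diff_distrib right_diff_distrib)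
  also have "\<dots> = (\<Sum>(bs, as)\<in>multi_indices ?k \<times> multi_indices ?k.
      evolution_coeff chi j (bs, as) * (\<Prod>i<?k. state_of \<phi> (index_pair (bs, as) i)))"
    unfolding sum.cartesian_product[symmetric] sum.swap[where A = "multi_indices ?k :: 'a list set"]
  proof (intro sum.cong refl)
    fix bs :: "'a list" and as :: "(complex ^ 'm::{finite,linorder}) list"
    assume bs: "bs \<in> multi_indices ?k"
    have "(\<Prod>i<?k. linear_part \<phi> (bs ! i) \<bullet> (as ! i)) = (\<Prod>i<?k. state_of \<phi> (index_pair (bs, as) i))"
    proof (intro prod.cong refl)
      fix i assume "i \<in> {..<?k}"
      then have "bs ! i \<in> Basis" using bs by (auto simp: multi_indices_def subset_eq)
      then have "bs ! i \<noteq> 0" by auto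
      then show "linear_part \<phi> (bs ! i) \<bullet> (as ! i) = state_of \<phi> (index_pair (bs, as) i)"
        by (simp add: state_of_def index_pair_def linear_part_def)
    qed
    then show "(\<Prod>i<?k. linear_part \<phi> (bs ! i) \<bullet> (as ! i)) * T bs * ReOmega_component (as @ [a])
        = evolution_coeff chi j (bs, as) * (\<Prod>i<?k. state_of \<phi> (index_pair (bs, as) i))"
      by (simp add: evolution_coeff_def j(1) T_def)
  qed
  also have "\<dots> = evolution_field chi (state_of \<phi>) j"
    unfolding poly_field_def by (intro sum.cong refl) auto
  finally show ?thesis ..
qed

lemma evolves_state:
  fixes \<Phi> :: "real \<Rightarrow> 'a::euclidean_space \<Rightarrow> complex ^ 'm::{finite,linorder}"
  assumes "evolves I chi \<Phi>" "t \<in> I" "j \<in> state_indices"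
  shows "((\<lambda>s. state_of (\<Phi> s) j) has_real_derivative evolution_field chi (state_of (\<Phi> t)) j) (at t)"
proof -
  obtain x a where j: "j = (x, a)" by (cases j)
  have "((\<lambda>s. \<Phi> s x) has_vector_derivative velocity chi (\<Phi> t) x) (at t)" for x
    using assms by (auto simp: evolves_def)
  note d = this
  have "((\<lambda>s. (if x = 0 then \<Phi> s 0 else \<Phi> s x - \<Phi> s 0)) has_vector_derivative
      (if x = 0 then velocity chi (\<Phi> t) 0 else velocity chi (\<Phi> t) x - velocity chi (\<Phi> t) 0)) (at t)"
    using d[of 0] has_vector_derivative_diff[OF d[of x] d[of 0]] by auto
  from bounded_linear.has_vector_derivative[OF bounded_linear_inner_left this, of a]
  show ?thesis
    unfolding evolution_field_state_of[OF assms(3)] has_real_derivative_iff_has_vector_derivative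
    by (simp add: j state_of_def)
qed

lemma evolves_unique:
  fixes \<Phi> \<Psi> :: "real \<Rightarrow> 'a::euclidean_space \<Rightarrow> complex ^ 'm::{finite,linorder}"
  assumes "evolves (closed_segment a b) chi \<Phi>" "evolves (closed_segment a b) chi \<Psi>" "\<Phi> a = \<Psi> a"
  shows "\<Phi> b = \<Psi> b"
proof -
  have eq: "state_of (\<Phi> b) j = state_of (\<Psi> b) j" if "j \<in> state_indices" for j
    by (rule poly_ode_unique[OF finite_state_indices index_pair_in_state_indices
          evolves_state[OF assms(1)] evolves_state[OF assms(2)] _ that]) (use assms(3) in auto)
  have "map_of_state (state_of (\<Phi> b)) = map_of_state (state_of (\<Psi> b))"
    using eq by (auto simp: map_of_state_def fun_eq_iff state_indices_def intro!: sum.cong)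
  moreover have "affine_map (\<Phi> b)" "affine_map (\<Psi> b)" using assms by (auto simp: evolves_def)
  ultimately show ?thesis by (simp add: map_of_state_of)
qed

lemma evolution_local_analytic_solution:
  fixes \<phi> :: "'a::euclidean_space \<Rightarrow> complex ^ 'm::{finite,linorder}"
  assumes chi: "\<And>as. affine_map (\<lambda>x. chi x as)" and \<phi>: "affine_map \<phi>"
  shows "\<exists>R \<Phi>. 0 < R \<and> evolves {-R<..<R} chi \<Phi> \<and> \<Phi> 0 = \<phi> \<and>
    (\<forall>x. \<exists>a. \<forall>t. \<bar>t\<bar> < R \<longrightarrow> (\<lambda>n. t ^ n *\<^sub>R a n) sums \<Phi> t x)"
proof -
  let ?J = "state_indices :: ('a \<times> (complex ^ 'm::{finite,linorder})) set"
  show ?thesis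
  proof (rule poly_ode_local_analytic_solution[OF finite_state_indices index_pair_in_state_indices,
      where k = "CARD('m) - 1" and c = "state_of \<phi>" and C = "evolution_coeff chi"])
    fix R a assume R: "0 < R" and init: "\<And>j. a j 0 = state_of \<phi> j"
      and summ: "\<And>j t. j \<in> ?J \<Longrightarrow> \<bar>t\<bar> < R \<Longrightarrow> summable (\<lambda>n. a j n * t ^ n)"
      and deriv: "\<And>j t. j \<in> ?J \<Longrightarrow> \<bar>t\<bar> < R \<Longrightarrow> ((\<lambda>t. \<Sum>n. a j n * t ^ n) has_real_derivative
          evolution_field chi (\<lambda>j. \<Sum>n. a j n * t ^ n) j) (at t)"
    define y where "y t j = (\<Sum>n. a j n * t ^ n)" for t j
    define \<Phi> where "\<Phi> t = map_of_state (y t)" for t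
    have y_state: "state_of (\<Phi> t) j = y t j" if "j \<in> ?J" for t j
      unfolding \<Phi>_def by (rule state_of_map_of_state[OF that])
    have field: "evolution_field chi (y t) j = state_of (velocity chi (\<Phi> t)) j" if "j \<in> ?J" for t j
    proof -
      have "evolution_field chi (y t) j = evolution_field chi (state_of (\<Phi> t)) j"
        unfolding poly_field_def
        by (intro sum.cong prod.cong refl arg_cong2[of _ _ _ _ "(*)"])
          (metis y_state index_pair_in_state_indices lessThan_iff)
      then show ?thesis by (simp only: evolution_field_state_of[OF that])
    qed
    have ev: "evolves {-R<..<R} chi \<Phi>"
      unfolding evolves_def
    proof (intro ballI conjI allI)
      fix t x assume "t \<in> {-R<..<R}"
      then have t: "\<bar>t\<bar> < R" by auto
      show "affine_map (\<Phi> t)" unfolding \<Phi>_def by (rule affine_map_of_state)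
      have d: "((\<lambda>s. y s j) has_vector_derivative state_of (velocity chi (\<Phi> t)) j) (at t)" if "j \<in> ?J" for j
        using deriv[OF that t] field[OF that, of t]
        by (simp add: y_def[abs_def] has_real_derivative_iff_has_vector_derivative)
      define V where "V = state_of (velocity chi (\<Phi> t))"
      have "((\<lambda>s. map_of_state (y s) x) has_vector_derivative map_of_state V x) (at t)"
        unfolding map_of_state_def
      proof (rule has_vector_derivative_sum)
        fix a :: "complex ^ 'm::{finite,linorder}" assume a: "a \<in> Basis"
        have "((\<lambda>s. y s (0, a) + (\<Sum>b\<in>Basis. (x \<bullet> b) * y s (b, a))) has_vector_derivative
            V (0, a) + (\<Sum>b\<in>Basis. (x \<bullet> b) * V (b, a))) (at t)"
          unfolding V_def
          using a by (intro has_vector_derivative_add has_vector_derivative_sum has_vector_derivative_mult_right d)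
            (auto simp: state_indices_def)
        from bounded_linear.has_vector_derivative[OF bounded_linear_scaleR_left this, of a]
        show "((\<lambda>s. (y s (0, a) + (\<Sum>b\<in>Basis. (x \<bullet> b) * y s (b, a))) *\<^sub>R a) has_vector_derivative
            (V (0, a) + (\<Sum>b\<in>Basis. (x \<bullet> b) * V (b, a))) *\<^sub>R a) (at t)" .
      qed
      then show "((\<lambda>s. \<Phi> s x) has_vector_derivative velocity chi (\<Phi> t) x) (at t)"
        by (simp add: V_def map_of_state_of[OF affine_velocity[OF chi]] \<Phi>_def[symmetric])
    qed
    have y0: "y 0 j = state_of \<phi> j" for j
      using powser_zero[of "a j"] init by (simp add: y_def)
    have "\<Phi> 0 = map_of_state (state_of \<phi>)" by (simp add: \<Phi>_def y0[abs_def])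
    then have \<Phi>0: "\<Phi> 0 = \<phi>" using map_of_state_of[OF \<phi>] by simp
    have series: "\<exists>A. \<forall>t. \<bar>t\<bar> < R \<longrightarrow> (\<lambda>n. t ^ n *\<^sub>R A n) sums \<Phi> t x" for x
    proof (intro exI allI impI)
      fix t assume t: "\<bar>t\<bar> < R"
      have s: "(\<lambda>n. t ^ n * a j n) sums y t j" if "j \<in> ?J" for j
        using summable_sums[OF summ[OF that t]] by (simp add: y_def mult.commute)
      have "(\<lambda>n. \<Sum>e\<in>Basis. (t ^ n * a (0, e) n + (\<Sum>b\<in>Basis. (x \<bullet> b) * (t ^ n * a (b, e) n))) *\<^sub>R e) sums \<Phi> t x"
        unfolding \<Phi>_def map_of_state_def
        by (intro sums_sum sums_scaleR_left sums_add sums_mult s) (auto simp: state_indices_def)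
      moreover have "(\<Sum>e\<in>Basis. (t ^ n * a (0, e) n + (\<Sum>b\<in>Basis. (x \<bullet> b) * (t ^ n * a (b, e) n))) *\<^sub>R e)
          = t ^ n *\<^sub>R map_of_state (\<lambda>j. a j n) x" for n
        unfolding map_of_state_def scaleR_sum_right
        by (intro sum.cong refl) (simp add: distrib_left sum_distrib_left mult_ac)
      ultimately show "(\<lambda>n. t ^ n *\<^sub>R map_of_state (\<lambda>j. a j n) x) sums \<Phi> t x" by simp
    qed
    show ?thesis
      by (rule exI[of _ R], rule exI[of _ \<Phi>]) (intro conjI allI R ev \<Phi>0 series)
  qed
qed

text \<open>By uniqueness a solution agrees near \<open>t\<^sub>0\<close> with the local power series solution that starts from
  \<open>\<Phi> t\<^sub>0\<close>, so no power series has to be expanded around a new centre.\<close>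

lemma evolves_analytic:
  fixes \<Phi> :: "real \<Rightarrow> 'a::euclidean_space \<Rightarrow> complex ^ 'm::{finite,linorder}"
  assumes chi: "\<And>as. affine_map (\<lambda>x. chi x as)" and \<Phi>: "evolves {-\<epsilon><..<\<epsilon>} chi \<Phi>"
  shows "(\<lambda>t. \<Phi> t x) real_analytic_on {-\<epsilon><..<\<epsilon>}"
  unfolding real_analytic_on_def
proof
  fix t\<^sub>0 assume t0: "t\<^sub>0 \<in> {-\<epsilon><..<\<epsilon>}"
  then have "affine_map (\<Phi> t\<^sub>0)" using \<Phi> by (auto simp: evolves_def)
  from evolution_local_analytic_solution[OF chi this]
  obtain R where "\<exists>\<Psi>. 0 < R \<and> evolves {-R<..<R} chi \<Psi> \<and> \<Psi> 0 = \<Phi> t\<^sub>0 \<and>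
      (\<forall>x. \<exists>a. \<forall>t. \<bar>t\<bar> < R \<longrightarrow> (\<lambda>n. t ^ n *\<^sub>R a n) sums \<Psi> t x)" ..
  then obtain \<Psi> where "0 < R \<and> evolves {-R<..<R} chi \<Psi> \<and> \<Psi> 0 = \<Phi> t\<^sub>0 \<and>
      (\<forall>x. \<exists>a. \<forall>t. \<bar>t\<bar> < R \<longrightarrow> (\<lambda>n. t ^ n *\<^sub>R a n) sums \<Psi> t x)" ..
  then have R: "0 < R" and \<Psi>: "evolves {-R<..<R} chi \<Psi>" "\<Psi> 0 = \<Phi> t\<^sub>0"
    and series: "\<exists>a. \<forall>t. \<bar>t\<bar> < R \<longrightarrow> (\<lambda>n. t ^ n *\<^sub>R a n) sums \<Psi> t x" for x
    by simp_all
  obtain a where a: "\<And>t. \<bar>t\<bar> < R \<Longrightarrow> (\<lambda>n. t ^ n *\<^sub>R a n) sums \<Psi> t x" using series[of x] by blast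
  have "(\<lambda>n. (t - t\<^sub>0) ^ n *\<^sub>R a n) sums \<Phi> t x" if t: "\<bar>t - t\<^sub>0\<bar> < R" "t \<in> {-\<epsilon><..<\<epsilon>}" for t
  proof -
    let ?I = "closed_segment 0 (t - t\<^sub>0)"
    have "evolves ?I chi (\<lambda>s. \<Phi> (t\<^sub>0 + s))"
      by (rule evolves_shift[OF \<Phi>]) (use t0 t in \<open>auto simp: closed_segment_eq_real_ivl split: if_splits\<close>)
    moreover have "evolves ?I chi \<Psi>"
      by (rule evolves_subset[OF \<Psi>(1)]) (use t R in \<open>auto simp: closed_segment_eq_real_ivl split: if_splits\<close>)
    ultimately have "\<Phi> (t\<^sub>0 + (t - t\<^sub>0)) = \<Psi> (t - t\<^sub>0)"
      using \<Psi>(2) by (intro evolves_unique) auto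
    then show ?thesis using a[OF t(1)] by simp
  qed
  then show "\<exists>r>0. \<exists>a. \<forall>t. \<bar>t - t\<^sub>0\<bar> < r \<longrightarrow> t \<in> {-\<epsilon><..<\<epsilon>} \<longrightarrow> (\<lambda>n. (t - t\<^sub>0) ^ n *\<^sub>R a n) sums \<Phi> t x"
    using R by blast
qed


section \<open>Linear algebra of the evolution velocity\<close>

lemma omega_eq_inner: "omega u v = (\<i> *s u) \<bullet> v"
proof -
  have "omega u v = (\<Sum>j\<in>UNIV. Re (\<i> / 2 * (u $ j * cnj (v $ j) - v $ j * cnj (u $ j))))"
    by (simp add: omega_def sum_distrib_left Re_sum)
  also have "\<dots> = (\<i> *s u) \<bullet> v"
    unfolding inner_vec_def by (intro sum.cong) (auto simp: inner_complex_def field_simps)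
  finally show ?thesis .
qed

lemma inner_i_scale: "(\<i> *s u) \<bullet> (\<i> *s v) = u \<bullet> (v :: complex ^ 'm)"
  unfolding inner_vec_def by (intro sum.cong) (auto simp: inner_complex_def algebra_simps)

lemma linear_complex_scale: "linear (\<lambda>u. c *s (u :: complex ^ 'm))"
  by (rule linearI) (simp_all add: vec_eq_iff algebra_simps)

lemma bounded_bilinear_omega: "bounded_bilinear (omega :: complex ^ 'm \<Rightarrow> complex ^ 'm \<Rightarrow> real)"
proof -
  have "bounded_linear (\<lambda>u :: complex ^ 'm. \<i> *s u)"
    using linear_complex_scale linear_conv_bounded_linear by blast
  from bounded_bilinear.comp1[OF bounded_bilinear_inner this] show ?thesis
    by (simp add: omega_eq_inner[abs_def])
qed

interpretation omega: bounded_bilinear "omega :: complex ^ 'm \<Rightarrow> complex ^ 'm \<Rightarrow> real"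
  by (rule bounded_bilinear_omega)

lemma omega_antisym: "omega u v = - omega v u"
  by (simp add: omega_def sum_subtractf algebra_simps)

lemma omega_self: "omega u u = 0"
  using omega_antisym[of u u] by simp

lemma omega_eq_inner_right: "omega u v = - (u \<bullet> (\<i> *s v))"
  using omega_antisym[of u v] omega_eq_inner[of v u] inner_commute[of "\<i> *s v" u] by simp

lemma omega_zero_span:
  assumes A: "\<And>u v. u \<in> A \<Longrightarrow> v \<in> B \<Longrightarrow> omega u v = 0" and "u \<in> span A" "v \<in> span B"
  shows "omega u v = 0"
  using assms(2)
proof (induction rule: span_induct)
  case base
  show ?case by (auto simp: subspace_def omega.add_left omega.scaleR_left omega.zero_left)
next
  case (step x)
  show ?case
    using assms(3)
  proof (induction rule: span_induct)
    case base
    show ?case by (auto simp: subspace_def omega.add_right omega.scaleR_right omega.zero_right)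
  qed (use A step in auto)
qed

lemma Omega_repeated: "i \<noteq> l \<Longrightarrow> Omega (a(l := a i)) = 0"
  unfolding Omega_def by (rule det_identical_rows[of i l]) (auto simp: row_def vec_eq_iff)

text \<open>As \<open>\<Omega>\<close> is complex linear in each slot, this covers the whole complex line through a real
  combination of the other arguments, where \<open>\<Omega>\<close> vanishes by alternation.\<close>

lemma Omega_in_span_others:
  assumes "x \<in> span (a ` (- {l}))" shows "Omega (a(l := c *s x)) = 0"
proof -
  have "Omega (a(l := x)) = 0"
    using assms
  proof (induction rule: span_induct)
    case base
    show ?case
      using linear_0[OF linear_Omega_update[of a l]] linear_add[OF linear_Omega_update[of a l]]
        linear_scale[OF linear_Omega_update[of a l]]
      by (auto simp del: fun_upd_apply simp: subspace_def)
  next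
    case (step x)
    then obtain i where "x = a i" "i \<noteq> l" by auto
    then show ?case using Omega_repeated[OF \<open>i \<noteq> l\<close>, of a] by (simp only:)
  qed
  then show ?thesis by (simp add: Omega_update_scale)
qed

lemma Omega_real_combination:
  fixes a :: "'m::finite \<Rightarrow> complex ^ 'm"
  shows "Omega (\<lambda>i. \<Sum>j\<in>UNIV. A i j *\<^sub>R a j) = of_real (det (\<chi> i j. A i j)) * Omega a"
proof -
  have "(\<chi> i j. (\<Sum>l\<in>UNIV. A i l *\<^sub>R a l) $ j) = (\<chi> i j. complex_of_real (A i j)) ** (\<chi> i j. a i $ j)"
    by (simp add: matrix_matrix_mult_def vec_eq_iff scaleR_conv_of_real[symmetric])
  moreover have "det (\<chi> i j. complex_of_real (A i j)) = of_real (det (\<chi> i j. A i j))"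
    by (simp add: det_def)
  ultimately show ?thesis by (simp add: Omega_def det_mul)
qed

text \<open>A complex relation between the vectors has the form \<open>u + \<i> v = 0\<close> with \<open>u\<close> and \<open>v\<close> in their real
  span. Isotropy makes \<open>\<i> v\<close> orthogonal to \<open>u\<close>, so \<open>u = v = 0\<close> and the relation is trivial.\<close>

lemma Omega_nonzero_if_isotropic:
  fixes a :: "'m::finite \<Rightarrow> complex ^ 'm"
  assumes indep: "\<And>r. (\<Sum>i\<in>UNIV. r i *\<^sub>R a i) = 0 \<Longrightarrow> \<forall>i. r i = (0::real)"
    and iso: "\<And>i j. omega (a i) (a j) = 0"
  shows "Omega a \<noteq> 0"
proof
  assume "Omega a = 0"
  let ?A = "\<chi> i j. a i $ j"
  have "det (transpose ?A) = 0" using \<open>Omega a = 0\<close> by (simp add: Omega_def)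
  then have "\<not> invertible (transpose ?A)" using invertible_det_nz by blast
  then obtain c where c: "transpose ?A *v c = 0" "c \<noteq> 0"
    using invertible_left_inverse matrix_left_invertible_ker by blast
  define u where "u = (\<Sum>i\<in>UNIV. Re (c $ i) *\<^sub>R a i)"
  define v where "v = (\<Sum>i\<in>UNIV. Im (c $ i) *\<^sub>R a i)"
  have "u + \<i> *s v = transpose ?A *v c"
    unfolding u_def v_def vec_eq_iff
  proof
    fix j
    have "(\<Sum>i\<in>UNIV. Re (c $ i) *\<^sub>R a i $ j) + \<i> * (\<Sum>i\<in>UNIV. Im (c $ i) *\<^sub>R a i $ j)
        = (\<Sum>i\<in>UNIV. (of_real (Re (c $ i)) + \<i> * of_real (Im (c $ i))) * a i $ j)"
      by (simp add: sum_distrib_left sum.distrib[symmetric] distrib_right scaleR_conv_of_real mult.assoc)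
    then show "((\<Sum>i\<in>UNIV. Re (c $ i) *\<^sub>R a i) + \<i> *s (\<Sum>i\<in>UNIV. Im (c $ i) *\<^sub>R a i)) $ j = (transpose ?A *v c) $ j"
      by (simp add: matrix_vector_mult_def transpose_def complex_eq[symmetric] mult.commute)
  qed
  then have sum0: "u + \<i> *s v = 0" using c by simp
  have span: "u \<in> span (range a)" "v \<in> span (range a)"
    unfolding u_def v_def by (intro span_sum span_scale span_base rangeI)+
  have iso': "omega x y = 0" if "x \<in> span (range a)" "y \<in> span (range a)" for x y
    by (rule omega_zero_span[OF _ that]) (use iso in auto)
  have "u \<bullet> u = (u + \<i> *s v) \<bullet> u - omega v u" by (simp add: inner_add_left omega_eq_inner)
  then have u0: "u = 0" using sum0 iso'[OF span(2,1)] by simp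
  then have "\<i> *s v = 0" using sum0 by simp
  then have v0: "v = 0" using inner_i_scale[of v v] by simp
  have "\<forall>i. Re (c $ i) = 0" by (rule indep) (use u0 in \<open>simp add: u_def\<close>)
  moreover have "\<forall>i. Im (c $ i) = 0" by (rule indep) (use v0 in \<open>simp add: v_def\<close>)
  ultimately have "c = 0" by (simp add: vec_eq_iff complex_eq_iff)
  with c show False by simp
qed

text \<open>The Hermitian product has real part \<open>g\<close> and imaginary part \<open>- \<omega>\<close>, so the vectors form a unitary basis.\<close>

lemma Omega_orthonormal_lagrangian:
  fixes e :: "'m::finite \<Rightarrow> complex ^ 'm"
  assumes on: "\<And>i j. e i \<bullet> e j = (if i = j then 1 else 0)" and iso: "\<And>i j. omega (e i) (e j) = 0"
  shows "cmod (Omega e) = 1"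
proof -
  let ?A = "\<chi> i j. e i $ j" and ?B = "\<chi> i j. cnj (e i $ j)"
  have herm: "(\<Sum>j\<in>UNIV. u $ j * cnj (v $ j)) = Complex (u \<bullet> v) (- omega u v)" for u v :: "complex ^ 'm"
    unfolding omega_eq_inner inner_vec_def
    by (auto simp: complex_eq_iff inner_complex_def Re_sum Im_sum sum_negf[symmetric] intro!: sum.cong)
  have "?A ** transpose ?B = mat 1"
    by (simp add: vec_eq_iff matrix_matrix_mult_def transpose_def mat_def herm on iso complex_eq_iff)
  then have "det ?A * det ?B = 1" by (metis det_I det_mul det_transpose)
  moreover have "det ?B = cnj (det ?A)" by (simp add: det_def)
  ultimately have "Omega e * cnj (Omega e) = 1" by (simp add: Omega_def)
  then have "(cmod (Omega e))\<^sup>2 = 1" by (metis complex_norm_square of_real_eq_1_iff)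
  then show ?thesis by (simp add: power2_eq_1_iff) (smt (verit) norm_ge_zero)
qed

text \<open>\<open>E\<close> is a basis of \<open>W\<close>, indexed by the coordinates other than \<open>l\<close>. Slot \<open>l\<close> of \<open>\<Omega>\<close> is
  the one that the contraction leaves open.\<close>

lemma contract_Lambda_top_degree:
  fixes W :: "'a::euclidean_space set"
  assumes W: "subspace W" "dim W = CARD('m::{finite,linorder}) - 1" and T: "T \<in> Lambda (CARD('m) - 1) W"
  obtains K and l :: "'m::{finite,linorder}" and E :: "'m::{finite,linorder} \<Rightarrow> 'a"
  where "inj_on E (- {l})" "independent (E ` (- {l}))"
    "span (E ` (- {l})) = W" "T \<noteq> (\<lambda>_. 0) \<Longrightarrow> K \<noteq> 0"
    "\<And>(L :: 'a \<Rightarrow> complex ^ 'm::{finite,linorder}) y. linear L \<Longrightarrow>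
       contract_ReOmega (pushforward (CARD('m) - 1) L T) \<bullet> y = K * Re (Omega ((\<lambda>i. L (E i))(l := y)))"
proof -
  let ?k = "CARD('m) - 1"
  obtain es K where es: "length es = ?k" "distinct es" "span (set es) = W" "independent (set es)"
    and TK: "T = (\<lambda>as. K * wedge ?k es as)"
    using Lambda_top_degree[OF W T] by metis
  have "?k < CARD('m)" by simp
  from obtain_position[OF this] obtain l :: 'm where
    l: "card {j. j < l} = ?k" "\<And>i. card {j. j < i} = ?k \<longleftrightarrow> i = l" by metis
  have less: "card {j. j < i} < ?k" if "i \<noteq> l" for i :: 'm
    using position_less[of i] l(2)[of i] that by linarith
  define E where "E = (by_position (es @ [0]) :: 'm \<Rightarrow> 'a)"
  have E: "E i = es ! card {j. j < i}" if "i \<noteq> l" for i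
    using less[OF that] es(1) by (simp add: E_def by_position_def nth_append)
  have inj: "inj_on E (- {l})"
  proof (rule inj_onI)
    fix i j assume ij: "i \<in> - {l}" "j \<in> - {l}" "E i = E j"
    then have "card {r. r < i} = card {r. r < j}"
      using E less es by (simp add: nth_eq_iff_index_eq)
    then show "i = j" using position_bij[where 'm = 'm] by (simp add: bij_betw_def inj_on_def)
  qed
  have "E i \<in> set es" if "i \<noteq> l" for i
    unfolding E[OF that] using less[OF that] es(1) by (intro nth_mem) simp
  then have "E ` (- {l}) \<subseteq> set es" by auto
  moreover have "card (E ` (- {l})) = card (set es)"
    using es card_image[OF inj] by (simp add: distinct_card Compl_eq_Diff_UNIV)
  ultimately have img: "E ` (- {l}) = set es" by (intro card_subset_eq) auto
  have "contract_ReOmega (pushforward ?k L T) \<bullet> y = K * fact ?k * Re (Omega ((\<lambda>i. L (E i))(l := y)))"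
    if L: "linear L" for L :: "'a \<Rightarrow> complex ^ 'm::{finite,linorder}" and y
  proof -
    have "by_position (map L es @ [y]) = (\<lambda>i. L (E i))(l := y)"
    proof
      fix i :: 'm
      show "by_position (map L es @ [y]) i = ((\<lambda>i. L (E i))(l := y)) i"
        using l(1) less[of i] E[of i] es(1) by (cases "i = l") (simp_all add: by_position_def nth_append)
    qed
    then show ?thesis
      unfolding TK contract_pushforward_wedge[OF L es(1)] by (simp add: ReOmega_component_def)
  qed
  moreover have "T \<noteq> (\<lambda>_. 0) \<Longrightarrow> K * fact ?k \<noteq> 0" using TK by auto
  ultimately show ?thesis using that[of E l "K * fact ?k"] inj img es by simp
qed

text \<open>All parts rest on \<open>X \<bullet> y = K * Re (\<Omega>(L e\<^sub>1, \<dots>, L e\<^sub>m\<^sub>-\<^sub>1, y))\<close>. The right-hand side vanishes for \<open>y\<close> in the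
  complex span of \<open>L W\<close>, which gives the orthogonality relations. It vanishes for all \<open>y\<close> if the
  vectors \<open>L e\<^sub>i\<close> are dependent. If \<open>L W\<close> is isotropic of dimension \<open>m - 1\<close>, a vector \<open>y\<close> orthogonal to
  \<open>L W\<close> and \<open>\<i> L W\<close> completes it to a Lagrangian subspace, where \<open>\<Omega>\<close> does not vanish. Finally
  \<open>y = \<i> X\<close> gives \<open>- K Im \<Omega>(L e\<^sub>1, \<dots>, L e\<^sub>m\<^sub>-\<^sub>1, X) = X \<bullet> \<i> X = 0\<close>.\<close>

lemma velocity_properties:
  fixes \<phi> :: "'a::euclidean_space \<Rightarrow> complex ^ 'm::{finite,linorder}" and chi x
  defines "L \<equiv> linear_part \<phi>" and "X \<equiv> velocity chi \<phi> x"
  assumes \<phi>: "affine_map \<phi>" and W: "subspace W" "dim W = CARD('m) - 1"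
    and chi: "chi x \<in> Lambda (CARD('m) - 1) W" "chi x \<noteq> (\<lambda>_. 0)"
  shows velocity_orthogonal: "w \<in> W \<Longrightarrow> X \<bullet> L w = 0" "w \<in> W \<Longrightarrow> omega X (L w) = 0"
    and velocity_nonzero_if_inj: "(\<And>u v. u \<in> W \<Longrightarrow> v \<in> W \<Longrightarrow> omega (L u) (L v) = 0) \<Longrightarrow> inj_on L W \<Longrightarrow> X \<noteq> 0"
    and velocity_nonzero_imp_inj: "X \<noteq> 0 \<Longrightarrow> inj_on L W"
    and velocity_special_lagrangian_frame:
      "X \<noteq> 0 \<Longrightarrow> (\<And>u v. u \<in> W \<Longrightarrow> v \<in> W \<Longrightarrow> omega (L u) (L v) = 0) \<Longrightarrow>
        \<exists>a. span (range a) = span (insert X (L ` W)) \<and> dim (span (range a)) = CARD('m) \<and>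
          (\<forall>i j. omega (a i) (a j) = 0) \<and> Im (Omega (a :: 'm \<Rightarrow> _)) = 0"
proof -
  obtain K and l :: 'm and E :: "'m \<Rightarrow> 'a" where E: "inj_on E (- {l})" "independent (E ` (- {l}))"
    "span (E ` (- {l})) = W" and K: "K \<noteq> 0" and
    con: "\<And>(L :: 'a \<Rightarrow> complex ^ 'm::{finite,linorder}) y. linear L \<Longrightarrow>
       contract_ReOmega (pushforward (CARD('m) - 1) L (chi x)) \<bullet> y = K * Re (Omega ((\<lambda>i. L (E i))(l := y)))"
    using contract_Lambda_top_degree[OF W chi(1)] chi(2) by metis
  have L: "linear L" unfolding L_def by (rule affine_mapE(1)[OF \<phi>])
  let ?a = "\<lambda>y. (\<lambda>i. L (E i))(l := y)"
  have X: "X \<bullet> y = K * Re (Omega (?a y))" for y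
    unfolding X_def velocity_def using con[OF L[unfolded L_def], of y] by (simp add: L_def)
  have LW: "L ` W = span ((\<lambda>i. L (E i)) ` (- {l}))"
    unfolding E(3)[symmetric] linear_span_image[OF L, symmetric] by (simp add: image_image)
  have zero: "Omega (?a (c *s L w)) = 0" if "w \<in> W" for c w
    using Omega_in_span_others[of "L w" "\<lambda>i. L (E i)" l c] that LW by blast
  show orth: "X \<bullet> L w = 0" if "w \<in> W" for w
    using zero[OF that, of 1] X by simp
  show om: "omega X (L w) = 0" if "w \<in> W" for w
    unfolding omega_eq_inner_right using zero[OF that, of \<i>] X[of "\<i> *s L w"] by simp
  have E_W: "E i \<in> W" if "i \<noteq> l" for i using that E(3) span_base[of "E i" "E ` (- {l})"] by simp
  have comb: "\<forall>i. i \<noteq> l \<longrightarrow> r i = 0" if "inj_on L W" "(\<Sum>i\<in>- {l}. r i *\<^sub>R L (E i)) = 0" for r :: "'m \<Rightarrow> real"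
  proof -
    have "L (\<Sum>i\<in>- {l}. r i *\<^sub>R E i) = L 0"
      using that(2) by (simp add: linear_sum[OF L] linear_scale[OF L] linear_0[OF L])
    moreover have "(\<Sum>i\<in>- {l}. r i *\<^sub>R E i) \<in> W"
      using E_W W(1) by (intro subspace_sum subspace_scale) auto
    ultimately have s: "(\<Sum>i\<in>- {l}. r i *\<^sub>R E i) = 0"
      using that(1) subspace_0[OF W(1)] by (metis inj_onD)
    have "(\<Sum>v\<in>E ` (- {l}). r (inv_into (- {l}) E v) *\<^sub>R v) = 0"
      unfolding sum.reindex[OF E(1)] comp_def s[symmetric]
      by (intro sum.cong refl) (simp add: inv_into_f_f[OF E(1)])
    then have "\<forall>v\<in>E ` (- {l}). r (inv_into (- {l}) E v) = 0"
      using E(2) independentD[OF E(2), of "E ` (- {l})" "\<lambda>v. r (inv_into (- {l}) E v)"] by auto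
    then show ?thesis using E(1) by (auto simp: inv_into_f_f)
  qed
  have frame_indep: "\<forall>i. r i = 0" if inj: "inj_on L W" and y: "y \<noteq> 0" "\<And>w. w \<in> W \<Longrightarrow> y \<bullet> L w = 0"
    and s: "(\<Sum>i\<in>UNIV. r i *\<^sub>R ?a y i) = 0" for y and r :: "'m \<Rightarrow> real"
  proof -
    have split: "(\<Sum>i\<in>UNIV. r i *\<^sub>R ?a y i) = r l *\<^sub>R y + (\<Sum>i\<in>- {l}. r i *\<^sub>R L (E i))"
      by (subst sum.remove[of _ l]) (auto simp: Compl_eq_Diff_UNIV intro!: sum.cong)
    have "y \<bullet> (\<Sum>i\<in>- {l}. r i *\<^sub>R L (E i)) = 0"
      using y(2) E_W by (simp add: inner_sum_right)
    then have "y \<bullet> (r l *\<^sub>R y + (\<Sum>i\<in>- {l}. r i *\<^sub>R L (E i))) = r l * (y \<bullet> y)"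
      by (simp add: inner_add_right)
    then have "r l = 0" using s split y(1) by simp
    then show ?thesis using comb[OF inj, of r] s split by auto
  qed
  have frame_iso: "omega (?a y i) (?a y j) = 0" if iso: "\<And>u v. u \<in> W \<Longrightarrow> v \<in> W \<Longrightarrow> omega (L u) (L v) = 0"
    and y: "\<And>w. w \<in> W \<Longrightarrow> omega y (L w) = 0" for y i j
    using iso y E_W omega_antisym[of _ y] by (auto simp: omega_self)
  show "X \<noteq> 0" if iso: "\<And>u v. u \<in> W \<Longrightarrow> v \<in> W \<Longrightarrow> omega (L u) (L v) = 0" and inj: "inj_on L W"
  proof -
    let ?Z = "L ` W \<union> (\<lambda>u. \<i> *s u) ` (L ` W)"
    have "dim ?Z \<le> dim (L ` W) + dim ((\<lambda>u. \<i> *s u) ` (L ` W))"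
    proof -
      have "span ?Z = {x + y |x y. x \<in> span (L ` W) \<and> y \<in> span ((\<lambda>u. \<i> *s u) ` (L ` W))}"
        by (rule span_Un)
      then have "dim (span ?Z) \<le> dim (span (L ` W)) + dim (span ((\<lambda>u. \<i> *s u) ` (L ` W)))"
        using dim_sums_Int[of "span (L ` W)" "span ((\<lambda>u. \<i> *s u) ` (L ` W))"] by simp
      then show ?thesis by simp
    qed
    also have "\<dots> \<le> dim W + dim W"
      using dim_image_le[OF L, of W] dim_image_le[OF linear_complex_scale, of \<i> "L ` W"] by linarith
    also have "\<dots> < DIM(complex ^ 'm::{finite,linorder})" 
    proof -
      have "dim W + dim W < 2 * CARD('m)" using W(2) zero_less_card_finite[where 'a = 'm] by linarith
      then show ?thesis by simp
    qed
    finally obtain y where y: "y \<noteq> 0" "\<And>z. z \<in> span ?Z \<Longrightarrow> orthogonal y z"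
      by (metis orthogonal_to_subspace_exists)
    have y1: "y \<bullet> L w = 0" if "w \<in> W" for w
      using y(2)[of "L w"] that by (auto simp: orthogonal_def intro: span_base)
    have y2: "omega y (L w) = 0" if "w \<in> W" for w
    proof -
      have "\<i> *s L w \<in> span ?Z" using that by (intro span_base) auto
      then show ?thesis unfolding omega_eq_inner_right using y(2) by (simp add: orthogonal_def)
    qed
    have "Omega (?a y) \<noteq> 0"
      by (rule Omega_nonzero_if_isotropic[OF frame_indep[OF inj y(1) y1] frame_iso[OF iso y2]]) auto
    \<comment> \<open>The phase of \<open>y\<close> is corrected so that \<open>\<Omega>\<close> becomes real and positive.\<close>
    moreover have "Omega (?a (cnj (Omega (?a y)) *s y)) = (cmod (Omega (?a y)))\<^sup>2"
      by (simp add: Omega_update_scale complex_norm_square[unfolded of_real_power] mult.commute)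
    ultimately have "X \<bullet> (cnj (Omega (?a y)) *s y) \<noteq> 0" using K by (simp add: X)
    then show ?thesis by auto
  qed
  show injX: "inj_on L W" if "X \<noteq> 0"
  proof (rule ccontr)
    assume "\<not> inj_on L W"
    then obtain w where w: "w \<in> W" "w \<noteq> 0" "L w = 0"
      using linear_inj_on_iff_eq_0[OF L W(1)] by blast
    obtain u where u: "w = (\<Sum>v\<in>E ` (- {l}). u v *\<^sub>R v)"
      using w(1) E(3) span_finite[of "E ` (- {l})"] by auto
    have "\<exists>v\<in>E ` (- {l}). u v \<noteq> 0"
    proof (rule ccontr)
      assume "\<not> (\<exists>v\<in>E ` (- {l}). u v \<noteq> 0)"
      then have "w = 0" unfolding u by (intro sum.neutral) auto
      with w(2) show False by simp
    qed
    then obtain i where i: "i \<noteq> l" "u (E i) \<noteq> 0" by auto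
    have Lw: "(\<Sum>j\<in>- {l}. u (E j) *\<^sub>R L (E j)) = 0"
      using w(3) u E(1) by (simp add: sum.reindex linear_sum[OF L] linear_scale[OF L])
    have Oz: "Omega (?a y) = 0" for y
    proof -
      have Lw': "u (E i) *\<^sub>R L (E i) + (\<Sum>j\<in>- {l} - {i}. u (E j) *\<^sub>R L (E j)) = 0"
        using Lw sum.remove[of "- {l}" i "\<lambda>j. u (E j) *\<^sub>R L (E j)"] i by simp
      have "u (E i) *\<^sub>R L (E i) \<in> span (?a y ` (- {i}))"
      proof -
        have "u (E i) *\<^sub>R L (E i) = - (\<Sum>j\<in>- {l} - {i}. u (E j) *\<^sub>R L (E j))"
          using Lw' by (simp add: add_eq_0_iff2)
        moreover have "(\<Sum>j\<in>- {l} - {i}. u (E j) *\<^sub>R L (E j)) \<in> span (?a y ` (- {i}))"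
        proof (intro span_sum span_scale span_base)
          fix j assume "j \<in> - {l} - {i}"
          then show "L (E j) \<in> ?a y ` (- {i})" by (intro image_eqI[of _ _ j]) auto
        qed
        ultimately show ?thesis by (simp add: span_neg)
      qed
      then have "L (E i) \<in> span (?a y ` (- {i}))"
        using i(2) span_scale[of "u (E i) *\<^sub>R L (E i)" _ "inverse (u (E i))"] by simp
      from Omega_in_span_others[OF this, of 1] have "Omega ((?a y)(i := L (E i))) = 0" by simp
      moreover have "(?a y)(i := L (E i)) = ?a y" using i(1) by (auto simp: fun_eq_iff)
      ultimately show ?thesis by simp
    qed
    have "X \<bullet> X = 0" using X[of X] Oz by simp
    then show False using that by simp
  qed
  show "\<exists>a. span (range a) = span (insert X (L ` W)) \<and> dim (span (range a)) = CARD('m) \<and>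
          (\<forall>i j. omega (a i) (a j) = 0) \<and> Im (Omega (a :: 'm \<Rightarrow> _)) = 0"
    if X0: "X \<noteq> 0" and iso: "\<And>u v. u \<in> W \<Longrightarrow> v \<in> W \<Longrightarrow> omega (L u) (L v) = 0"
  proof (intro exI[of _ "?a X"] conjI allI)
    have range: "range (?a X) = insert X ((\<lambda>i. L (E i)) ` (- {l}))" by auto
    show span: "span (range (?a X)) = span (insert X (L ` W))"
      unfolding range LW span_insert span_span ..
    show "omega (?a X i) (?a X j) = 0" for i j by (rule frame_iso[OF iso om])
    have "X \<bullet> (\<i> *s X) = 0" using omega_self[of X] unfolding omega_eq_inner_right by simp
    then show "Im (Omega (?a X)) = 0" using X[of "\<i> *s X"] K by (simp add: Omega_update_scale)
    have fi: "\<forall>i. r i = 0" if "(\<Sum>i\<in>UNIV. r i *\<^sub>R ?a X i) = 0" for r :: "'m \<Rightarrow> real"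
      using frame_indep[OF injX[OF X0] X0 orth that] by blast
    have inj_a: "inj (?a X)"
    proof (rule injI, rule ccontr)
      fix i j assume ij: "?a X i = ?a X j" "i \<noteq> j"
      have "(\<Sum>r\<in>UNIV. (if r = i then 1 else if r = j then - 1 else 0) *\<^sub>R ?a X r)
          = (\<Sum>r\<in>UNIV. (if r = i then ?a X i else 0) - (if r = j then ?a X j else 0))"
        using ij(2) by (intro sum.cong) auto
      also have "\<dots> = 0" using ij(1) by (simp add: sum_subtractf)
      finally show False using fi[of "\<lambda>r. if r = i then 1 else if r = j then - 1 else 0"] by (metis zero_neq_one)
    qed
    have "independent (range (?a X))"
    proof (rule independent_if_scalars_zero)
      fix f x assume f: "(\<Sum>v\<in>range (?a X). f v *\<^sub>R v) = 0" "x \<in> range (?a X)"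
      have "(\<Sum>i\<in>UNIV. f (?a X i) *\<^sub>R ?a X i) = 0" using f(1) unfolding sum.reindex[OF inj_a] by (simp add: comp_def)
      from fi[OF this] show "f x = 0" using f(2) by blast
    qed auto
    then show "dim (span (range (?a X))) = CARD('m)"
      using card_image[OF inj_a] by (simp add: dim_eq_card_independent)
  qed
qed


section \<open>What the evolution preserves\<close>

lemma contract_pushforward_cong:
  fixes L L' :: "'a::euclidean_space \<Rightarrow> complex ^ 'm::{finite,linorder}"
  assumes L: "linear L" "linear L'" "\<And>w. w \<in> W \<Longrightarrow> L w = L' w" and T: "T \<in> Lambda (CARD('m) - 1) W"
  shows "contract_ReOmega (pushforward (CARD('m) - 1) L T) = contract_ReOmega (pushforward (CARD('m) - 1) L' T)"
proof (rule euclidean_eqI)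
  fix y :: "complex ^ 'm::{finite,linorder}"
  let ?k = "CARD('m) - 1"
  obtain N :: nat and c v where v: "\<And>r. r < N \<Longrightarrow> length (v r) = ?k \<and> set (v r) \<subseteq> W"
    and T': "T = (\<lambda>as. \<Sum>r<N. c r * wedge ?k (v r) as)"
    using T unfolding Lambda_def by blast
  have eq: "contract_ReOmega (pushforward ?k L T) \<bullet> y = (\<Sum>r<N. c r * fact ?k * ReOmega_component (map L (v r) @ [y]))"
    if "linear L" for L :: "'a \<Rightarrow> complex ^ 'm::{finite,linorder}"
  proof -
    have "contract_ReOmega (pushforward ?k L T) \<bullet> y
        = (\<Sum>r<N. contract_ReOmega (pushforward ?k L (\<lambda>as. c r * wedge ?k (v r) as)) \<bullet> y)"
      unfolding contract_pushforward_inner T' sum_distrib_right by (rule sum.swap)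
    also have "\<dots> = (\<Sum>r<N. c r * fact ?k * ReOmega_component (map L (v r) @ [y]))"
      using v by (intro sum.cong refl contract_pushforward_wedge that) auto
    finally show ?thesis .
  qed
  have map_eq: "map L (v r) = map L' (v r)" if "r < N" for r using v[OF that] L(3) by auto
  show "contract_ReOmega (pushforward ?k L T) \<bullet> y = contract_ReOmega (pushforward ?k L' T) \<bullet> y"
    unfolding eq[OF L(1)] eq[OF L(2)] by (intro sum.cong refl) (metis map_eq lessThan_iff)
qed

lemma Lambda_add_diff_scale:
  assumes "S \<in> Lambda k W" "T \<in> Lambda k W" "R \<in> Lambda k W"
  shows "(\<lambda>as. a * S as + b * T as + c * R as) \<in> Lambda k W"
proof -
  let ?T = "\<lambda>i::nat. if i = 0 then S else if i = 1 then T else R"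
  let ?u = "\<lambda>i::nat. if i = 0 then a else if i = 1 then b else c"
  have "(\<lambda>as. \<Sum>i\<in>{0, 1, 2}. ?u i * ?T i as) \<in> Lambda k W"
    by (rule Lambda_linear_combination) (use assms in auto)
  then show ?thesis by (simp add: add.assoc)
qed

text \<open>Conditions that are affine in the point extend from a set of points to its affine hull \<open>q + W\<close>.
  This lemma and the next one make the extension a matter of minimality of the span.\<close>

lemma subspace_Lambda_directions:
  assumes chi: "\<And>as. affine_map (\<lambda>x. chi x as)" and q: "chi q \<in> Lambda k W"
  shows "subspace {w. chi (q + w) \<in> Lambda k W}"
  unfolding subspace_def
proof (intro conjI ballI allI)
  show "0 \<in> {w. chi (q + w) \<in> Lambda k W}" using q by simp
next
  fix v w assume vw: "v \<in> {w. chi (q + w) \<in> Lambda k W}" "w \<in> {w. chi (q + w) \<in> Lambda k W}"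
  have "chi (q + (v + w)) = (\<lambda>as. 1 * chi (q + v) as + 1 * chi (q + w) as + (-1) * chi q as)"
    using affine_map_combination(1)[OF chi] by (auto simp: fun_eq_iff)
  then show "v + w \<in> {w. chi (q + w) \<in> Lambda k W}"
    using Lambda_add_diff_scale[of "chi (q + v)" k W "chi (q + w)" "chi q" 1 1 "-1"] vw q by simp
next
  fix r w assume w: "w \<in> {w. chi (q + w) \<in> Lambda k W}"
  have "chi (q + r *\<^sub>R w) = (\<lambda>as. r * chi (q + w) as + (1 - r) * chi q as + 0 * chi q as)"
    using affine_map_combination(2)[OF chi] by (auto simp: fun_eq_iff)
  then show "r *\<^sub>R w \<in> {w. chi (q + w) \<in> Lambda k W}"
    using Lambda_add_diff_scale[of "chi (q + w)" k W "chi q" "chi q" r "1 - r" 0] w q by simp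
qed

lemma subspace_zero_directions:
  assumes f: "affine_map f" and q: "f q = 0"
  shows "subspace {w. f (q + w) = 0}"
  using q by (auto simp: subspace_def affine_map_combination[OF f])

lemma linear_projection_exists:
  fixes W :: "'a::euclidean_space set"
  assumes "subspace W"
  obtains p where "linear p" "\<And>x. p x \<in> W" "\<And>w. w \<in> W \<Longrightarrow> p w = w"
proof -
  obtain B where B: "B \<subseteq> W" "pairwise orthogonal B" "\<And>x. x \<in> B \<Longrightarrow> norm x = 1" "independent B" "span B = W"
    using orthonormal_basis_subspace[OF assms] by metis
  have fin: "finite B" using B independent_bound by blast
  define p where "p x = (\<Sum>b\<in>B. (x \<bullet> b) *\<^sub>R b)" for x
  show ?thesis
  proof (rule that)
    show "linear p"
      by (rule linearI) (simp_all add: p_def inner_add_left scaleR_add_left sum.distrib scaleR_sum_right)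
    show "p x \<in> W" for x
      unfolding p_def using B(1) assms by (intro subspace_sum subspace_scale) auto
    show "p w = w" if "w \<in> W" for w
      unfolding p_def using orthonormal_expansion[OF B(2,3) fin] that B(5) by simp
  qed
qed

text \<open>Let \<open>\<pi>\<close> be an affine projection onto the affine hull of \<open>P'\<close>. On the hull \<open>chi\<close> takes values in
  \<open>\<Lambda> W\<close>, so its push-forward depends on the restriction of \<open>\<Phi> t\<close> to the hull alone, and \<open>\<Phi> t \<circ> \<pi>\<close>
  solves the evolution equation for the data \<open>chi \<circ> \<pi>\<close>. Its velocity vanishes at time \<open>t\<^sub>0\<close>, first on
  \<open>P'\<close> and then on the hull, so by uniqueness it is constant in time.\<close>

lemma velocity_zero_persists:
  fixes \<Phi> :: "real \<Rightarrow> 'a::euclidean_space \<Rightarrow> complex ^ 'm::{finite,linorder}"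
  assumes chi: "\<And>as. affine_map (\<lambda>x. chi x as)" and \<Phi>: "evolves {-\<epsilon><..<\<epsilon>} chi \<Phi>"
    and q: "q \<in> P'" and chi_P': "\<And>p. p \<in> P' \<Longrightarrow> chi p \<in> Lambda (CARD('m) - 1) (span ((\<lambda>p. p - q) ` P'))"
    and t: "t\<^sub>0 \<in> {-\<epsilon><..<\<epsilon>}" "t\<^sub>1 \<in> {-\<epsilon><..<\<epsilon>}"
    and zero: "\<And>p. p \<in> P' \<Longrightarrow> velocity chi (\<Phi> t\<^sub>0) p = 0" and p: "p \<in> P'"
  shows "velocity chi (\<Phi> t\<^sub>1) p = 0"
proof -
  let ?k = "CARD('m) - 1"
  define W where "W = span ((\<lambda>p. p - q) ` P')"
  have W: "subspace W" by (simp add: W_def)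
  obtain pr where pr: "linear pr" "\<And>x. pr x \<in> W" "\<And>w. w \<in> W \<Longrightarrow> pr w = w"
    using linear_projection_exists[OF W] by metis
  define \<pi> where "\<pi> x = q + pr (x - q)" for x
  have \<pi>_fix: "\<pi> p = p" if "p \<in> P'" for p
    using pr(3)[of "p - q"] that by (simp add: \<pi>_def W_def span_base)
  define chi' where "chi' x = chi (\<pi> x)" for x
  have comp_affine: "affine_map (\<lambda>x. f (\<pi> x)) \<and> linear_part (\<lambda>x. f (\<pi> x)) = linear_part f \<circ> pr"
    if f: "affine_map f" for f :: "'a \<Rightarrow> 'b::real_vector"
  proof -
    note lin = affine_mapE(1)[OF f]
    have eq: "f (\<pi> x) = f q + linear_part f (pr x - pr q)" for x
      using affine_mapE(2)[OF f, of "\<pi> x"] affine_mapE(2)[OF f, of q]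
      by (simp add: \<pi>_def linear_add[OF lin] linear_diff[OF pr(1)])
    have "f (\<pi> x) - f (\<pi> 0) = linear_part f (pr x)" for x
      unfolding eq by (simp add: linear_diff[OF lin] linear_0[OF pr(1)] linear_0[OF lin] linear_neg[OF lin])
    then have "linear_part (\<lambda>x. f (\<pi> x)) = linear_part f \<circ> pr"
      by (simp add: fun_eq_iff linear_part_def[of "\<lambda>x. f (\<pi> x)"])
    moreover have "affine_map (\<lambda>x. f (\<pi> x))"
      by (rule affine_mapI[of "linear_part f \<circ> pr" _ "f q - linear_part f (pr q)"])
        (simp_all add: linear_compose[OF pr(1) lin] eq linear_diff[OF lin] fun_eq_iff)
    ultimately show ?thesis by simp
  qed
  have chi'_affine: "affine_map (\<lambda>x. chi' x as)" for as
    using comp_affine[OF chi] by (simp add: chi'_def)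
  have chi'_Lambda: "chi' x \<in> Lambda ?k W" for x
  proof -
    have "W \<subseteq> {w. chi (q + w) \<in> Lambda ?k W}"
      unfolding W_def
      by (rule span_minimal[OF _ subspace_Lambda_directions[OF chi]]) (use chi_P' q in auto)
    then show ?thesis using pr(2) by (auto simp: chi'_def \<pi>_def)
  qed
  define \<Psi> where "\<Psi> t x = \<Phi> t (\<pi> x)" for t x
  have \<Phi>_affine: "affine_map (\<Phi> t)" if "t \<in> {-\<epsilon><..<\<epsilon>}" for t using \<Phi> that by (auto simp: evolves_def)
  have vel: "velocity chi' (\<Psi> t) x = velocity chi (\<Phi> t) (\<pi> x)" if "t \<in> {-\<epsilon><..<\<epsilon>}" for t x
  proof -
    have lp: "linear_part (\<Psi> t) = linear_part (\<Phi> t) \<circ> pr"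
      using comp_affine[OF \<Phi>_affine[OF that]] by (simp add: \<Psi>_def[abs_def])
    note lin = affine_mapE(1)[OF \<Phi>_affine[OF that]]
    have "contract_ReOmega (pushforward ?k (linear_part (\<Phi> t) \<circ> pr) (chi' x))
        = contract_ReOmega (pushforward ?k (linear_part (\<Phi> t)) (chi' x))"
      by (rule contract_pushforward_cong[OF linear_compose[OF pr(1) lin] lin _ chi'_Lambda]) (simp add: pr(3))
    then show ?thesis by (simp only: velocity_def lp chi'_def)
  qed
  have ev: "evolves {-\<epsilon><..<\<epsilon>} chi' \<Psi>"
    unfolding evolves_def
  proof (intro ballI conjI allI)
    fix t x assume t: "t \<in> {-\<epsilon><..<\<epsilon>}"
    show "affine_map (\<Psi> t)" using comp_affine[OF \<Phi>_affine[OF t]] by (simp add: \<Psi>_def[abs_def])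
    show "((\<lambda>s. \<Psi> s x) has_vector_derivative velocity chi' (\<Psi> t) x) (at t)"
      unfolding vel[OF t] unfolding \<Psi>_def using \<Phi> t by (auto simp: evolves_def)
  qed
  have vel0: "velocity chi' (\<Psi> t\<^sub>0) x = 0" for x
  proof -
    have "W \<subseteq> {w. velocity chi (\<Phi> t\<^sub>0) (q + w) = 0}"
      unfolding W_def
      by (rule span_minimal[OF _ subspace_zero_directions[OF affine_velocity[OF chi]]]) (use zero q in auto)
    then show ?thesis using pr(2) by (auto simp: vel[OF t(1)] \<pi>_def)
  qed
  have const: "evolves {-\<epsilon><..<\<epsilon>} chi' (\<lambda>_. \<Psi> t\<^sub>0)"
    using ev t(1) by (auto simp: evolves_def vel0)
  have seg: "closed_segment t\<^sub>0 t\<^sub>1 \<subseteq> {-\<epsilon><..<\<epsilon>}"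
    using t by (auto simp: closed_segment_eq_real_ivl split: if_splits)
  have "\<Psi> t\<^sub>1 = \<Psi> t\<^sub>0"
    by (rule evolves_unique[OF evolves_subset[OF ev seg] evolves_subset[OF const seg] refl])
  then have "velocity chi' (\<Psi> t\<^sub>1) p = 0" using vel0 by simp
  then show ?thesis using vel[OF t(2)] \<pi>_fix[OF p] by simp
qed

text \<open>In a chart \<open>G\<close> the relation \<open>omega X (L (G' u)) = 0\<close> holds along \<open>P\<close>. Its derivative in the
  direction \<open>v\<close> expresses \<open>omega (A (G' v)) (L (G' u))\<close> through the second derivative of \<open>G\<close>, which is
  symmetric in \<open>u\<close> and \<open>v\<close>. The left-hand side of the claim is the time derivative of
  \<open>omega (L u) (L v)\<close> along the evolution.\<close>

lemma omega_pullback_stationary: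
  fixes \<phi> :: "'a::euclidean_space \<Rightarrow> complex ^ 'm::{finite,linorder}"
  assumes chi: "\<And>as. affine_map (\<lambda>x. chi x as)" and \<phi>: "affine_map \<phi>"
    and tangent: "\<And>p. p \<in> nonsingular_points (CARD('m) - 1) P \<Longrightarrow>
      chi p \<in> Lambda (CARD('m) - 1) (tangent_space P p) \<and> chi p \<noteq> (\<lambda>_. 0)"
    and p: "p \<in> nonsingular_points (CARD('m) - 1) P" and uv: "u \<in> tangent_space P p" "v \<in> tangent_space P p"
  defines "L \<equiv> linear_part \<phi>" and "A \<equiv> linear_part (velocity chi \<phi>)"
  shows "omega (A u) (L v) + omega (L u) (A v) = 0"
proof -
  let ?k = "CARD('m) - 1" and ?X = "velocity chi \<phi>"
  obtain U V F G S where ch: "chart ?k P U V F G S" and pU: "p \<in> U \<inter> P"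
    using nonsingular_pointsE[OF p] by metis
  note c = chart_inverse[OF ch]
  have oV: "open V" and Gs: "G smooth_on V" using ch by (auto simp: chart_def)
  define s where "s = F p"
  have s: "s \<in> V" "s \<in> S" "G s = p" using c(5)[OF pU] c(2) pU by (auto simp: s_def)
  let ?D = "\<lambda>u y. frechet_derivative G (at y) u"
  let ?D2 = "\<lambda>u v. frechet_derivative (?D u) (at s) v"
  have X_affine: "affine_map ?X" by (rule affine_velocity[OF chi])
  have linL: "linear L" and linA: "linear A"
    unfolding L_def A_def by (rule affine_mapE(1)[OF \<phi>], rule affine_mapE(1)[OF X_affine])
  have key: "omega (A (?D v' s)) (L (?D u' s)) = - omega (?X p) (L (?D2 u' v'))" if u'v': "u' \<in> S" "v' \<in> S" for u' v'
  proof -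
    obtain \<delta> where \<delta>: "0 < \<delta>" and VS: "\<And>\<tau>. \<bar>\<tau>\<bar> < \<delta> \<Longrightarrow> s + \<tau> *\<^sub>R v' \<in> V \<inter> S"
      using chart_short_line[OF ch _ u'v'(2), of s] s by blast
    have line: "((\<lambda>\<tau>. s + \<tau> *\<^sub>R v') has_vector_derivative v') (at 0)" by (auto intro!: derivative_eq_intros)
    have "((\<lambda>\<tau>. G (s + \<tau> *\<^sub>R v')) has_vector_derivative ?D v' s) (at 0)"
      using has_vector_derivative_smooth_compose[OF Gs line] s by simp
    then have "((\<lambda>\<tau>. A (G (s + \<tau> *\<^sub>R v'))) has_vector_derivative A (?D v' s)) (at 0)"
      by (rule bounded_linear.has_vector_derivative[OF linear_conv_bounded_linear[THEN iffD1, OF linA]])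
    then have "((\<lambda>\<tau>. ?X 0 + A (G (s + \<tau> *\<^sub>R v'))) has_vector_derivative 0 + A (?D v' s)) (at 0)"
      by (intro has_vector_derivative_add has_vector_derivative_const)
    then have dX: "((\<lambda>\<tau>. ?X (G (s + \<tau> *\<^sub>R v'))) has_vector_derivative A (?D v' s)) (at 0)"
      unfolding A_def using affine_mapE(2)[OF X_affine, symmetric] by simp
    have "((\<lambda>\<tau>. ?D u' (s + \<tau> *\<^sub>R v')) has_vector_derivative ?D2 u' v') (at 0)"
      using has_vector_derivative_smooth_compose[OF smooth_on_frechet_derivative[OF Gs, of u'] line] s by simp
    then have dL: "((\<lambda>\<tau>. L (?D u' (s + \<tau> *\<^sub>R v'))) has_vector_derivative L (?D2 u' v')) (at 0)"
      by (rule bounded_linear.has_vector_derivative[OF linear_conv_bounded_linear[THEN iffD1, OF linL]])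
    from omega.has_vector_derivative[OF dX dL]
    have "((\<lambda>\<tau>. omega (?X (G (s + \<tau> *\<^sub>R v'))) (L (?D u' (s + \<tau> *\<^sub>R v')))) has_vector_derivative
        omega (?X p) (L (?D2 u' v')) + omega (A (?D v' s)) (L (?D u' s))) (at 0)"
      using s by simp
    moreover have "((\<lambda>\<tau>. omega (?X (G (s + \<tau> *\<^sub>R v'))) (L (?D u' (s + \<tau> *\<^sub>R v')))) has_vector_derivative 0) (at 0)"
    proof (rule has_vector_derivative_transform_within_open[OF has_vector_derivative_const])
      fix \<tau> :: real assume "\<tau> \<in> ball 0 \<delta>"
      then have z: "s + \<tau> *\<^sub>R v' \<in> V \<inter> S" using VS by simp
      let ?z = "s + \<tau> *\<^sub>R v'"
      have Gz: "G ?z \<in> U \<inter> P" using c(6)[OF z] .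
      have ns: "G ?z \<in> nonsingular_points ?k P" by (rule chart_nonsingular[OF ch Gz])
      have "?D u' ?z \<in> tangent_space P (G ?z)"
        using chart_tangent_space[OF ch Gz] c(4) z u'v' by simp
      then show "0 = omega (?X (G ?z)) (L (?D u' ?z))"
        using velocity_orthogonal(2)[OF \<phi> nonsingular_tangent_space[OF ns], of chi] tangent[OF ns]
        unfolding L_def by simp
    qed (use \<delta> in auto)
    ultimately have "omega (?X p) (L (?D2 u' v')) + omega (A (?D v' s)) (L (?D u' s)) = 0"
      using vector_derivative_unique_at by blast
    then show ?thesis by simp
  qed
  have T: "tangent_space P p = (\<lambda>u. ?D u s) ` S" using chart_tangent_space[OF ch pU] by (simp add: s_def)
  then obtain u' v' where u': "u' \<in> S" "u = ?D u' s" and v': "v' \<in> S" "v = ?D v' s" using uv by auto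
  have "?D2 u' v' = ?D2 v' u'" by (rule second_derivative_symmetric[OF Gs oV s(1)])
  then have "omega (A u) (L v) = omega (A v) (L u)"
    using key[OF u'(1) v'(1)] key[OF v'(1) u'(1)] u' v' by simp
  then show ?thesis using omega_antisym[of "L u" "A v"] by simp
qed

text \<open>\<open>D\<^sub>0\<close> is the dense set on which the initial map is an immersion.\<close>

locale affine_evolution =
  fixes P :: "'a::euclidean_space set" and chi :: "'a \<Rightarrow> 'a list \<Rightarrow> real"
    and \<Phi> :: "real \<Rightarrow> 'a \<Rightarrow> complex ^ 'm::{finite,linorder}" and \<epsilon> :: real and D\<^sub>0 :: "'a set"
  assumes dense_nonsingular: "P \<subseteq> closure (nonsingular_points (CARD('m) - 1) P)"
    and chi_affine: "\<And>as. affine_map (\<lambda>x. chi x as)"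
    and chi_tangent: "\<And>p. p \<in> nonsingular_points (CARD('m) - 1) P \<Longrightarrow>
      chi p \<in> Lambda (CARD('m) - 1) (tangent_space P p) \<and> chi p \<noteq> (\<lambda>_. 0)"
    and evolves: "evolves {-\<epsilon><..<\<epsilon>} chi \<Phi>" and \<epsilon>: "0 < \<epsilon>"
    and initially_isotropic: "\<And>p u v. p \<in> nonsingular_points (CARD('m) - 1) P \<Longrightarrow> u \<in> tangent_space P p \<Longrightarrow>
      v \<in> tangent_space P p \<Longrightarrow> omega (linear_part (\<Phi> 0) u) (linear_part (\<Phi> 0) v) = 0"
    and initially_dense: "P \<subseteq> closure D\<^sub>0"
    and initially_injective: "\<And>p. p \<in> D\<^sub>0 \<Longrightarrow> p \<in> nonsingular_points (CARD('m) - 1) P \<and>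
      inj_on (linear_part (\<Phi> 0)) (tangent_space P p)"
begin

abbreviation "L t \<equiv> linear_part (\<Phi> t)"
abbreviation "X t \<equiv> velocity chi (\<Phi> t)"
abbreviation "I \<equiv> {-\<epsilon><..<\<epsilon>}"

text \<open>Nonvanishing of the velocity implies injectivity on the tangent space, and unlike injectivity it
  can be followed in time through uniqueness of solutions.\<close>

definition immersed_points :: "real \<Rightarrow> 'a set" where
  "immersed_points t = {p \<in> nonsingular_points (CARD('m) - 1) P. X t p \<noteq> 0}"

lemma affine: "t \<in> I \<Longrightarrow> affine_map (\<Phi> t)"
  using evolves by (auto simp: evolves_def)

lemma derivative: "t \<in> I \<Longrightarrow> ((\<lambda>s. \<Phi> s x) has_vector_derivative X t x) (at t)"
  using evolves by (auto simp: evolves_def)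

lemma derivative_linear_part: "t \<in> I \<Longrightarrow> ((\<lambda>s. L s u) has_vector_derivative linear_part (X t) u) (at t)"
  unfolding linear_part_def by (intro has_vector_derivative_diff derivative)

lemma isotropic:
  assumes t: "t \<in> I" and p: "p \<in> nonsingular_points (CARD('m) - 1) P" "u \<in> tangent_space P p" "v \<in> tangent_space P p"
  shows "omega (L t u) (L t v) = 0"
proof -
  have "((\<lambda>s. omega (L s u) (L s v)) has_vector_derivative 0) (at s)" if s: "s \<in> I" for s
    using omega.has_vector_derivative[OF derivative_linear_part[OF s, of u] derivative_linear_part[OF s, of v]]
      omega_pullback_stationary[OF chi_affine affine[OF s] chi_tangent p]
    by (simp add: add.commute)
  then have "((\<lambda>s. omega (L s u) (L s v)) has_derivative (\<lambda>_. 0)) (at s within I)" if "s \<in> I" for s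
    using that has_derivative_at_withinI by (fastforce simp: has_vector_derivative_def)
  then have "omega (L t u) (L t v) = omega (L 0 u) (L 0 v)"
    using \<epsilon> t by (intro has_derivative_zero_unique[of I]) auto
  then show ?thesis using initially_isotropic[OF p] by simp
qed

lemma immersed_points_relatively_open:
  assumes "p \<in> immersed_points t"
  obtains U where "open U" "p \<in> U" "U \<inter> P \<subseteq> immersed_points t"
proof -
  have "continuous_on UNIV (X t)" by (intro affine_map_continuous affine_velocity chi_affine)
  then have "open (X t -` (- {0}))" by (intro open_vimage) auto
  moreover obtain U where "open U" "p \<in> U" "U \<inter> P \<subseteq> nonsingular_points (CARD('m) - 1) P"
    using assms nonsingular_points_relatively_open unfolding immersed_points_def by blast
  ultimately show ?thesis
    using assms by (intro that[of "U \<inter> X t -` (- {0})"]) (auto simp: immersed_points_def)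
qed

text \<open>If the velocity vanished on a relatively open piece \<open>P'\<close> of the nonsingular points at time \<open>t\<close>, it
  would vanish there at time \<open>0\<close> as well. But \<open>P'\<close> meets the dense set \<open>D\<^sub>0\<close>, where the initial map is
  injective and isotropic on tangent spaces, so that its velocity is nonzero.\<close>

lemma immersed_points_dense:
  assumes t: "t \<in> I" shows "P \<subseteq> closure (immersed_points t)"
proof
  fix p assume p: "p \<in> P"
  show "p \<in> closure (immersed_points t)"
  proof (rule ccontr)
    assume "p \<notin> closure (immersed_points t)"
    then have oB: "open (- closure (immersed_points t))" and pB: "p \<in> - closure (immersed_points t)" by auto
    define P' where "P' = nonsingular_points (CARD('m) - 1) P - closure (immersed_points t)"
    obtain q where q: "q \<in> D\<^sub>0" "q \<in> - closure (immersed_points t)"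
      using initially_dense p oB pB open_Int_closure_eq_empty[OF oB, of D\<^sub>0] by blast
    have qP: "q \<in> P'" using q initially_injective by (auto simp: P'_def)
    have zero: "X t p = 0" if "p \<in> P'" for p
      using that closure_subset[of "immersed_points t"] by (auto simp: P'_def immersed_points_def)
    have chi_P': "chi p \<in> Lambda (CARD('m) - 1) (span ((\<lambda>p. p - q) ` P'))" if p: "p \<in> P'" for p
    proof -
      let ?W = "span ((\<lambda>p. p - q) ` P')"
      have pP0: "p \<in> nonsingular_points (CARD('m) - 1) P" using p by (simp add: P'_def)
      obtain U where U: "open U" "p \<in> U" "U \<inter> P \<subseteq> nonsingular_points (CARD('m) - 1) P"
        using nonsingular_points_relatively_open[OF pP0] by metis
      let ?U = "U - closure (immersed_points t)"
      have "open ?U" "p \<in> ?U" "?U \<inter> P \<subseteq> P'" using U p by (auto simp: P'_def)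
      then have "tangent_space P p \<subseteq> tangent_space P' p"
        using tangent_space_Int_open[of ?U p P] tangent_space_mono[of "?U \<inter> P" P' p] by simp
      also have "\<dots> \<subseteq> ?W"
      proof (rule tangent_space_subset_subspace[OF subspace_span])
        show "x - p \<in> ?W" if "x \<in> P'" for x
          using span_diff[of "x - q" "(\<lambda>p. p - q) ` P'" "p - q"] that p by (simp add: span_base)
      qed
      finally have "tangent_space P p \<subseteq> ?W" .
      then have "Lambda (CARD('m) - 1) (tangent_space P p) \<subseteq> Lambda (CARD('m) - 1) ?W"
        unfolding Lambda_def by blast
      then show ?thesis using chi_tangent[OF pP0] by blast
    qed
    have 0: "0 \<in> I" using \<epsilon> by simp
    have "X 0 q = 0"
      by (rule velocity_zero_persists[OF chi_affine evolves qP chi_P' t 0 zero qP])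
    moreover have qP0: "q \<in> nonsingular_points (CARD('m) - 1) P" and inj: "inj_on (L 0) (tangent_space P q)"
      using initially_injective[OF q(1)] by auto
    have "X 0 q \<noteq> 0"
      using velocity_nonzero_if_inj[OF affine[OF 0] nonsingular_tangent_space[OF qP0], of chi]
        chi_tangent[OF qP0] isotropic[OF 0 qP0] inj by blast
    ultimately show False by simp
  qed
qed

lemma immersed_points_injective:
  assumes t: "t \<in> I" and p: "p \<in> immersed_points t"
  shows "inj_on (L t) (tangent_space P p)"
proof -
  have pP: "p \<in> nonsingular_points (CARD('m) - 1) P" "X t p \<noteq> 0" using p by (auto simp: immersed_points_def)
  show ?thesis
    using velocity_nonzero_imp_inj[OF affine[OF t] nonsingular_tangent_space[OF pP(1)], of chi] chi_tangent[OF pP(1)] pP(2)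
    by blast
qed

end


section \<open>The submanifold swept out by the evolution\<close>

text \<open>These are the planes that become special Lagrangian in a suitable orientation, without a choice
  of that orientation. The conditions are closed, so they pass to limits.\<close>

definition special_lagrangian_plane :: "(complex ^ 'm::finite) set \<Rightarrow> bool" where
  "special_lagrangian_plane T \<longleftrightarrow> subspace T \<and> dim T = CARD('m) \<and>
     (\<forall>u\<in>T. \<forall>v\<in>T. omega u v = 0) \<and> (\<forall>v. (\<forall>i. v i \<in> T) \<longrightarrow> Im (Omega v) = 0)"

lemma orthonormal_frame_exists:
  fixes T :: "'a::euclidean_space set"
  assumes "subspace T" "dim T = CARD('m::finite)"
  obtains e :: "'m::finite \<Rightarrow> 'a" where "\<And>i j. e i \<bullet> e j = (if i = j then 1 else 0)" "span (range e) = T"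
proof -
  obtain B where B: "pairwise orthogonal B" "\<And>x. x \<in> B \<Longrightarrow> norm x = 1" "independent B" "card B = CARD('m)" "span B = T"
    using orthonormal_basis_subspace[OF assms(1)] assms(2) by metis
  have "finite B" using B independent_bound by blast
  then obtain e :: "'m \<Rightarrow> 'a" where e: "bij_betw e UNIV B"
    using finite_same_card_bij[of "UNIV :: 'm set" B] B(4) by auto
  then have eB: "e i \<in> B" and inj: "e i = e j \<longleftrightarrow> i = j" for i j
    by (auto simp: bij_betw_def inj_on_def)
  have "e i \<bullet> e j = (if i = j then 1 else 0)" for i j
    using B(1) B(2)[OF eB] eB[of i] eB[of j] inj[of i j]
    by (auto simp: pairwise_def orthogonal_def norm_eq_1)
  then show ?thesis using that[of e] e B(5) by (simp add: bij_betw_def)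
qed

lemma orthonormal_frame_expansion:
  fixes e :: "'m::finite \<Rightarrow> 'a::euclidean_space"
  assumes on: "\<And>i j. e i \<bullet> e j = (if i = j then 1 else 0)" and v: "v \<in> span (range e)"
  shows "v = (\<Sum>j\<in>UNIV. (v \<bullet> e j) *\<^sub>R e j)"
proof -
  have lin: "linear (\<lambda>v. \<Sum>j\<in>UNIV. (v \<bullet> e j) *\<^sub>R e j)"
    by (rule linearI) (simp_all add: inner_add_left scaleR_add_left sum.distrib scaleR_sum_right)
  have "(\<Sum>j\<in>UNIV. (x \<bullet> e j) *\<^sub>R e j) = x" if "x \<in> range e" for x
    using that by (auto simp: on if_distrib[of "\<lambda>r. r *\<^sub>R _"] sum.delta cong: if_cong)
  from linear_eq_on_span[OF lin linear_ident this v] show ?thesis by simp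
qed

lemma orthonormal_frame_independent:
  fixes e :: "'m::finite \<Rightarrow> 'a::real_inner"
  assumes on: "\<And>i j. e i \<bullet> e j = (if i = j then 1 else 0)" and s: "(\<Sum>i\<in>UNIV. r i *\<^sub>R e i) = 0"
  shows "r j = 0"
proof -
  have "(\<Sum>i\<in>UNIV. r i *\<^sub>R e i) \<bullet> e j = r j"
    by (simp add: inner_sum_left on if_distrib[of "\<lambda>x. _ * x"] sum.delta cong: if_cong)
  then show ?thesis using s by simp
qed

lemma in_span_range:
  fixes a :: "'m::finite \<Rightarrow> 'b::real_vector"
  assumes "v \<in> span (range a)" shows "\<exists>A. v = (\<Sum>j\<in>UNIV. A j *\<^sub>R a j)"
  using assms
proof (induction rule: span_induct_alt)
  case base
  show ?case by (rule exI[of _ "\<lambda>_. 0"]) simp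
next
  case (step c x y)
  then obtain A i where A: "y = (\<Sum>j\<in>UNIV. A j *\<^sub>R a j)" "x = a i" by auto
  have "c *\<^sub>R x = (\<Sum>j\<in>UNIV. (if j = i then c else 0) *\<^sub>R a j)"
    by (simp add: A(2) if_distrib[of "\<lambda>r. r *\<^sub>R _"] sum.delta cong: if_cong)
  then have "c *\<^sub>R x + y = (\<Sum>j\<in>UNIV. ((if j = i then c else 0) + A j) *\<^sub>R a j)"
    unfolding A(1) scaleR_add_left sum.distrib by simp
  then show ?case by (rule exI[of _ "\<lambda>j. (if j = i then c else 0) + A j"])
qed

lemma special_lagrangian_planeI:
  fixes a :: "'m::finite \<Rightarrow> complex ^ 'm"
  assumes "dim (span (range a)) = CARD('m)" "\<And>i j. omega (a i) (a j) = 0" "Im (Omega a) = 0"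
  shows "special_lagrangian_plane (span (range a))"
  unfolding special_lagrangian_plane_def
proof (intro conjI ballI allI impI)
  show "omega u v = 0" if "u \<in> span (range a)" "v \<in> span (range a)" for u v
    by (rule omega_zero_span[OF _ that]) (use assms(2) in auto)
  fix v :: "'m \<Rightarrow> complex ^ 'm" assume "\<forall>i. v i \<in> span (range a)"
  then have "\<forall>i. \<exists>A. v i = (\<Sum>j\<in>UNIV. A j *\<^sub>R a j)"
    using in_span_range by blast
  from choice[OF this] obtain A where A: "\<forall>i. v i = (\<Sum>j\<in>UNIV. A i j *\<^sub>R a j)" ..
  then have "v = (\<lambda>i. \<Sum>j\<in>UNIV. A i j *\<^sub>R a j)" by auto
  then have "Omega v = Omega (\<lambda>i. \<Sum>j\<in>UNIV. A i j *\<^sub>R a j)" by (rule arg_cong)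
  also have "\<dots> = of_real (det (\<chi> i j. A i j)) * Omega a" by (rule Omega_real_combination)
  finally have "Omega v = of_real (det (\<chi> i j. A i j)) * Omega a" .
  then show "Im (Omega v) = 0" using assms(3) by simp
qed (use assms(1) in auto)

text \<open>At an orthonormal basis \<open>\<Omega>\<close> has modulus \<open>1\<close> and is real. If it is \<open>-1\<close>, the sign of one vector is
  changed.\<close>

lemma special_lagrangian_plane_oriented_basis:
  fixes T :: "(complex ^ 'm::finite) set"
  assumes T: "special_lagrangian_plane T"
  obtains e :: "'m \<Rightarrow> complex ^ 'm" where "\<And>i j. e i \<bullet> e j = (if i = j then 1 else 0)" "span (range e) = T" "Omega e = 1"
proof -
  obtain e :: "'m \<Rightarrow> complex ^ 'm" where e: "\<And>i j. e i \<bullet> e j = (if i = j then 1 else 0)" "span (range e) = T"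
    using orthonormal_frame_exists[of T] T by (auto simp: special_lagrangian_plane_def)
  have eT: "e i \<in> T" for i using e(2) span_base[of "e i" "range e"] by simp
  have "cmod (Omega e) = 1"
    using T eT by (intro Omega_orthonormal_lagrangian e) (auto simp: special_lagrangian_plane_def)
  moreover have im: "Im (Omega e) = 0" using T eT by (auto simp: special_lagrangian_plane_def)
  ultimately have "\<bar>Re (Omega e)\<bar> = 1" by (simp add: cmod_def)
  then consider "Omega e = 1" | "Omega e = - 1" using im by (auto simp: complex_eq_iff abs_if split: if_splits)
  then show ?thesis
  proof cases
    case 1
    then show ?thesis using that e by blast
  next
    case 2
    \<comment> \<open>Any coordinate will do.\<close>
    fix i\<^sub>0 :: 'm
    define e' where "e' = e(i\<^sub>0 := - 1 *s e i\<^sub>0)"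
    have e': "e' i = (if i = i\<^sub>0 then - e i else e i)" for i
      by (auto simp: e'_def vec_eq_iff)
    have "Omega e' = - 1 * Omega (e(i\<^sub>0 := e i\<^sub>0))" unfolding e'_def by (rule Omega_update_scale)
    then have "Omega e' = 1" using 2 by simp
    moreover have "e' i \<bullet> e' j = (if i = j then 1 else 0)" for i j
      using e(1)[of i j] by (auto simp: e')
    moreover have "span (range e') = T"
    proof -
      have "e i \<in> span (range e')" for i
        using span_base[of "e' i" "range e'"] span_neg[of "e' i" "range e'"] by (auto simp: e' split: if_splits)
      moreover have "e' i \<in> span (range e)" for i
        using span_base[of "e i" "range e"] span_neg[of "e i" "range e"] by (auto simp: e')
      ultimately have "span (range e') = span (range e)" by (intro span_eq[THEN iffD2]) auto
      then show ?thesis using e(2) by simp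
    qed
    ultimately show ?thesis using that[of e'] by blast
  qed
qed

lemma Omega_eq_vol_form:
  fixes e :: "'m::finite \<Rightarrow> complex ^ 'm"
  assumes "\<And>i j. e i \<bullet> e j = (if i = j then 1 else 0)" "Omega e = 1" "\<And>i. v i \<in> span (range e)"
  shows "Omega v = of_real (vol_form e v)"
proof -
  have "v = (\<lambda>i. \<Sum>j\<in>UNIV. (v i \<bullet> e j) *\<^sub>R e j)"
    by (rule ext) (rule orthonormal_frame_expansion[OF assms(1,3)])
  then have "Omega v = Omega (\<lambda>i. \<Sum>j\<in>UNIV. (v i \<bullet> e j) *\<^sub>R e j)" by (rule arg_cong)
  also have "\<dots> = of_real (det (\<chi> i j. v i \<bullet> e j)) * Omega e" by (rule Omega_real_combination)
  finally show ?thesis using assms(2) by (simp add: vol_form_def)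
qed

lemma continuous_on_Omega:
  assumes "\<And>i. continuous_on U (\<lambda>y. f y i)"
  shows "continuous_on U (\<lambda>y. Omega (f y))"
  unfolding Omega_def det_def using assms by (auto intro!: continuous_intros)

definition tangent_frame :: "'a::euclidean_space set \<Rightarrow> 'a set \<Rightarrow> ('a \<Rightarrow> 'm::finite \<Rightarrow> 'a) \<Rightarrow> bool" where
  "tangent_frame U M f \<longleftrightarrow> (\<forall>i. continuous_on U (\<lambda>y. f y i)) \<and>
    (\<forall>y\<in>U \<inter> M. span (range (f y)) = tangent_space M y \<and>
      (\<forall>r. (\<Sum>i\<in>UNIV. r i *\<^sub>R f y i) = 0 \<longrightarrow> (\<forall>i. r i = 0)))"

lemma tangent_frame_tangent: "tangent_frame U M f \<Longrightarrow> y \<in> U \<inter> M \<Longrightarrow> f y i \<in> tangent_space M y"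
  using span_base[of "f y i" "range (f y)"] by (simp add: tangent_frame_def)

text \<open>The derivative of the inverse chart carries a fixed basis of the linear model to tangent vectors
  that depend continuously on the point.\<close>

lemma chart_tangent_frame:
  fixes M :: "'a::euclidean_space set"
  assumes ch: "chart CARD('m::finite) M U V F G S"
  shows "\<exists>f :: 'a \<Rightarrow> 'm::finite \<Rightarrow> 'a. tangent_frame U M f"
proof -
  note c = chart_inverse[OF ch]
  have S: "subspace S" "dim S = CARD('m)" and Gs: "G smooth_on V" and Fs: "F smooth_on U"
    using ch by (auto simp: chart_def)
  obtain b :: "'m \<Rightarrow> 'a" where b: "\<And>i j. b i \<bullet> b j = (if i = j then 1 else 0)" "span (range b) = S"
    using orthonormal_frame_exists[OF S] by metis
  define f where "f y i = frechet_derivative G (at (F y)) (b i)" for y i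
  show ?thesis
    unfolding tangent_frame_def
  proof (rule exI[of _ f], intro conjI allI ballI impI)
    show "continuous_on U (\<lambda>y. f y i)" for i
      unfolding f_def
      by (rule continuous_on_compose2[OF smooth_on_continuous[OF smooth_on_frechet_derivative[OF Gs]]
            smooth_on_continuous[OF Fs]]) (use c(1) in auto)
    fix y assume y: "y \<in> U \<inter> M"
    note lin = chart_tangent_space_subspace(3)[OF ch y] and inj = chart_tangent_space_subspace(4)[OF ch y]
    show "span (range (f y)) = tangent_space M y"
      unfolding chart_tangent_space[OF ch y] b(2)[symmetric] linear_span_image[OF lin, symmetric]
      by (simp add: f_def image_image)
    fix r i assume "(\<Sum>i\<in>UNIV. r i *\<^sub>R f y i) = 0"
    then have "frechet_derivative G (at (F y)) (\<Sum>i\<in>UNIV. r i *\<^sub>R b i) = frechet_derivative G (at (F y)) 0"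
      by (simp add: f_def linear_sum[OF lin] linear_scale[OF lin] linear_0[OF lin])
    then have "(\<Sum>i\<in>UNIV. r i *\<^sub>R b i) = 0" using inj by (simp add: inj_eq)
    then show "r i = 0" by (rule orthonormal_frame_independent[OF b(1)])
  qed
qed

lemma continuous_zero_closure:
  fixes g :: "'a::metric_space \<Rightarrow> 'b::metric_space"
  assumes "continuous_on U g" "open U" "x \<in> U" "x \<in> closure Q" "\<And>y. y \<in> U \<inter> Q \<Longrightarrow> g y = c"
  shows "g x = c"
proof (rule ccontr)
  assume "g x \<noteq> c"
  then obtain e where e: "0 < e" "\<And>y. dist x y < e \<Longrightarrow> g y \<noteq> c"
    using continuous_on_open_avoid[OF assms(1,2,3)] by blast
  obtain r where r: "0 < r" "ball x r \<subseteq> U" using assms(2,3) openE by blast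
  obtain y where "y \<in> Q" "dist y x < min e r"
    using assms(4) e(1) r(1) unfolding closure_approachable by (metis min_less_iff_conj)
  then show False using e(2)[of y] r(2) assms(5)[of y] by (auto simp: dist_commute subset_eq)
qed

text \<open>In a continuous tangent frame the values of \<open>\<omega>\<close> and \<open>Im \<Omega>\<close> are continuous functions, which vanish on
  \<open>Q\<close>.\<close>

lemma special_lagrangian_plane_closure:
  fixes M :: "(complex ^ 'm::finite) set"
  assumes ch: "chart CARD('m) M U V F G S" and x: "x \<in> U \<inter> M" "x \<in> closure Q"
    and Q: "\<And>y. y \<in> Q \<Longrightarrow> y \<in> M \<and> special_lagrangian_plane (tangent_space M y)"
  shows "special_lagrangian_plane (tangent_space M x)"
proof -
  have oU: "open U" using ch by (simp add: chart_def)
  from chart_tangent_frame[OF ch] obtain f :: "complex ^ 'm \<Rightarrow> 'm \<Rightarrow> complex ^ 'm" where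
    frame: "tangent_frame U M f" ..
  then have f: "continuous_on U (\<lambda>y. f y i)"
    "y \<in> U \<inter> M \<Longrightarrow> span (range (f y)) = tangent_space M y" for i y
    by (simp_all add: tangent_frame_def)
  note fT = tangent_frame_tangent[OF frame]
  have "omega (f x i) (f x j) = 0" for i j
  proof (rule continuous_zero_closure[OF _ oU _ x(2)])
    show "continuous_on U (\<lambda>y. omega (f y i) (f y j))" by (intro omega.continuous_on f(1))
    show "omega (f y i) (f y j) = 0" if "y \<in> U \<inter> Q" for y
      using Q[of y] fT[of y] that by (auto simp: special_lagrangian_plane_def)
  qed (use x in auto)
  moreover have "Im (Omega (f x)) = 0"
  proof (rule continuous_zero_closure[OF _ oU _ x(2)])
    show "continuous_on U (\<lambda>y. Im (Omega (f y)))" by (intro continuous_intros continuous_on_Omega f(1))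
    show "Im (Omega (f y)) = 0" if "y \<in> U \<inter> Q" for y
      using Q[of y] fT[of y] that by (auto simp: special_lagrangian_plane_def)
  qed (use x in auto)
  moreover have "dim (span (range (f x))) = CARD('m)"
    unfolding f(2)[OF x(1)] by (rule chart_tangent_space_subspace(2)[OF ch x(1)])
  ultimately show ?thesis using special_lagrangian_planeI[of "f x"] f(2)[OF x(1)] by simp
qed

text \<open>The basis \<open>e x\<close> with \<open>\<Omega>(e x) = 1\<close> orients each tangent plane. A chart frame \<open>f\<close> has determinant
  \<open>Re \<Omega>(f)\<close> with respect to it, which is continuous and nonzero; scaling one vector by the sign of
  its value at \<open>x\<close> makes it positive near \<open>x\<close>.\<close>

lemma special_lagrangian_if_tangent_planes:
  fixes M :: "(complex ^ 'm::finite) set"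
  assumes M: "submanifold CARD('m) M" and plane: "\<And>x. x \<in> M \<Longrightarrow> special_lagrangian_plane (tangent_space M x)"
  shows "\<exists>e. special_lagrangian M e"
proof -
  have "\<exists>e. (\<forall>i j. e i \<bullet> e j = (if i = j then 1 else 0)) \<and> span (range e) = tangent_space M x \<and> Omega e = 1"
    if "x \<in> M" for x
    using special_lagrangian_plane_oriented_basis[OF plane[OF that]] by metis
  then obtain e :: "complex ^ 'm \<Rightarrow> 'm \<Rightarrow> complex ^ 'm" where
    e: "\<And>x i j. x \<in> M \<Longrightarrow> e x i \<bullet> e x j = (if i = j then 1 else 0)"
    "\<And>x. x \<in> M \<Longrightarrow> span (range (e x)) = tangent_space M x" "\<And>x. x \<in> M \<Longrightarrow> Omega (e x) = 1"
    by metis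
  have vol: "Omega v = of_real (vol_form (e x) v)" if "x \<in> M" "\<And>i. v i \<in> tangent_space M x" for x v
    using that e by (intro Omega_eq_vol_form) auto
  have orient: "\<exists>U f. open U \<and> x \<in> U \<and> (\<forall>i. continuous_on (M \<inter> U) (\<lambda>y. f y i)) \<and>
        (\<forall>y\<in>M \<inter> U. (\<forall>i. f y i \<in> tangent_space M y) \<and> det (\<chi> i j. f y i \<bullet> e y j) > 0)" if x: "x \<in> M" for x
  proof -
    obtain U V F G S where ch: "chart CARD('m) M U V F G S" and xU: "x \<in> U \<inter> M"
      using M x unfolding submanifold_def nonsingular_point_iff_chart by (metis IntI)
    have oU: "open U" using ch by (simp add: chart_def)
    from chart_tangent_frame[OF ch] obtain f :: "complex ^ 'm \<Rightarrow> 'm \<Rightarrow> complex ^ 'm" where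
      frame: "tangent_frame U M f" ..
    then have f: "continuous_on U (\<lambda>y. f y i)"
      "y \<in> U \<inter> M \<Longrightarrow> (\<Sum>i\<in>UNIV. r i *\<^sub>R f y i) = 0 \<Longrightarrow> \<forall>i. r i = 0" for i y r
      by (simp_all add: tangent_frame_def)
    note fT = tangent_frame_tangent[OF frame]
    have "omega (f x i) (f x j) = 0" for i j
      using plane[OF x] fT[OF xU] by (auto simp: special_lagrangian_plane_def)
    then have "Omega (f x) \<noteq> 0" using f(2)[OF xU] by (intro Omega_nonzero_if_isotropic) auto
    moreover have "Im (Omega (f x)) = 0"
      using plane[OF x] fT[OF xU] by (auto simp: special_lagrangian_plane_def)
    ultimately have Re_nz: "Re (Omega (f x)) \<noteq> 0" by (simp add: complex_eq_iff)
    fix i\<^sub>0 :: 'm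
    define s where "s = sgn (Re (Omega (f x)))"
    define f' where "f' y = (f y)(i\<^sub>0 := complex_of_real s *s f y i\<^sub>0)" for y
    have f': "f' y i = (if i = i\<^sub>0 then s *\<^sub>R f y i else f y i)" for y i
      by (simp add: f'_def scaleR_eq_vector_mult)
    have cont: "continuous_on U (\<lambda>y. f' y i)" for i
      unfolding f' using f(1) by (cases "i = i\<^sub>0") (auto intro!: continuous_intros)
    have f'T: "f' y i \<in> tangent_space M y" if y: "y \<in> U \<inter> M" for y i
      using fT[OF y] subspace_scale[OF chart_tangent_space_subspace(1)[OF ch y]] by (simp add: f')
    have "Omega (f' x) = of_real s * Omega (f x)"
      unfolding f'_def Omega_update_scale by simp
    then have pos: "0 < Re (Omega (f' x))" using Re_nz by (simp add: s_def sgn_if)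
    have "continuous_on U (\<lambda>y. Re (Omega (f' y)))"
      by (intro continuous_intros continuous_on_Omega cont)
    then have "open (U \<inter> (\<lambda>y. Re (Omega (f' y))) -` {0<..})"
      using oU by (intro continuous_open_preimage) auto
    moreover have "det (\<chi> i j. f' y i \<bullet> e y j) > 0" if "y \<in> M" "y \<in> U" "0 < Re (Omega (f' y))" for y
      using vol[of y "f' y"] f'T[of y] that by (simp add: vol_form_def)
    ultimately show ?thesis
      using xU pos f'T
      by (intro exI[of _ "U \<inter> (\<lambda>y. Re (Omega (f' y))) -` {0<..}"] exI[of _ f'])
        (auto intro: continuous_on_subset[OF cont])
  qed
  have "special_lagrangian M e"
    unfolding special_lagrangian_def oriented_by_def using M e orient vol by auto
  then show ?thesis by blast
qed

lemma chart_nonsingular_points: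
  assumes "chart k N U V F G S" shows "chart k (nonsingular_points k N) U V F G S"
proof -
  have "U \<inter> nonsingular_points k N = U \<inter> N"
    using chart_nonsingular[OF assms] nonsingular_points_subset[of k N] by auto
  then show ?thesis using assms by (simp add: chart_def)
qed

lemma submanifold_nonsingular_points: "submanifold k (nonsingular_points k N)"
  unfolding submanifold_def nonsingular_point_iff_chart
  using chart_nonsingular_points nonsingular_pointsE by (metis IntD1)

text \<open>Near a nonsingular point all points of \<open>N\<close> are nonsingular.\<close>

lemma tangent_space_nonsingular_points:
  assumes x: "x \<in> nonsingular_points k N"
  shows "tangent_space N x \<subseteq> tangent_space (nonsingular_points k N) x"
proof -
  obtain U where U: "open U" "x \<in> U" "U \<inter> N \<subseteq> nonsingular_points k N"
    using nonsingular_points_relatively_open[OF x] by metis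
  then show ?thesis using tangent_space_Int_open[of U x N] tangent_space_mono[OF U(3), of x] by simp
qed

context affine_evolution
begin

definition swept :: "(complex ^ 'm::{finite,linorder}) set" where
  "swept = {\<Phi> t p | t p. t \<in> I \<and> p \<in> P}"

text \<open>The curves \<open>s \<mapsto> \<Phi> (t + s) q\<close> and \<open>s \<mapsto> \<Phi> t (\<gamma> s)\<close>, with \<open>\<gamma>\<close> a curve in \<open>P\<close>, show that the tangent space
  contains the velocity and the image of the tangent space of \<open>P\<close>. These span a subspace of
  dimension \<open>m\<close>, so they span everything.\<close>

lemma special_lagrangian_plane_at_immersed_point:
  assumes t: "t \<in> I" and q: "q \<in> immersed_points t" and y: "\<Phi> t q \<in> nonsingular_points CARD('m) swept"
  shows "special_lagrangian_plane (tangent_space (nonsingular_points CARD('m) swept) (\<Phi> t q))"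
proof -
  let ?T = "tangent_space (nonsingular_points CARD('m) swept) (\<Phi> t q)"
  have qP: "q \<in> nonsingular_points (CARD('m) - 1) P" and X0: "X t q \<noteq> 0"
    using q by (auto simp: immersed_points_def)
  have qP': "q \<in> P" using qP nonsingular_points_subset by blast
  have "\<Phi> t q \<in> nonsingular_points CARD('m) (nonsingular_points CARD('m) swept)"
    using submanifold_nonsingular_points[of "CARD('m)" swept] y
    by (simp add: submanifold_def nonsingular_points_def)
  note T = nonsingular_tangent_space[OF this]
  have "X t q \<in> tangent_space swept (\<Phi> t q)"
  proof -
    have "((\<lambda>s. \<Phi> (t + s) q) has_vector_derivative X t q) (at 0)"
      using evolves_shift[OF evolves, of "{0}" t] t by (auto simp: evolves_def)
    moreover have "\<Phi> (t + s) q \<in> swept" if "\<bar>s\<bar> < \<epsilon> - \<bar>t\<bar>" for s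
      unfolding swept_def using qP' that by (intro CollectI exI[of _ "t + s"] exI[of _ q]) auto
    moreover have "0 < \<epsilon> - \<bar>t\<bar>" using t by auto
    ultimately show ?thesis
      unfolding tangent_space_def
      by (intro CollectI exI[of _ "\<lambda>s. \<Phi> (t + s) q"] conjI exI[of _ "\<epsilon> - \<bar>t\<bar>"]) auto
  qed
  moreover have "L t w \<in> tangent_space swept (\<Phi> t q)" if "w \<in> tangent_space P q" for w
  proof -
    obtain \<gamma> \<delta> where \<gamma>: "\<gamma> 0 = q" "0 < \<delta>" "\<And>t. \<bar>t\<bar> < \<delta> \<Longrightarrow> \<gamma> t \<in> P"
      and d: "(\<gamma> has_vector_derivative w) (at (0::real))" using \<open>w \<in> _\<close> unfolding tangent_space_def by blast
    have "bounded_linear (L t)" using affine_mapE(1)[OF affine[OF t]] by (simp add: linear_conv_bounded_linear)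
    from has_vector_derivative_add[OF has_vector_derivative_const bounded_linear.has_vector_derivative[OF this d], of "\<Phi> t 0"]
    have "((\<lambda>s. \<Phi> t (\<gamma> s)) has_vector_derivative L t w) (at 0)"
      using affine_mapE(2)[OF affine[OF t], symmetric] by simp
    moreover have "\<Phi> t (\<gamma> s) \<in> swept" if "\<bar>s\<bar> < \<delta>" for s
      unfolding swept_def using t \<gamma>(3)[OF that] by blast
    ultimately show ?thesis
      unfolding tangent_space_def using \<gamma>(1,2) by (intro CollectI exI[of _ "\<lambda>s. \<Phi> t (\<gamma> s)"]) auto
  qed
  ultimately have sub: "insert (X t q) (L t ` tangent_space P q) \<subseteq> ?T"
    using tangent_space_nonsingular_points[OF y] by auto
  have "\<exists>a. span (range a) = span (insert (X t q) (L t ` tangent_space P q)) \<and> dim (span (range a)) = CARD('m) \<and>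
      (\<forall>i j. omega (a i) (a j) = 0) \<and> Im (Omega (a :: 'm \<Rightarrow> _)) = 0"
    using chi_tangent[OF qP]
    by (intro velocity_special_lagrangian_frame[OF affine[OF t] nonsingular_tangent_space[OF qP] _ _ X0] isotropic[OF t qP]) auto
  then obtain a :: "'m \<Rightarrow> complex ^ 'm::{finite,linorder}" where a: "span (range a) = span (insert (X t q) (L t ` tangent_space P q))"
    "dim (span (range a)) = CARD('m)" "\<And>i j. omega (a i) (a j) = 0" "Im (Omega a) = 0" by blast
  have "span (range a) = ?T"
    unfolding a(1)
  proof (rule subspace_dim_equal)
    show "span (insert (X t q) (L t ` tangent_space P q)) \<subseteq> ?T" by (rule span_minimal[OF sub T(1)])
    show "dim ?T \<le> dim (span (insert (X t q) (L t ` tangent_space P q)))" using T(2) a(1,2) by simp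
  qed (use T in auto)
  then show ?thesis using special_lagrangian_planeI[OF a(2,3,4)] by simp
qed

text \<open>Images of immersed points are dense in the swept set, since at each time the immersed points are
  dense in \<open>P\<close>. Their tangent planes determine all others by continuity.\<close>

theorem swept_special_lagrangian: "\<exists>e. special_lagrangian (nonsingular_points CARD('m) swept) e"
proof (rule special_lagrangian_if_tangent_planes[OF submanifold_nonsingular_points])
  let ?M = "nonsingular_points CARD('m) swept"
  let ?Q = "{y \<in> ?M. special_lagrangian_plane (tangent_space ?M y)}"
  fix x assume x: "x \<in> ?M"
  obtain U V F G S where ch: "chart CARD('m) swept U V F G S" and xU: "x \<in> U \<inter> swept"
    using nonsingular_pointsE[OF x] by metis
  have oU: "open U" using ch by (simp add: chart_def)
  obtain t p where tp: "t \<in> I" "p \<in> P" "x = \<Phi> t p" using xU unfolding swept_def by blast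
  have "x \<in> closure ?Q"
  proof (rule ccontr)
    assume nx: "x \<notin> closure ?Q"
    let ?O = "\<Phi> t -` (U - closure ?Q)"
    have oO: "open ?O" using oU by (intro open_vimage affine_map_continuous affine[OF tp(1)]) auto
    have "p \<in> ?O" using tp xU nx by auto
    then obtain q where q: "q \<in> immersed_points t" "q \<in> ?O"
      using immersed_points_dense[OF tp(1)] tp(2) open_Int_closure_eq_empty[OF oO, of "immersed_points t"] by blast
    have "q \<in> P" using q(1) nonsingular_points_subset unfolding immersed_points_def by blast
    then have "\<Phi> t q \<in> U \<inter> swept" using q(2) tp(1) unfolding swept_def by blast
    then have "\<Phi> t q \<in> ?M" by (rule chart_nonsingular[OF ch])
    then have "\<Phi> t q \<in> ?Q" using special_lagrangian_plane_at_immersed_point[OF tp(1) q(1)] by simp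
    then show False using q(2) closure_subset[of ?Q] by auto
  qed
  then show "special_lagrangian_plane (tangent_space ?M x)"
    by (rule special_lagrangian_plane_closure[OF chart_nonsingular_points[OF ch], rotated]) (use x xU in auto)
qed

end


section \<open>Existence, uniqueness and special Lagrangian geometry of the evolution\<close>

theorem theorem3p5:
  fixes P :: "(real ^ 'n) set"
    and chi :: "real ^ 'n \<Rightarrow> (real ^ 'n) list \<Rightarrow> real"
    and \<phi> :: "real ^ 'n \<Rightarrow> complex ^ 'm::{finite,linorder}"
  assumes "2 \<le> CARD('m)" and "CARD('m) \<le> CARD('n)"
    and "affine_evolution_data CARD('m) P chi"
    and "\<phi> \<in> C_set P"
  shows "\<exists>\<epsilon>>0. \<exists>\<Phi>. evolution_family P chi \<phi> \<epsilon> \<Phi> \<and>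
           (\<forall>\<Psi>. evolution_family P chi \<phi> \<epsilon> \<Psi> \<longrightarrow> (\<forall>t\<in>{-\<epsilon><..<\<epsilon>}. \<Psi> t = \<Phi> t)) \<and>
           (\<exists>e. special_lagrangian
                  (nonsingular_points CARD('m) {\<Phi> t p | t p. t \<in> {-\<epsilon><..<\<epsilon>} \<and> p \<in> P}) e)"
proof -
  let ?k = "CARD('m) - 1"
  have chi: "\<And>as. affine_map (\<lambda>x. chi x as)"
    and dense: "P \<subseteq> closure (nonsingular_points ?k P)"
    and tangent: "\<And>p. p \<in> nonsingular_points ?k P \<Longrightarrow>
      chi p \<in> Lambda ?k (tangent_space P p) \<and> chi p \<noteq> (\<lambda>_. 0)"
    using assms(3) by (auto simp: affine_evolution_data_def singular_submanifold_def)
  obtain D where \<phi>: "affine_map \<phi>" and D: "P \<subseteq> closure D"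
    and D_inj: "\<And>p. p \<in> D \<Longrightarrow> nonsingular_point ?k P p \<and> inj_on (linear_part \<phi>) (tangent_space P p)"
    and iso: "\<And>p u v. p \<in> nonsingular_points ?k P \<Longrightarrow> u \<in> tangent_space P p \<Longrightarrow> v \<in> tangent_space P p \<Longrightarrow>
      omega (linear_part \<phi> u) (linear_part \<phi> v) = 0"
    using assms(4) unfolding C_set_def by blast
  from evolution_local_analytic_solution[OF chi \<phi>]
  obtain \<epsilon> where "\<exists>\<Phi>. 0 < \<epsilon> \<and> evolves {-\<epsilon><..<\<epsilon>} chi \<Phi> \<and> \<Phi> 0 = \<phi> \<and>
      (\<forall>x. \<exists>a. \<forall>t. \<bar>t\<bar> < \<epsilon> \<longrightarrow> (\<lambda>n. t ^ n *\<^sub>R a n) sums \<Phi> t x)" ..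
  then obtain \<Phi> where "0 < \<epsilon> \<and> evolves {-\<epsilon><..<\<epsilon>} chi \<Phi> \<and> \<Phi> 0 = \<phi> \<and>
      (\<forall>x. \<exists>a. \<forall>t. \<bar>t\<bar> < \<epsilon> \<longrightarrow> (\<lambda>n. t ^ n *\<^sub>R a n) sums \<Phi> t x)" ..
  then have \<epsilon>: "0 < \<epsilon>" and ev: "evolves {-\<epsilon><..<\<epsilon>} chi \<Phi>" and \<Phi>0: "\<Phi> 0 = \<phi>" by simp_all
  interpret affine_evolution P chi \<Phi> \<epsilon> D
    using dense chi tangent ev \<epsilon> iso D D_inj
    by unfold_locales (auto simp: \<Phi>0 nonsingular_points_def)
  have "\<Phi> t \<in> C_set P" if t: "t \<in> {-\<epsilon><..<\<epsilon>}" for t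
    unfolding C_set_def
  proof (intro CollectI conjI ballI exI)
    show "affine_map (\<Phi> t)" by (rule affine[OF t])
    show "omega (linear_part (\<Phi> t) u) (linear_part (\<Phi> t) v) = 0"
      if "p \<in> nonsingular_points ?k P" "u \<in> tangent_space P p" "v \<in> tangent_space P p" for p u v
      by (rule isotropic[OF t that])
    show "P \<subseteq> closure (immersed_points t)" by (rule immersed_points_dense[OF t])
    show "openin (top_of_set P) (immersed_points t)"
    proof (subst openin_subopen, intro ballI)
      fix p assume p: "p \<in> immersed_points t"
      then obtain U where U: "open U" "p \<in> U" "U \<inter> P \<subseteq> immersed_points t"
        using immersed_points_relatively_open by metis
      have "p \<in> P" using p nonsingular_points_subset unfolding immersed_points_def by blast
      then show "\<exists>T. openin (top_of_set P) T \<and> p \<in> T \<and> T \<subseteq> immersed_points t"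
        using U by (intro exI[of _ "P \<inter> U"]) (auto intro: openin_open_Int)
    qed
    fix p assume p: "p \<in> immersed_points t"
    show "nonsingular_point ?k P p" using p by (simp add: immersed_points_def nonsingular_points_def)
    show "inj_on (linear_part (\<Phi> t)) (tangent_space P p)" by (rule immersed_points_injective[OF t p])
  qed
  then have family: "evolution_family P chi \<phi> \<epsilon> \<Phi>"
    unfolding evolution_family_def
    using \<Phi>0 evolves_analytic[OF chi ev] derivative by (simp add: velocity_def)
  have unique: "\<Psi> t = \<Phi> t" if \<Psi>: "evolution_family P chi \<phi> \<epsilon> \<Psi>" and t: "t \<in> {-\<epsilon><..<\<epsilon>}" for \<Psi> t
  proof -
    have ev': "evolves {-\<epsilon><..<\<epsilon>} chi \<Psi>" and eq0: "\<Psi> 0 = \<Phi> 0"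
      using \<Psi> \<Phi>0 by (auto simp: evolution_family_def evolves_def C_set_def velocity_def)
    have seg: "closed_segment 0 t \<subseteq> {-\<epsilon><..<\<epsilon>}"
      using t \<epsilon> by (auto simp: closed_segment_eq_real_ivl split: if_splits)
    show ?thesis by (rule evolves_unique[OF evolves_subset[OF ev' seg] evolves_subset[OF ev seg] eq0])
  qed
  show ?thesis
    using \<epsilon> family unique swept_special_lagrangian unfolding swept_def by blast
qed

end
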